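(* Let $H$ be a fixed undirected simple graph with at least three vertices. \begin{itemize} \item If $H$ is $P_3$, $\text{co-}P_3$ or $P_4$, then there is $q=\tilde O(1)$ such that $D^{q}(\textsc{IndSub}(H))=\tilde O(n)$. \item Otherwise, $R^p_{2/3}(\textsc{IndSub}(H))=\Omega(n^2/p)$. \end{itemize}
   Context: Insertion-only graph streaming model: the edges of an $n$-vertex input graph arrive as a stream in arbitrary order; the algorithm knows $n$, may scan the stream from beginning to end $p$ times (passes), and has $S$ bits of memory. $\textsc{IndSub}(H)$: given an $n$-vertex undirected simple graph $G$ (as a stream) and a fixed pattern graph $H$ (at least three vertices, possibly disconnected), decide whether $G$ contains $H$ as an induced subgraph, and if so output the vertex set of such a copy. $R^p_{2/3}(\Pi)$ is the minimum space of a randomized $p$-pass streaming algorithm solving $\Pi$ with success probability at least $2/3$; $D^p(\Pi)$ is the minimum space of a deterministic $p$-pass streaming algorithm solving $\Pi$. $\tilde O$ hides polylogarithmic factors in $n$; asymptotics are as $n\to\infty$ with $H$ fixed, and $p$ may depend on $n$. $P_\ell$ is the path on $\ell$ vertices and $\text{co-}P_\ell$ its complement (so $\text{co-}P_3$ is one edge plus an isolated vertex). *)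

theory Defs
  imports "HOL-Probability.Probability" "HOL-Library.Landau_Symbols"
begin

definition all_pairs :: "nat \<Rightarrow> nat set set" where
  "all_pairs n = {e. \<exists>u v. u < n \<and> v < n \<and> u \<noteq> v \<and> e = {u, v}}"

definition simple_graph :: "nat \<Rightarrow> nat set set \<Rightarrow> bool" where
  "simple_graph n G \<longleftrightarrow> G \<subseteq> all_pairs n"

definition path_graph :: "nat \<Rightarrow> nat set set" where
  "path_graph l = {e. \<exists>i. i + 1 < l \<and> e = {i, i + 1}}"

definition graph_compl :: "nat \<Rightarrow> nat set set \<Rightarrow> nat set set" where
  "graph_compl k H = all_pairs k - H"

definition graph_iso :: "nat \<Rightarrow> nat set set \<Rightarrow> nat \<Rightarrow> nat set set \<Rightarrow> bool" where
  "graph_iso k H k' H' \<longleftrightarrow> k = k' \<and> (\<exists>f. bij_betw f {..<k} {..<k} \<and>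
      (\<forall>i<k. \<forall>j<k. {i, j} \<in> H \<longleftrightarrow> {f i, f j} \<in> H'))"

definition induced_copy :: "nat \<Rightarrow> nat set set \<Rightarrow> nat set set \<Rightarrow> nat set \<Rightarrow> bool" where
  "induced_copy k H G U \<longleftrightarrow> (\<exists>f. bij_betw f {..<k} U \<and>
      (\<forall>i<k. \<forall>j<k. i \<noteq> j \<longrightarrow> ({i, j} \<in> H \<longleftrightarrow> {f i, f j} \<in> G)))"

definition indsub_correct :: "nat \<Rightarrow> nat \<Rightarrow> nat set set \<Rightarrow> nat set set \<Rightarrow> nat set option \<Rightarrow> bool" where
  "indsub_correct n k H G out = (case out of
      None \<Rightarrow> \<not> (\<exists>U. U \<subseteq> {..<n} \<and> induced_copy k H G U)
    | Some U \<Rightarrow> U \<subseteq> {..<n} \<and> induced_copy k H G U)"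

definition is_stream :: "nat set set \<Rightarrow> nat set list \<Rightarrow> bool" where
  "is_stream G es \<longleftrightarrow> distinct es \<and> set es = G"

text \<open>A deterministic streaming algorithm: memory states are natural numbers;
  an algorithm with S bits of memory only uses the states {0..<2^S}.
  It starts in init, processes each stream element by step, may do arbitrary
  computation at the end of each pass (end_pass), and outputs by out.\<close>
record salg =
  init :: nat
  step :: "nat \<Rightarrow> nat set \<Rightarrow> nat"
  end_pass :: "nat \<Rightarrow> nat"
  out :: "nat \<Rightarrow> nat set option"

definition space_bounded :: "nat \<Rightarrow> salg \<Rightarrow> bool" where
  "space_bounded S A \<longleftrightarrow> init A < 2 ^ S \<and>
     (\<forall>s < 2 ^ S. \<forall>e. step A s e < 2 ^ S) \<and> (\<forall>s < 2 ^ S. end_pass A s < 2 ^ S)"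

definition one_pass :: "salg \<Rightarrow> nat set list \<Rightarrow> nat \<Rightarrow> nat" where
  "one_pass A es s = end_pass A (fold (\<lambda>e t. step A t e) es s)"

definition run :: "salg \<Rightarrow> nat \<Rightarrow> nat set list \<Rightarrow> nat set option" where
  "run A p es = out A ((one_pass A es ^^ p) (init A))"

definition det_solves :: "nat \<Rightarrow> nat \<Rightarrow> nat set set \<Rightarrow> nat \<Rightarrow> nat \<Rightarrow> salg \<Rightarrow> bool" where
  "det_solves n k H p S A \<longleftrightarrow> space_bounded S A \<and>
     (\<forall>G es. simple_graph n G \<longrightarrow> is_stream G es \<longrightarrow> indsub_correct n k H G (run A p es))"

text \<open>A randomized algorithm is a probability distribution over deterministic
  S-bit algorithms (random bits are not charged to memory).\<close>
definition rand_solves :: "nat \<Rightarrow> nat \<Rightarrow> nat set set \<Rightarrow> nat \<Rightarrow> nat \<Rightarrow> salg pmf \<Rightarrow> bool" where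
  "rand_solves n k H p S R \<longleftrightarrow> (\<forall>A \<in> set_pmf R. space_bounded S A) \<and>
     (\<forall>G es. simple_graph n G \<longrightarrow> is_stream G es \<longrightarrow>
        measure_pmf.prob R {A. indsub_correct n k H G (run A p es)} \<ge> 2 / 3)"

definition Dspace :: "nat \<Rightarrow> nat set set \<Rightarrow> nat \<Rightarrow> nat \<Rightarrow> nat" where
  "Dspace k H n p = (LEAST S. \<exists>A. det_solves n k H p S A)"

definition Rspace :: "nat \<Rightarrow> nat set set \<Rightarrow> nat \<Rightarrow> nat \<Rightarrow> nat" where
  "Rspace k H n p = (LEAST S. \<exists>R. rand_solves n k H p S R)"

end

theory Submission
  imports Defs
begin

text \<open>Upper bound: \<open>P\<^sub>3\<close>, \<open>co-P\<^sub>3\<close> and \<open>P\<^sub>4\<close> are induced subgraphs of \<open>P\<^sub>4\<close>. A \<open>P\<^sub>4\<close>-free graph has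
  twins, so there are only \<open>2\<^bsup>O(n log n)\<^esup>\<close> of them on \<open>n\<close> labelled vertices, and some edge weighting of
  \<open>O(n log n)\<close> bits gives them distinct total weights. Hence two passes decide whether \<open>G[W]\<close> is
  \<open>H\<close>-free: the weight of \<open>G[W]\<close> leaves one candidate cograph \<open>C\<close>, and \<open>G[W] = C\<close> is then verified by counting edges.
  Binary search over \<open>W\<close> locates a copy vertex by vertex.

  Lower bound: if \<open>H\<close> is none of these graphs, then \<open>H\<close> or its complement is not bipartite or is a four-cycle, and then
  disjointness of \<open>k\<close> sets in a universe of size \<open>\<Theta>(n\<^sup>2)\<close>, under the promise that they are pairwise disjoint or share an
  element, reduces to the problem. Since a reported copy can be verified, errors on disjoint inputs can be excluded. A corruption
  argument shows that then \<open>\<Omega>(n\<^sup>2)\<close> bits are needed: in a large box of inputs most coordinates are nearly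
  unbiased, so that a box with many disjoint inputs also has many inputs that meet in a random coordinate.\<close>

section \<open>Biased coordinates\<close>

text \<open>Two obstacles shape the lower bound. First, a blow-up of a pattern creates many mixed
  candidates for a copy. Under the promise a copy of the special vertex has at most one
  input-controlled neighbour in each copy of the rest, so no odd cycle closes there; hence one
  player per pattern vertex instead of two players. Since the number of players is constant, losses
  exponential in it are harmless. Second, corruption loses a factor 8^-t, which error 1/3 does not
  beat. A constant number \<open>m\<close> of deterministic algorithms is therefore fixed by
  averaging so that all of them together miss only a 3^-m fraction of the intersecting inputs; as no
  disjoint input is ever accepted, their verdicts combine without new errors. The upper bound
  exploits that only memory is charged: edge weights, candidates and query strategy are obtained by
  mere existence. A graph that is not a cograph may share its weight with one, hence the second
  pass; if that pass refutes the candidate, the answer is known, because an induced four-vertex path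
  already contains the pattern.\<close>

lemma sum_Pow_prod:
  fixes f g :: "'c \<Rightarrow> real"
  assumes "finite C"
  shows "(\<Sum>Z\<in>Pow C. (\<Prod>c\<in>C. if c \<in> Z then f c else g c)) = (\<Prod>c\<in>C. f c + g c)"
  using assms
proof (induction C)
  case empty
  then show ?case by simp
next
  case (insert x C)
  have inj: "inj_on (insert x) (Pow C)"
    using insert.hyps(2) by (auto simp: inj_on_def)
  have disj: "Pow C \<inter> insert x ` Pow C = {}"
    using insert.hyps(2) by auto
  have 1: "(\<Prod>c\<in>insert x C. if c \<in> Z then f c else g c) = g x * (\<Prod>c\<in>C. if c \<in> Z then f c else g c)"
    if "Z \<in> Pow C" for Z
    using that insert.hyps by auto
  have 2: "(\<Prod>c\<in>insert x C. if c \<in> insert x Z then f c else g c) = f x * (\<Prod>c\<in>C. if c \<in> Z then f c else g c)"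
    if "Z \<in> Pow C" for Z
  proof -
    have "(\<Prod>c\<in>C. if c \<in> insert x Z then f c else g c) = (\<Prod>c\<in>C. if c \<in> Z then f c else g c)"
      using insert.hyps by (intro prod.cong) auto
    then show ?thesis using insert.hyps by simp
  qed
  have "(\<Sum>Z\<in>Pow (insert x C). (\<Prod>c\<in>insert x C. if c \<in> Z then f c else g c))
    = (\<Sum>Z\<in>Pow C. (\<Prod>c\<in>insert x C. if c \<in> Z then f c else g c))
    + (\<Sum>Z\<in>Pow C. (\<Prod>c\<in>insert x C. if c \<in> insert x Z then f c else g c))"
    unfolding Pow_insert
    using insert.hyps disj by (subst sum.union_disjoint) (auto simp: sum.reindex[OF inj])
  also have "\<dots> = (\<Sum>Z\<in>Pow C. g x * (\<Prod>c\<in>C. if c \<in> Z then f c else g c))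
      + (\<Sum>Z\<in>Pow C. f x * (\<Prod>c\<in>C. if c \<in> Z then f c else g c))"
    using 1 2 by (metis (no_types, lifting) sum.cong)
  finally show ?case
    using insert by (simp add: sum_distrib_left[symmetric] distrib_right add.commute)
qed

lemma double_count:
  assumes "finite A" "finite B"
  shows "(\<Sum>a\<in>A. card {b\<in>B. r a b}) = (\<Sum>b\<in>B. card {a\<in>A. r a b})"
proof -
  have "(\<Sum>a\<in>A. card {b\<in>B. r a b}) = (\<Sum>a\<in>A. \<Sum>b\<in>B. of_bool (r a b))"
    using assms by (intro sum.cong) (auto simp: sum.If_cases of_bool_def Int_def)
  also have "\<dots> = (\<Sum>b\<in>B. \<Sum>a\<in>A. of_bool (r a b))" by (rule sum.swap)
  also have "\<dots> = (\<Sum>b\<in>B. card {a\<in>A. r a b})"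
    using assms by (intro sum.cong) (auto simp: sum.If_cases of_bool_def Int_def)
  finally show ?thesis .
qed

definition biased :: "'c set set \<Rightarrow> 'c \<Rightarrow> bool" where
  "biased S k \<longleftrightarrow> 8 * card {Z\<in>S. k \<in> Z} < card S \<or> 8 * card {Z\<in>S. k \<notin> Z} < card S"

text \<open>Members of \<open>S\<close> take the minority value on at most a quarter of the biased coordinates, at least half of the time.
  Weighting every minority value by \<open>(3/4)\<^sup>4\<close> bounds the number of such sets.\<close>

lemma card_biased:
  assumes "finite C" and "S \<subseteq> Pow C"
  shows "real (card S) \<le> 2 * 2 ^ card C * (9/10) ^ card {k\<in>C. biased S k}"
proof -
  define K where "K = {k\<in>C. biased S k}"
  \<comment> \<open>For biased \<open>k\<close> in \<open>M\<close> absence is the rare value, for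
    other biased \<open>k\<close> presence. So \<open>d Z\<close> counts the biased coordinates
    where \<open>Z\<close> takes the rare value.\<close>
  define M where "M = {k. \<not> 8 * card {Z\<in>S. k \<in> Z} < card S}"
  define d where "d Z = card {k\<in>K. (k \<in> Z) \<noteq> (k \<in> M)}" for Z
  have fS: "finite S" using assms finite_subset by blast
  have fK: "finite K" and KC: "K \<subseteq> C" using assms by (auto simp: K_def)
  define S' where "S' = {Z\<in>S. 4 * d Z \<le> card K}"
  have "8 * card {Z\<in>S. (k \<in> Z) \<noteq> (k \<in> M)} \<le> card S" if "k \<in> K" for k
  proof (cases "k \<in> M")
    case True
    then show ?thesis using that by (auto simp: K_def M_def biased_def)
  next
    case False
    then show ?thesis by (auto simp: M_def)
  qed
  then have "(\<Sum>k\<in>K. 8 * card {Z\<in>S. (k \<in> Z) \<noteq> (k \<in> M)}) \<le> card K * card S"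
    by (metis (no_types, lifting) sum_bounded_above of_nat_id)
  then have tot: "8 * (\<Sum>Z\<in>S. d Z) \<le> card K * card S"
    unfolding d_def using double_count[OF fS fK, of "\<lambda>Z k. (k \<in> Z) \<noteq> (k \<in> M)"]
    by (simp add: sum_distrib_left)
  have half: "card S \<le> 2 * card S'"
  proof (cases "card K = 0")
    case True
    then have "S' = S" using fK by (auto simp: S'_def d_def)
    then show ?thesis by simp
  next
    case False
    have "card (S - S') * (card K) \<le> (\<Sum>Z\<in>S - S'. 4 * d Z)"
    proof -
      have "card K \<le> 4 * d Z" if "Z \<in> S - S'" for Z using that by (auto simp: S'_def)
      then show ?thesis using sum_bounded_below[of "S - S'" "card K" "\<lambda>Z. 4 * d Z"] by simp
    qed
    also have "\<dots> \<le> (\<Sum>Z\<in>S. 4 * d Z)" using fS by (intro sum_mono2) auto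
    finally have "card (S - S') * card K \<le> 4 * (\<Sum>Z\<in>S. d Z)"
      by (simp add: sum_distrib_left)
    then have "2 * (card (S - S') * card K) \<le> card K * card S" using tot by linarith
    then have "card K * (2 * card (S - S')) \<le> card K * card S" by (simp add: ac_simps)
    then have "2 * card (S - S') \<le> card S" using False by simp
    moreover have "card S = card S' + card (S - S')"
      using fS by (metis (no_types, lifting) S'_def card_Diff_subset card_mono finite_subset le_add_diff_inverse mem_Collect_eq subsetI)
    ultimately show ?thesis by linarith
  qed
  \<comment> \<open>Each biased coordinate contributes a factor (1 + \<mu>^4) / (2 \<mu>) to the
    final bound; for \<mu> = 3/4 this is 337/384 < 9/10.\<close>
  define \<mu> :: real where "\<mu> = 3/4"
  define f where "f c = (if c \<in> K \<and> c \<notin> M then \<mu>^4 else 1)" for c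
  define g where "g c = (if c \<in> K \<and> c \<in> M then \<mu>^4 else 1)" for c
  have wt: "(\<Prod>c\<in>C. if c \<in> Z then f c else g c) = (\<mu>^4) ^ d Z" for Z
  proof -
    have "(\<Prod>c\<in>C. if c \<in> Z then f c else g c) = (\<Prod>c\<in>C. if c \<in> {k\<in>K. (k \<in> Z) \<noteq> (k \<in> M)} then \<mu>^4 else 1)"
      by (intro prod.cong) (auto simp: f_def g_def)
    also have "\<dots> = (\<Prod>c\<in>C \<inter> {k\<in>K. (k \<in> Z) \<noteq> (k \<in> M)}. \<mu>^4)"
      by (rule prod.inter_restrict[OF assms(1), symmetric])
    also have "C \<inter> {k\<in>K. (k \<in> Z) \<noteq> (k \<in> M)} = {k\<in>K. (k \<in> Z) \<noteq> (k \<in> M)}"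
      using KC by auto
    finally show ?thesis by (simp add: d_def)
  qed
  have "(\<Sum>Z\<in>S'. \<mu> ^ card K) \<le> (\<Sum>Z\<in>S'. (\<mu>^4) ^ d Z)"
    by (intro sum_mono) (auto simp: S'_def \<mu>_def power_mult[symmetric] intro!: power_decreasing)
  also have "\<dots> \<le> (\<Sum>Z\<in>Pow C. (\<mu>^4) ^ d Z)"
    using assms by (intro sum_mono2) (auto simp: S'_def \<mu>_def)
  also have "\<dots> = (\<Prod>c\<in>C. f c + g c)"
    using sum_Pow_prod[OF assms(1), of f g] by (simp add: wt)
  also have "\<dots> = (\<Prod>c\<in>C. if c \<in> K then 1 + \<mu>^4 else 2)"
    by (intro prod.cong) (auto simp: f_def g_def)
  also have "\<dots> = (1 + \<mu>^4) ^ card K * 2 ^ card (C - K)"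
    using assms(1) KC by (simp add: prod.If_cases Int_absorb1 Diff_eq)
  finally have "real (card S') * \<mu> ^ card K \<le> (1 + \<mu>^4) ^ card K * 2 ^ card (C - K)" by simp
  also have "(2::real) ^ card (C - K) = 2 ^ card C / 2 ^ card K"
    using KC assms(1) fK by (simp add: card_Diff_subset power_diff card_mono)
  finally have "real (card S') \<le> 2 ^ card C * ((1 + \<mu>^4) ^ card K / (2 ^ card K * \<mu> ^ card K))"
    by (simp add: \<mu>_def field_simps)
  also have "(1 + \<mu>^4) ^ card K / (2 ^ card K * \<mu> ^ card K) = ((1 + \<mu>^4) / (2 * \<mu>)) ^ card K"
    by (simp add: power_divide power_mult_distrib)
  also have "\<dots> \<le> (9/10) ^ card K"
    by (intro power_mono) (auto simp: \<mu>_def power_divide)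
  finally have "real (card S') \<le> 2 ^ card C * (9/10) ^ card K" by simp
  then show ?thesis using half unfolding K_def[symmetric] by simp
qed

section \<open>Corruption for promise disjointness\<close>

text \<open>Here \<open>a0 q\<close> and \<open>a1 q\<close> stand for the number of choices of
  player \<open>q\<close> without and with a given coordinate: \<open>w0\<close> counts inputs where
  nobody holds it, \<open>w1 q\<close> those where only \<open>q\<close> does, and the right-hand
  side those where everybody does. If no \<open>q\<close> is biased, cancelling the common factor
  gives \<open>a0 q\<close> \<le> 8 \<open>a1 q\<close> for all \<open>q\<close>, and these
  multiply. If some \<open>q\<close> is biased, then \<open>w0\<close> \<le> \<open>b q\<close> and
  the bound is trivial.\<close>

lemma product_bias_ineq:
  fixes a0 a1 :: "nat \<Rightarrow> real" and t :: nat
  assumes t: "t \<ge> 1" and a0: "\<And>q. a0 q \<ge> 0" and a1: "\<And>q. a1 q \<ge> 0"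
  defines "w0 \<equiv> \<Prod>q<t. a0 q"
  defines "w1 \<equiv> \<lambda>q. \<Prod>q'<t. if q' = q then a1 q' else a0 q'"
  defines "s \<equiv> \<lambda>q. w0 + w1 q"
  defines "b \<equiv> \<lambda>q. if 8 * w1 q < s q \<or> 8 * w0 < s q then s q else 0"
  shows "(1/8)^t * ((\<Sum>q<t. s q) / (8 * t) - 2 * (\<Sum>q<t. b q)) \<le> (\<Prod>q<t. a1 q)"
proof -
  have w0: "w0 \<ge> 0" unfolding w0_def using a0 by (intro prod_nonneg) auto
  have w1: "w1 q \<ge> 0" for q unfolding w1_def using a0 a1 by (intro prod_nonneg) auto
  have s: "s q \<ge> 0" "w0 \<le> s q" for q using w0 w1[of q] by (auto simp: s_def)
  have b: "b q \<ge> 0" for q using s by (auto simp: b_def)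
  have claim1: "(1/8)^t * (w0 - (\<Sum>q<t. b q)) \<le> (\<Prod>q<t. a1 q)"
  proof (cases "\<exists>q<t. b q \<noteq> 0")
    case True
    then obtain q where q: "q < t" "b q \<noteq> 0" by auto
    then have "w0 \<le> b q" using s by (auto simp: b_def split: if_splits)
    also have "b q \<le> (\<Sum>q<t. b q)" using q b by (intro member_le_sum) auto
    finally have "(1/8)^t * (w0 - (\<Sum>q<t. b q)) \<le> 0" by (simp add: mult_nonneg_nonpos)
    also have "0 \<le> (\<Prod>q<t. a1 q)" using a1 by (intro prod_nonneg) auto
    finally show ?thesis .
  next
    case False
    then have bz: "b q = 0" if "q < t" for q using that by blast
    have "(\<Prod>q<t. a0 q / 8) \<le> (\<Prod>q<t. a1 q)"
    proof (cases "w0 = 0")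
      case True
      then have "\<exists>q<t. a0 q = 0" by (auto simp: w0_def)
      then have "(\<Prod>q<t. a0 q / 8) = 0" by auto
      also have "0 \<le> (\<Prod>q<t. a1 q)" using a1 by (intro prod_nonneg) auto
      finally show ?thesis .
    next
      case False
      have "a0 q / 8 \<le> a1 q" if "q < t" for q
      proof -
        define r where "r = (\<Prod>q'\<in>{..<t} - {q}. a0 q')"
        have w0q: "w0 = a0 q * r" unfolding w0_def r_def using that by (subst prod.remove[of _ q]) auto
        have w1q: "w1 q = a1 q * r" unfolding w1_def r_def using that
          by (subst prod.remove[of _ q]) (auto intro!: prod.cong)
        have "r \<ge> 0" unfolding r_def using a0 by (intro prod_nonneg) auto
        then have r: "r > 0" using False w0q by (cases "r = 0") auto
        have "w0 \<le> 8 * w1 q" using bz[OF that] s(2)[of q] False w0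
          by (auto simp: b_def split: if_splits)
        then have "a0 q * r \<le> (8 * a1 q) * r" using w0q w1q by simp
        then show ?thesis using r by simp
      qed
      then show ?thesis using a0 by (intro prod_mono) auto
    qed
    moreover have "(\<Prod>q<t. a0 q / 8) = (1/8)^t * w0"
      by (simp add: w0_def prod_dividef power_divide)
    ultimately show ?thesis using bz by simp
  qed
  have "(s q - b q) / 8 \<le> w0" if "q < t" for q
    using w0 by (auto simp: b_def)
  then have "(\<Sum>q<t. (s q - b q) / 8) \<le> real t * w0"
    using sum_mono[of "{..<t}" "\<lambda>q. (s q - b q) / 8" "\<lambda>_. w0"] by simp
  then have "(\<Sum>q<t. s q) / 8 - (\<Sum>q<t. b q) / 8 \<le> real t * w0"
    by (simp add: sum_divide_distrib sum_subtractf diff_divide_distrib)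
  then have 1: "(\<Sum>q<t. s q) / (8 * t) - (\<Sum>q<t. b q) / (8 * t) \<le> w0"
    using t by (simp add: field_simps)
  have "(\<Sum>q<t. b q) / (8 * t) \<le> (\<Sum>q<t. b q) / 1"
    using t b by (intro divide_left_mono sum_nonneg) auto
  \<comment> \<open>One bias sum comes from \<open>claim1\<close>, the other, much weakened, from
    averaging (\<open>s q\<close> - \<open>b q\<close>) / 8 \<le> \<open>w0\<close> over
    \<open>q\<close>.\<close>
  with 1 have 2: "(\<Sum>q<t. s q) / (8 * t) - 2 * (\<Sum>q<t. b q) \<le> w0 - (\<Sum>q<t. b q)" by linarith
  have "(1/8)^t * ((\<Sum>q<t. s q) / (8 * t) - 2 * (\<Sum>q<t. b q)) \<le> (1/8)^t * (w0 - (\<Sum>q<t. b q))"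
    using 2 by (intro mult_left_mono) auto
  with claim1 show ?thesis by linarith
qed

text \<open>Once the owners are fixed, the players choose independently, so counts inside a box
  factor.\<close>

lemma card_fiberwise:
  fixes D :: "'c \<Rightarrow> nat"
  assumes A: "finite A" and D: "\<And>c. c \<in> A \<Longrightarrow> D c < t"
  shows "card {R\<in>Pow A. \<forall>q<t. Q q {c\<in>R. D c = q}} = (\<Prod>q<t. card {W\<in>Pow {c\<in>A. D c = q}. Q q W})"
proof -
  have "bij_betw (\<lambda>R. \<lambda>q\<in>{..<t}. {c\<in>R. D c = q}) {R\<in>Pow A. \<forall>q<t. Q q {c\<in>R. D c = q}}
          (PiE {..<t} (\<lambda>q. {W\<in>Pow {c\<in>A. D c = q}. Q q W}))"
  proof (rule bij_betw_byWitness[where f' = "\<lambda>F. \<Union>q<t. F q"])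
    show "\<forall>R\<in>{R\<in>Pow A. \<forall>q<t. Q q {c\<in>R. D c = q}}. (\<Union>q<t. (\<lambda>q\<in>{..<t}. {c\<in>R. D c = q}) q) = R"
      using D by auto
    show "\<forall>F\<in>PiE {..<t} (\<lambda>q. {W\<in>Pow {c\<in>A. D c = q}. Q q W}). (\<lambda>q\<in>{..<t}. {c\<in>\<Union>q<t. F q. D c = q}) = F"
    proof
      fix F assume F: "F \<in> PiE {..<t} (\<lambda>q. {W\<in>Pow {c\<in>A. D c = q}. Q q W})"
      have "{c\<in>\<Union>q<t. F q. D c = q} = F q" if "q < t" for q
        using F that by (fastforce simp: PiE_def Pi_def)
      then show "(\<lambda>q\<in>{..<t}. {c\<in>\<Union>q<t. F q. D c = q}) = F"
        using F by (auto simp: PiE_def extensional_def restrict_def fun_eq_iff)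
    qed
    show "(\<lambda>R. \<lambda>q\<in>{..<t}. {c\<in>R. D c = q}) ` {R\<in>Pow A. \<forall>q<t. Q q {c\<in>R. D c = q}}
        \<subseteq> PiE {..<t} (\<lambda>q. {W\<in>Pow {c\<in>A. D c = q}. Q q W})" by auto
    show "(\<lambda>F. \<Union>q<t. F q) ` (PiE {..<t} (\<lambda>q. {W\<in>Pow {c\<in>A. D c = q}. Q q W}))
        \<subseteq> {R\<in>Pow A. \<forall>q<t. Q q {c\<in>R. D c = q}}"
    proof safe
      fix F x q assume F: "F \<in> PiE {..<t} (\<lambda>q. {W\<in>Pow {c\<in>A. D c = q}. Q q W})" and q: "q < t"
      show "x \<in> A" if "x \<in> F q" using F q that by (fastforce simp: PiE_def Pi_def)
      have "{c\<in>\<Union>q<t. F q. D c = q} = F q"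
        using F q by (fastforce simp: PiE_def Pi_def)
      moreover have "Q q (F q)" using F q by (auto simp: PiE_def Pi_def)
      ultimately show "Q q {c\<in>\<Union>q<t. F q. D c = q}" by simp
    qed
  qed
  then have "card {R\<in>Pow A. \<forall>q<t. Q q {c\<in>R. D c = q}} = card (PiE {..<t} (\<lambda>q. {W\<in>Pow {c\<in>A. D c = q}. Q q W}))"
    by (rule bij_betw_same_card)
  then show ?thesis by (simp add: card_PiE)
qed

text \<open>Inputs of the players in the promise disjointness problem: \<open>Z\<close> is the union of the
  disjoint sets, and \<open>D\<close> assigns every coordinate to the only player that may hold it.\<close>

definition disj_input :: "('c \<Rightarrow> nat) \<Rightarrow> 'c set \<Rightarrow> nat \<Rightarrow> 'c set" where
  "disj_input D Z q = {c\<in>Z. D c = q}"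

definition meet_input :: "'c \<Rightarrow> ('c \<Rightarrow> nat) \<Rightarrow> 'c set \<Rightarrow> nat \<Rightarrow> 'c set" where
  "meet_input k D R q = insert k {c\<in>R. D c = q}"

definition disj_index :: "nat \<Rightarrow> 'c set \<Rightarrow> (('c \<Rightarrow> nat) \<times> 'c set) set" where
  "disj_index t C = (C \<rightarrow>\<^sub>E {..<t}) \<times> Pow C"

text \<open>The common coordinate has no owner here. Giving it each of the \<open>t\<close> owners
  in turn runs through all owner maps of \<open>disj_index\<close>, which makes sums over the two
  index sets comparable.\<close>

definition meet_index :: "nat \<Rightarrow> 'c set \<Rightarrow> ('c \<times> ('c \<Rightarrow> nat) \<times> 'c set) set" where
  "meet_index t C = (SIGMA k:C. ((C - {k}) \<rightarrow>\<^sub>E {..<t}) \<times> Pow (C - {k}))"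

text \<open>With the owners off \<open>k\<close> fixed, all counts are products over the players, as
  \<open>product_bias_ineq\<close> requires.\<close>

lemma local_corruption:
  fixes P :: "nat \<Rightarrow> 'c set \<Rightarrow> bool" and t :: nat
  assumes t: "t \<ge> 1" and C: "finite C" and k: "k \<in> C" and D: "D \<in> (C - {k}) \<rightarrow>\<^sub>E {..<t}"
  defines "S \<equiv> \<lambda>q. {Z\<in>Pow C. \<forall>q'<t. P q' (disj_input (D(k := q)) Z q')}"
  shows "(1/8)^t * ((\<Sum>q<t. real (card (S q))) / (8 * t)
            - 2 * (\<Sum>q<t. if biased (S q) k then real (card (S q)) else 0))
         \<le> card {R\<in>Pow (C - {k}). \<forall>q<t. P q (meet_input k D R q)}"
proof -
  define a0 where "a0 q = card {W\<in>Pow {c\<in>C - {k}. D c = q}. P q W}" for q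
  define a1 where "a1 q = card {W\<in>Pow {c\<in>C - {k}. D c = q}. P q (insert k W)}" for q
  have fC: "finite (C - {k})" using C by simp
  have Dt: "\<And>c. c \<in> C - {k} \<Longrightarrow> D c < t" using D by (fastforce simp: PiE_def Pi_def)
  have Y: "card {R\<in>Pow (C - {k}). \<forall>q<t. P q (meet_input k D R q)} = (\<Prod>q<t. a1 q)"
    unfolding meet_input_def a1_def by (rule card_fiberwise[OF fC Dt])
  \<comment> \<open>Sets avoiding \<open>k\<close> do not notice its owner; hence \<open>w0\<close>
    is the same for every \<open>q\<close>.\<close>
  have upd: "{c\<in>R. (D(k := q)) c = q'} = {c\<in>R. D c = q'}" if "R \<subseteq> C - {k}" for R q q'
    using that by auto
  have w0: "card {Z\<in>S q. k \<notin> Z} = (\<Prod>q<t. a0 q)" for q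
  proof -
    have "{Z\<in>S q. k \<notin> Z} = {R\<in>Pow (C - {k}). \<forall>q<t. P q {c\<in>R. D c = q}}"
    proof (intro set_eqI)
      fix Z
      show "Z \<in> {Z\<in>S q. k \<notin> Z} \<longleftrightarrow> Z \<in> {R\<in>Pow (C - {k}). \<forall>q<t. P q {c\<in>R. D c = q}}"
      proof (cases "Z \<subseteq> C - {k}")
        case True
        then have "Z \<subseteq> C" "k \<notin> Z" by auto
        then show ?thesis using True by (simp add: S_def disj_input_def upd[OF True] del: fun_upd_apply)
      qed (auto simp: S_def)
    qed
    then show ?thesis unfolding a0_def using card_fiberwise[OF fC Dt] by simp
  qed
  have w1: "card {Z\<in>S q. k \<in> Z} = (\<Prod>q'<t. if q' = q then a1 q' else a0 q')" if "q < t" for q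
  proof -
    have upd': "{c\<in>insert k R. (D(k := q)) c = q'} =
        (if q' = q then insert k {c\<in>R. D c = q'} else {c\<in>R. D c = q'})" if "R \<subseteq> C - {k}" for R q'
      using that by auto
    let ?Q = "\<lambda>q' W. if q' = q then P q' (insert k W) else P q' W"
    have Pif: "P q' (if q' = q then insert k X else X) = ?Q q' X" for q' X by simp
    have "{Z\<in>S q. k \<in> Z} = insert k ` {R\<in>Pow (C - {k}). \<forall>q'<t. ?Q q' {c\<in>R. D c = q'}}"
    proof (intro set_eqI iffI)
      fix Z assume Z: "Z \<in> {Z\<in>S q. k \<in> Z}"
      then have 1: "Z = insert k (Z - {k})" "Z - {k} \<subseteq> C - {k}" by (auto simp: S_def)
      have "\<forall>q'<t. P q' {c\<in>insert k (Z - {k}). (D(k := q)) c = q'}"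
        using Z 1(1) by (simp add: S_def disj_input_def)
      then have "\<forall>q'<t. ?Q q' {c\<in>Z - {k}. D c = q'}" unfolding upd'[OF 1(2)] Pif .
      then show "Z \<in> insert k ` {R\<in>Pow (C - {k}). \<forall>q'<t. ?Q q' {c\<in>R. D c = q'}}"
        using 1 by blast
    next
      fix Z assume "Z \<in> insert k ` {R\<in>Pow (C - {k}). \<forall>q'<t. ?Q q' {c\<in>R. D c = q'}}"
      then obtain R where R: "R \<subseteq> C - {k}" "Z = insert k R" "\<forall>q'<t. ?Q q' {c\<in>R. D c = q'}" by blast
      then have "\<forall>q'<t. P q' {c\<in>Z. (D(k := q)) c = q'}" unfolding R(2) upd'[OF R(1)] Pif by simp
      then show "Z \<in> {Z\<in>S q. k \<in> Z}" using R(1,2) k by (auto simp: S_def disj_input_def)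
    qed
    moreover have "inj_on (insert k) {R\<in>Pow (C - {k}). \<forall>q'<t. ?Q q' {c\<in>R. D c = q'}}"
      by (auto simp: inj_on_def)
    ultimately have "card {Z\<in>S q. k \<in> Z} = card {R\<in>Pow (C - {k}). \<forall>q'<t. ?Q q' {c\<in>R. D c = q'}}"
      by (simp add: card_image)
    also have "\<dots> = (\<Prod>q'<t. card {W\<in>Pow {c\<in>C - {k}. D c = q'}. ?Q q' W})"
      by (rule card_fiberwise[OF fC Dt])
    also have "\<dots> = (\<Prod>q'<t. if q' = q then a1 q' else a0 q')"
      by (intro prod.cong) (auto simp: a0_def a1_def)
    finally show ?thesis .
  qed
  have fS: "finite (S q)" for q using C by (auto simp: S_def)
  have cS: "card (S q) = card {Z\<in>S q. k \<notin> Z} + card {Z\<in>S q. k \<in> Z}" for q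
  proof -
    have "S q = {Z\<in>S q. k \<notin> Z} \<union> {Z\<in>S q. k \<in> Z}" by blast
    moreover have "card ({Z\<in>S q. k \<notin> Z} \<union> {Z\<in>S q. k \<in> Z}) = card {Z\<in>S q. k \<notin> Z} + card {Z\<in>S q. k \<in> Z}"
      using fS[of q] by (intro card_Un_disjoint) auto
    ultimately show ?thesis by simp
  qed
  define w0' where "w0' = (\<Prod>q<t. real (a0 q))"
  define w1' where "w1' q = (\<Prod>q'<t. if q' = q then real (a1 q') else real (a0 q'))" for q
  have r0: "real (card {Z\<in>S q. k \<notin> Z}) = w0'" for q by (simp add: w0 w0'_def)
  have r1: "real (card {Z\<in>S q. k \<in> Z}) = w1' q" if "q < t" for q
    by (simp add: w1[OF that] w1'_def if_distrib[of real] cong: if_cong)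
  have rS: "real (card (S q)) = w0' + w1' q" if "q < t" for q
    using cS[of q] r0[of q] r1[OF that] by simp
  have rb: "biased (S q) k \<longleftrightarrow> 8 * w1' q < w0' + w1' q \<or> 8 * w0' < w0' + w1' q" if "q < t" for q
    unfolding biased_def using rS[OF that] r0[of q] r1[OF that]
    by (metis (mono_tags, lifting) of_nat_less_iff of_nat_mult of_nat_numeral)
  have "(1/8)^t * ((\<Sum>q<t. w0' + w1' q) / (8 * t)
      - 2 * (\<Sum>q<t. if 8 * w1' q < w0' + w1' q \<or> 8 * w0' < w0' + w1' q then w0' + w1' q else 0))
     \<le> (\<Prod>q<t. real (a1 q))"
    using product_bias_ineq[OF t, of "\<lambda>q. real (a0 q)" "\<lambda>q. real (a1 q)"]
    unfolding w0'_def w1'_def by simp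
  moreover have "(\<Sum>q<t. real (card (S q))) = (\<Sum>q<t. w0' + w1' q)"
    by (intro sum.cong) (auto simp: rS)
  moreover have "(\<Sum>q<t. if biased (S q) k then real (card (S q)) else 0) =
      (\<Sum>q<t. if 8 * w1' q < w0' + w1' q \<or> 8 * w0' < w0' + w1' q then w0' + w1' q else 0)"
    by (intro sum.cong) (auto simp: rS rb)
  ultimately show ?thesis by (simp only: Y of_nat_prod)
qed

lemma sum_PiE_remove:
  fixes f :: "('c \<Rightarrow> nat) \<Rightarrow> real"
  assumes "k \<in> C"
  shows "(\<Sum>D\<in>(C - {k}) \<rightarrow>\<^sub>E T. \<Sum>q\<in>T. f (D(k := q))) = (\<Sum>D\<in>C \<rightarrow>\<^sub>E T. f D)"
proof -
  have "C \<rightarrow>\<^sub>E T = insert k (C - {k}) \<rightarrow>\<^sub>E T" using assms by (simp add: insert_absorb)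
  also have "\<dots> = (\<lambda>(y, g). g(k := y)) ` (T \<times> ((C - {k}) \<rightarrow>\<^sub>E T))"
    by (rule PiE_insert_eq)
  finally have eq: "C \<rightarrow>\<^sub>E T = (\<lambda>(y, g). g(k := y)) ` (T \<times> ((C - {k}) \<rightarrow>\<^sub>E T))" .
  have inj: "inj_on (\<lambda>(y, g). g(k := y)) (T \<times> ((C - {k}) \<rightarrow>\<^sub>E T))"
    using inj_combinator[of k "C - {k}" "\<lambda>_. T"] by simp
  have "(\<Sum>D\<in>C \<rightarrow>\<^sub>E T. f D) = (\<Sum>(q, D)\<in>T \<times> ((C - {k}) \<rightarrow>\<^sub>E T). f (D(k := q)))"
    unfolding eq by (subst sum.reindex[OF inj]) (simp add: case_prod_beta)
  also have "\<dots> = (\<Sum>q\<in>T. \<Sum>D\<in>(C - {k}) \<rightarrow>\<^sub>E T. f (D(k := q)))"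
    by (simp add: sum.cartesian_product)
  also have "\<dots> = (\<Sum>D\<in>(C - {k}) \<rightarrow>\<^sub>E T. \<Sum>q\<in>T. f (D(k := q)))" by (rule sum.swap)
  finally show ?thesis by simp
qed

text \<open>Either at most \<epsilon> |C| coordinates are biased, which the first term pays for, or
  \<open>card_biased\<close> makes \<open>S\<close> so small that the trivial bound |C| on their
  number is good enough.\<close>

lemma biased_weight:
  fixes \<epsilon> :: real
  assumes C: "finite C" and S: "S \<subseteq> Pow C" and \<epsilon>: "\<epsilon> \<ge> 0"
  shows "real (card S) * real (card {k\<in>C. biased S k})
    \<le> \<epsilon> * card C * card S + 2 * card C * (2 * (9/10) powr \<epsilon>) ^ card C"
proof -
  define N where "N = card C"
  define K where "K = card {k\<in>C. biased S k}"
  have KN: "K \<le> N" unfolding K_def N_def using C by (intro card_mono) auto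
  have "real (card S) * real K \<le> \<epsilon> * N * card S + 2 * N * (2 * (9/10) powr \<epsilon>) ^ N"
  proof (cases "real K \<le> \<epsilon> * N")
    case True
    then have "real (card S) * real K \<le> real (card S) * (\<epsilon> * N)" by (intro mult_left_mono) auto
    moreover have "real (card S) * (\<epsilon> * N) = \<epsilon> * N * card S" by simp
    moreover have "0 \<le> 2 * N * (2 * (9/10) powr \<epsilon>) ^ N" by simp
    ultimately show ?thesis by linarith
  next
    case False
    have "(9/10::real) ^ K = (9/10) powr real K" by (simp add: powr_realpow)
    also have "\<dots> \<le> (9/10) powr (\<epsilon> * N)" using False by (intro powr_mono') auto
    also have "\<dots> = ((9/10) powr \<epsilon>) ^ N" by (simp add: powr_powr[symmetric] powr_realpow)
    finally have "(9/10::real) ^ K \<le> ((9/10) powr \<epsilon>) ^ N" .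
    then have "2 * 2 ^ N * (9/10::real) ^ K \<le> 2 * 2 ^ N * ((9/10) powr \<epsilon>) ^ N"
      by (intro mult_left_mono) auto
    also have "\<dots> = 2 * (2 * (9/10) powr \<epsilon>) ^ N" by (simp add: power_mult_distrib)
    finally have "real (card S) \<le> 2 * (2 * (9/10) powr \<epsilon>) ^ N"
      using card_biased[OF C S] unfolding K_def N_def by linarith
    then have "real (card S) * real K \<le> (2 * (2 * (9/10) powr \<epsilon>) ^ N) * N"
      using KN by (intro mult_mono) auto
    moreover have "(2 * (2 * (9/10) powr \<epsilon>) ^ N) * N = 2 * N * (2 * (9/10) powr \<epsilon>) ^ N" by simp
    moreover have "0 \<le> \<epsilon> * N * card S" using \<epsilon> by simp
    ultimately show ?thesis by linarith
  qed
  then show ?thesis by (simp add: N_def K_def)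
qed

text \<open>Summing the local inequality over all \<open>k\<close> and all owner maps counts every
  disjoint input in the box once per coordinate. The loss is controlled by
  \<open>biased_weight\<close>, with one error term for each of the t^|C| owner maps.\<close>

lemma corruption:
  fixes P :: "nat \<Rightarrow> 'c set \<Rightarrow> bool" and t :: nat and \<epsilon> :: real
  assumes t: "t \<ge> 1" and C: "finite C" and \<epsilon>: "\<epsilon> \<ge> 0"
  shows "(1/8)^t * ((1 / (8 * t) - 2 * \<epsilon>) * card C
              * card {(D, Z)\<in>disj_index t C. \<forall>q<t. P q (disj_input D Z q)}
            - 4 * card C * (2 * t * (9/10) powr \<epsilon>) ^ card C)
         \<le> card {(k, D, R)\<in>meet_index t C. \<forall>q<t. P q (meet_input k D R q)}"
proof -
  define N where "N = card C"
  define S where "S D = {Z\<in>Pow C. \<forall>q<t. P q (disj_input D Z q)}" for D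
  define E where "E = (C \<rightarrow>\<^sub>E {..<t})"
  define Y where "Y k D = {R\<in>Pow (C - {k}). \<forall>q<t. P q (meet_input k D R q)}" for k D
  define bs where "bs D k = (if biased (S D) k then real (card (S D)) else 0)" for D k
  have fE: "finite E" unfolding E_def using C by (simp add: finite_PiE)
  have fS: "finite (S D)" for D using C by (simp add: S_def)
  have "{(D, Z)\<in>disj_index t C. \<forall>q<t. P q (disj_input D Z q)} = (SIGMA D:E. S D)"
    by (auto simp: disj_index_def E_def S_def)
  then have no: "card {(D, Z)\<in>disj_index t C. \<forall>q<t. P q (disj_input D Z q)} = (\<Sum>D\<in>E. card (S D))"
    using fE fS by simp
  have "{(k, D, R)\<in>meet_index t C. \<forall>q<t. P q (meet_input k D R q)}
      = (SIGMA k:C. SIGMA D:((C - {k}) \<rightarrow>\<^sub>E {..<t}). Y k D)"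
    by (auto simp: meet_index_def Y_def)
  moreover have "finite (Y k D)" for k D using C by (simp add: Y_def)
  ultimately have yes: "card {(k, D, R)\<in>meet_index t C. \<forall>q<t. P q (meet_input k D R q)}
      = (\<Sum>k\<in>C. \<Sum>D\<in>(C - {k}) \<rightarrow>\<^sub>E {..<t}. card (Y k D))"
    using C by (simp add: finite_PiE)
  have "(\<Sum>D\<in>E. \<Sum>k\<in>C. bs D k) \<le> (\<Sum>D\<in>E. \<epsilon> * N * card (S D) + 2 * N * (2 * (9/10) powr \<epsilon>) ^ N)"
  proof (rule sum_mono)
    fix D
    have "(\<Sum>k\<in>C. bs D k) = (\<Sum>k\<in>{k\<in>C. biased (S D) k}. real (card (S D)))"
      unfolding bs_def by (rule sum.inter_filter[OF C, symmetric])
    also have "\<dots> = real (card (S D)) * real (card {k\<in>C. biased (S D) k})" by simp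
    also have "\<dots> \<le> \<epsilon> * N * card (S D) + 2 * N * (2 * (9/10) powr \<epsilon>) ^ N"
      unfolding N_def using C \<epsilon> by (intro biased_weight) (auto simp: S_def)
    finally show "(\<Sum>k\<in>C. bs D k) \<le> \<epsilon> * N * card (S D) + 2 * N * (2 * (9/10) powr \<epsilon>) ^ N" .
  qed
  also have "\<dots> = \<epsilon> * N * (\<Sum>D\<in>E. card (S D)) + 2 * N * (2 * t * (9/10) powr \<epsilon>) ^ N"
    using C by (simp add: sum.distrib sum_distrib_left E_def card_PiE power_mult_distrib N_def mult_ac)
  finally have bias: "(\<Sum>D\<in>E. \<Sum>k\<in>C. bs D k)
      \<le> \<epsilon> * N * (\<Sum>D\<in>E. card (S D)) + 2 * N * (2 * t * (9/10) powr \<epsilon>) ^ N" .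
  have "(1/8)^t * ((\<Sum>q<t. real (card (S (D(k := q))))) / (8 * t) - 2 * (\<Sum>q<t. bs (D(k := q)) k)) \<le> card (Y k D)"
    if "k \<in> C" "D \<in> (C - {k}) \<rightarrow>\<^sub>E {..<t}" for k D
    using local_corruption[OF t C that, of P] unfolding S_def bs_def Y_def .
  then have "(\<Sum>k\<in>C. \<Sum>D\<in>(C - {k}) \<rightarrow>\<^sub>E {..<t}.
      (1/8)^t * ((\<Sum>q<t. real (card (S (D(k := q))))) / (8 * t) - 2 * (\<Sum>q<t. bs (D(k := q)) k)))
    \<le> (\<Sum>k\<in>C. \<Sum>D\<in>(C - {k}) \<rightarrow>\<^sub>E {..<t}. real (card (Y k D)))"
    by (intro sum_mono)
  also have "(\<Sum>k\<in>C. \<Sum>D\<in>(C - {k}) \<rightarrow>\<^sub>E {..<t}.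
      (1/8)^t * ((\<Sum>q<t. real (card (S (D(k := q))))) / (8 * t) - 2 * (\<Sum>q<t. bs (D(k := q)) k)))
     = (1/8)^t * (\<Sum>k\<in>C. (\<Sum>D\<in>E. real (card (S D))) / (8 * t) - 2 * (\<Sum>D\<in>E. bs D k))"
  proof -
    have "(\<Sum>D\<in>(C - {k}) \<rightarrow>\<^sub>E {..<t}.
      (1/8)^t * ((\<Sum>q<t. real (card (S (D(k := q))))) / (8 * t) - 2 * (\<Sum>q<t. bs (D(k := q)) k)))
      = (1/8)^t * ((\<Sum>D\<in>E. real (card (S D))) / (8 * t) - 2 * (\<Sum>D\<in>E. bs D k))" if "k \<in> C" for k
      using sum_PiE_remove[OF that, where T = "{..<t}" and f = "\<lambda>D. real (card (S D))"]
        sum_PiE_remove[OF that, where T = "{..<t}" and f = "\<lambda>D. bs D k"]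
      unfolding E_def
      by (simp only: sum_distrib_left[symmetric] sum_subtractf sum_divide_distrib[symmetric])
    then show ?thesis by (simp add: sum_distrib_left)
  qed
  also have "(\<Sum>k\<in>C. (\<Sum>D\<in>E. real (card (S D))) / (8 * t) - 2 * (\<Sum>D\<in>E. bs D k))
     = N * (\<Sum>D\<in>E. real (card (S D))) / (8 * t) - 2 * (\<Sum>D\<in>E. \<Sum>k\<in>C. bs D k)"
    by (subst sum.swap) (simp add: sum_subtractf sum_distrib_left N_def)
  finally have main: "(1/8)^t * (N * (\<Sum>D\<in>E. real (card (S D))) / (8 * t) - 2 * (\<Sum>D\<in>E. \<Sum>k\<in>C. bs D k))
     \<le> (\<Sum>k\<in>C. \<Sum>D\<in>(C - {k}) \<rightarrow>\<^sub>E {..<t}. real (card (Y k D)))" .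
  have "(1 / (8 * t) - 2 * \<epsilon>) * N * (\<Sum>D\<in>E. real (card (S D))) - 4 * N * (2 * t * (9/10) powr \<epsilon>) ^ N
     \<le> N * (\<Sum>D\<in>E. real (card (S D))) / (8 * t) - 2 * (\<Sum>D\<in>E. \<Sum>k\<in>C. bs D k)"
    using bias by (simp add: algebra_simps)
  then have "(1/8)^t * ((1 / (8 * t) - 2 * \<epsilon>) * N * (\<Sum>D\<in>E. real (card (S D))) - 4 * N * (2 * t * (9/10) powr \<epsilon>) ^ N)
     \<le> (1/8)^t * (N * (\<Sum>D\<in>E. real (card (S D))) / (8 * t) - 2 * (\<Sum>D\<in>E. \<Sum>k\<in>C. bs D k))"
    by (intro mult_left_mono) auto
  from order_trans[OF this main] show ?thesis by (simp only: no yes N_def of_nat_sum)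
qed

section \<open>Labels with box-shaped fibres\<close>

text \<open>Abstracts a communication protocol with at most \<open>M\<close> transcripts: the inputs
  producing a transcript form a product set, and the transcript determines \<open>R\<close>.\<close>

definition boxed :: "nat \<Rightarrow> nat \<Rightarrow> ((nat \<Rightarrow> 'c set) \<Rightarrow> bool) \<Rightarrow> bool" where
  "boxed t M R \<longleftrightarrow> (\<exists>lab :: (nat \<Rightarrow> 'c set) \<Rightarrow> nat.
      (\<forall>X. lab X < M) \<and>
      (\<forall>l. \<exists>P. \<forall>X. lab X = l \<longleftrightarrow> (\<forall>q<t. P q (X q))) \<and>
      (\<forall>X X'. lab X = lab X' \<longrightarrow> R X = R X'))"

lemma boxedE:
  fixes R :: "(nat \<Rightarrow> 'c set) \<Rightarrow> bool"
  assumes "boxed t M R"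
  obtains lab P where "\<And>X. lab X < M" "\<And>X l. lab X = l \<longleftrightarrow> (\<forall>q<t. P l q (X q))"
      "\<And>X X'. lab X = lab X' \<Longrightarrow> R X = R X'"
proof -
  obtain lab :: "(nat \<Rightarrow> 'c set) \<Rightarrow> nat" where *: "(\<forall>X. lab X < M) \<and>
      (\<forall>l. \<exists>P. \<forall>X. lab X = l \<longleftrightarrow> (\<forall>q<t. P q (X q))) \<and>
      (\<forall>X X'. lab X = lab X' \<longrightarrow> R X = R X')"
    using assms unfolding boxed_def by (rule exE)
  then have "\<forall>l. \<exists>P. \<forall>X. lab X = l \<longleftrightarrow> (\<forall>q<t. P q (X q))" by (elim conjE)
  from choice[OF this] obtain P where P: "\<forall>l X. lab X = l \<longleftrightarrow> (\<forall>q<t. P l q (X q))" ..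
  show ?thesis
  proof (rule that)
    show "lab X < M" for X using * by blast
    show "lab X = l \<longleftrightarrow> (\<forall>q<t. P l q (X q))" for X l using P by blast
    show "R X = R X'" if "lab X = lab X'" for X X' using * that by blast
  qed
qed

lemma boxedI:
  assumes t: "t \<ge> 1" and fin: "finite \<Lambda>" and card: "card \<Lambda> \<le> M"
    and lab: "\<And>X. lab X \<in> \<Lambda>"
    and box: "\<And>l. l \<in> \<Lambda> \<Longrightarrow> \<exists>P. \<forall>X. lab X = l \<longleftrightarrow> (\<forall>q<t. P q (X q))"
    and det: "\<And>X X'. lab X = lab X' \<Longrightarrow> R X = R X'"
  shows "boxed t M R"
proof -
  obtain h where h: "bij_betw h \<Lambda> {0..<card \<Lambda>}" using ex_bij_betw_finite_nat[OF fin] by blast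
  then have inj: "inj_on h \<Lambda>" by (simp add: bij_betw_def)
  have "h (lab X) < M" for X
  proof -
    have "h (lab X) \<in> {0..<card \<Lambda>}" using bij_betwE[OF h] lab by blast
    then show ?thesis using card by simp
  qed
  moreover have "\<exists>P. \<forall>X. h (lab X) = l \<longleftrightarrow> (\<forall>q<t. P q (X q))" for l
  proof (cases "l \<in> h ` \<Lambda>")
    case True
    then obtain l' where l': "l' \<in> \<Lambda>" "l = h l'" by auto
    then have "h (lab X) = l \<longleftrightarrow> lab X = l'" for X
      using inj lab[of X] by (auto dest: inj_onD)
    then show ?thesis using box[OF l'(1)] by simp
  next
    case False
    then have "h (lab X) \<noteq> l" for X using lab[of X] by auto
    \<comment> \<open>An empty fibre is a box because some player exists who can reject.\<close>
    then show ?thesis using t by (intro exI[of _ "\<lambda>_ _. False"]) (auto intro!: exI[of _ 0])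
  qed
  moreover have "R X = R X'" if "h (lab X) = h (lab X')" for X X'
    using det inj_onD[OF inj that lab lab] .
  ultimately show ?thesis unfolding boxed_def by (intro exI[of _ "\<lambda>X. h (lab X)"] conjI allI impI)
qed


text \<open>Two protocols run side by side: labels are paired in base \<open>M2\<close>, and boxes
  intersect in boxes.\<close>

lemma boxed_conj:
  assumes "boxed t M1 R1" and "boxed t M2 R2"
  shows "boxed t (M1 * M2) (\<lambda>X. R1 X \<and> R2 X)"
proof -
  obtain lab1 P1 where 1: "\<And>X. lab1 X < M1" "\<And>X l. lab1 X = l \<longleftrightarrow> (\<forall>q<t. P1 l q (X q))"
      "\<And>X X'. lab1 X = lab1 X' \<Longrightarrow> R1 X = R1 X'"
    using boxedE[OF assms(1)] by blast
  obtain lab2 P2 where 2: "\<And>X. lab2 X < M2" "\<And>X l. lab2 X = l \<longleftrightarrow> (\<forall>q<t. P2 l q (X q))"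
      "\<And>X X'. lab2 X = lab2 X' \<Longrightarrow> R2 X = R2 X'"
    using boxedE[OF assms(2)] by blast
  define lab where "lab X = lab1 X * M2 + lab2 X" for X
  have dec: "lab X = l \<longleftrightarrow> lab1 X = l div M2 \<and> lab2 X = l mod M2" for X l
    unfolding lab_def using 2(1)[of X] by auto
  have "lab X < M1 * M2" for X
  proof -
    have "lab X < Suc (lab1 X) * M2" using 2(1)[of X] by (simp add: lab_def)
    also have "\<dots> \<le> M1 * M2" using 1(1)[of X] by (intro mult_le_mono1) simp
    finally show ?thesis .
  qed
  moreover have "\<exists>P. \<forall>X. lab X = l \<longleftrightarrow> (\<forall>q<t. P q (X q))" for l
    by (rule exI[of _ "\<lambda>q x. P1 (l div M2) q x \<and> P2 (l mod M2) q x"]) (auto simp: dec 1(2) 2(2))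
  moreover have "(R1 X \<and> R2 X) = (R1 X' \<and> R2 X')" if "lab X = lab X'" for X X'
  proof -
    have "lab1 X = lab1 X'" "lab2 X = lab2 X'" using that dec[of X "lab X'"] dec[of X' "lab X'"] by auto
    then show ?thesis using 1(3) 2(3) by blast
  qed
  ultimately show ?thesis unfolding boxed_def by (intro exI[of _ lab] conjI allI impI)
qed

lemma card_partition:
  fixes f :: "'a \<Rightarrow> nat"
  assumes "finite A" and "\<And>a. a \<in> A \<Longrightarrow> f a \<in> L" and "finite L"
  shows "(\<Sum>l\<in>L. card {a\<in>A. f a = l}) = card A"
proof -
  have "card A = (\<Sum>a\<in>A. 1)" by simp
  also have "\<dots> = (\<Sum>l\<in>L. \<Sum>a\<in>{a\<in>A. f a = l}. 1)"
    using assms by (intro sum.group[symmetric]) auto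
  finally show ?thesis by simp
qed

lemma finite_disj_index: "finite C \<Longrightarrow> finite (disj_index t C)"
  by (simp add: disj_index_def finite_PiE)

lemma finite_meet_index: "finite C \<Longrightarrow> finite (meet_index t C)"
  by (simp add: meet_index_def finite_PiE)

lemma card_disj_index: "finite C \<Longrightarrow> card (disj_index t C) = (2 * t) ^ card C"
  by (simp add: disj_index_def card_cartesian_product card_PiE card_Pow power_mult_distrib)

lemma card_meet_index: "finite C \<Longrightarrow> card (meet_index t C) = card C * (2 * t) ^ (card C - 1)"
  by (simp add: meet_index_def finite_PiE card_cartesian_product card_PiE card_Pow power_mult_distrib)

text \<open>\<open>R\<close> will mean rejection. Labels with \<open>R\<close> cover all disjoint
  inputs, so applying \<open>corruption\<close> to each of them shows that errorless treatment of
  disjoint inputs forces many wrong rejections. The additive error is paid once per label.\<close>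

lemma boxed_corruption:
  fixes R :: "(nat \<Rightarrow> 'c set) \<Rightarrow> bool" and t :: nat and \<epsilon> :: real
  assumes t: "t \<ge> 1" and C: "finite C" and \<epsilon>: "\<epsilon> \<ge> 0" and R: "boxed t M R"
    and no: "\<And>D Z. (D, Z) \<in> disj_index t C \<Longrightarrow> R (disj_input D Z)"
  shows "(1/8)^t * ((1 / (8 * t) - 2 * \<epsilon>) * card C * (2 * t) ^ card C
            - 4 * M * card C * (2 * t * (9/10) powr \<epsilon>) ^ card C)
         \<le> card {(k, D, Z)\<in>meet_index t C. R (meet_input k D Z)}"
proof -
  obtain lab P where lab: "\<And>X. lab X < M" "\<And>X l. lab X = l \<longleftrightarrow> (\<forall>q<t. P l q (X q))"
      "\<And>X X'. lab X = lab X' \<Longrightarrow> R X = R X'"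
    using boxedE[OF R] by blast
  define L where "L = {l. l < M \<and> (\<exists>X. lab X = l \<and> R X)}"
  define N where "N = card C"
  define a b c where "a = (1/8::real)^t" and "b = (1 / (8 * t) - 2 * \<epsilon>) * N"
    and "c = 4 * N * (2 * t * (9/10) powr \<epsilon>) ^ N"
  define no_card yes_card where
    "no_card l = card {(D, Z)\<in>disj_index t C. lab (disj_input D Z) = l}" and
    "yes_card l = card {(k, D, Z)\<in>meet_index t C. lab (meet_input k D Z) = l}" for l
  have LI: "lab X \<in> L" if "R X" for X
    unfolding L_def using lab(1) that by blast
  have fL: "finite L" and cL: "card L \<le> M"
    using card_mono[of "{..<M}" L] by (auto simp: L_def)
  have "{(D, Z)\<in>disj_index t C. lab (disj_input D Z) = l} = {x\<in>disj_index t C. lab (case_prod disj_input x) = l}" for l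
    by auto
  moreover have "lab (case_prod disj_input x) \<in> L" if "x \<in> disj_index t C" for x
    using that no LI by (cases x) simp
  ultimately have "(\<Sum>l\<in>L. no_card l) = card (disj_index t C)"
    unfolding no_card_def using card_partition[of "disj_index t C" "\<lambda>x. lab (case_prod disj_input x)" L]
      finite_disj_index[OF C] fL by simp
  then have no_sum: "(\<Sum>l\<in>L. no_card l) = (2 * t) ^ N" by (simp add: card_disj_index[OF C] N_def)
  have "(\<Sum>l\<in>L. yes_card l) = card {(k, D, Z)\<in>meet_index t C. R (meet_input k D Z)}"
  proof -
    let ?A = "{(k, D, Z)\<in>meet_index t C. R (meet_input k D Z)}"
    have "{x\<in>?A. lab (case x of (k, D, Z) \<Rightarrow> meet_input k D Z) = l}
        = {(k, D, Z)\<in>meet_index t C. lab (meet_input k D Z) = l}" if l: "l \<in> L" for l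
    proof -
      obtain X0 where "lab X0 = l" "R X0" using l by (auto simp: L_def)
      then have "R X" if "lab X = l" for X using lab(3)[of X X0] that by simp
      then show ?thesis by auto
    qed
    moreover have "finite ?A"
      using finite_meet_index[OF C] by (rule finite_subset[rotated]) auto
    moreover have "lab (case x of (k, D, Z) \<Rightarrow> meet_input k D Z) \<in> L" if "x \<in> ?A" for x
      using that LI by (cases x) simp
    ultimately show ?thesis
      unfolding yes_card_def
      using card_partition[of ?A "\<lambda>x. lab (case x of (k, D, Z) \<Rightarrow> meet_input k D Z)" L] fL
      by simp
  qed
  moreover have "a * (b * no_card l - c) \<le> yes_card l" for l
    using corruption[OF t C \<epsilon>, of "P l"] unfolding no_card_def yes_card_def lab(2) a_def b_def c_def N_def .
  then have "(\<Sum>l\<in>L. a * (b * no_card l - c)) \<le> (\<Sum>l\<in>L. real (yes_card l))" by (intro sum_mono)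
  moreover have "(\<Sum>l\<in>L. a * (b * no_card l - c)) = a * (b * (\<Sum>l\<in>L. no_card l) - card L * c)"
    by (simp add: sum_distrib_left[symmetric] sum_subtractf)
  moreover have "a * (b * (\<Sum>l\<in>L. no_card l) - card L * c) \<ge> a * (b * (\<Sum>l\<in>L. no_card l) - M * c)"
    using cL by (intro mult_left_mono diff_left_mono mult_right_mono) (auto simp: a_def c_def)
  ultimately have "a * (b * (2 * t) ^ N - M * c) \<le> card {(k, D, Z)\<in>meet_index t C. R (meet_input k D Z)}"
    using no_sum by (simp del: of_nat_sum add: of_nat_sum[symmetric])
  then show ?thesis by (simp add: a_def b_def c_def N_def mult_ac)
qed

section \<open>From streaming algorithms to communication\<close>

definition listing :: "'a set \<Rightarrow> 'a list" where
  "listing A = (SOME xs. distinct xs \<and> set xs = A)"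

lemma listing: "finite A \<Longrightarrow> distinct (listing A) \<and> set (listing A) = A"
  unfolding listing_def by (rule someI_ex) (metis finite_distinct_list)

lemma finite_all_pairs: "finite (all_pairs n)"
proof -
  have "all_pairs n \<subseteq> Pow {..<n}" by (auto simp: all_pairs_def)
  then show ?thesis by (rule finite_subset) simp
qed

lemma induced_copy_cong:
  assumes "\<And>e. e \<subseteq> U \<Longrightarrow> e \<in> G \<longleftrightarrow> e \<in> G'"
  shows "induced_copy k H G U \<longleftrightarrow> induced_copy k H G' U"
proof -
  have "(\<forall>i<k. \<forall>j<k. i \<noteq> j \<longrightarrow> ({i, j} \<in> H \<longleftrightarrow> {f i, f j} \<in> G)) \<longleftrightarrow>
        (\<forall>i<k. \<forall>j<k. i \<noteq> j \<longrightarrow> ({i, j} \<in> H \<longleftrightarrow> {f i, f j} \<in> G'))" if f: "bij_betw f {..<k} U" for f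
  proof -
    have "{f i, f j} \<in> G \<longleftrightarrow> {f i, f j} \<in> G'" if "i < k" "j < k" for i j
      using assms[of "{f i, f j}"] bij_betwE[OF f] that by auto
    then show ?thesis by blast
  qed
  then show ?thesis unfolding induced_copy_def by blast
qed

lemma induced_copy_card: "induced_copy k H G U \<Longrightarrow> card U = k"
  unfolding induced_copy_def by (metis bij_betw_same_card card_lessThan)

section \<open>Fixing deterministic algorithms by averaging\<close>

lemma greedy_pick:
  fixes R :: "'a pmf" and rej :: "'a \<Rightarrow> 'b \<Rightarrow> bool"
  assumes Y: "finite Y" and rej: "\<And>y. y \<in> Y \<Longrightarrow> measure_pmf.prob R {A. rej A y} \<le> 1/3"
  shows "\<exists>A\<in>set_pmf R. 3 * card {y\<in>Y. rej A y} \<le> card Y"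
proof (rule ccontr)
  assume "\<not> ?thesis"
  then have gt: "3 * card {y\<in>Y. rej A y} \<ge> card Y + 1" if "A \<in> set_pmf R" for A
    using that by fastforce
  define f where "f A = (\<Sum>y\<in>Y. indicator {A. rej A y} A :: real)" for A
  have f: "f A = card {y\<in>Y. rej A y}" for A
    unfolding f_def using Y by (simp add: indicator_def sum.If_cases Int_def)
  have int: "integrable R (indicator {A. rej A y} :: 'a \<Rightarrow> real)" for y
    by (simp add: measure_pmf.integrable_const_bound[where B = 1] indicator_def)
  have "(real (card Y) + 1) / 3 \<le> measure_pmf.expectation R f"
  proof (rule measure_pmf.integral_ge_const)
    show "integrable R f" unfolding f_def using int by (intro Bochner_Integration.integrable_sum)
    show "AE x in R. (real (card Y) + 1) / 3 \<le> f x"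
      using gt unfolding AE_measure_pmf_iff f by (force simp: field_simps)
  qed
  also have "measure_pmf.expectation R f = (\<Sum>y\<in>Y. measure_pmf.prob R {A. rej A y})"
    unfolding f_def using int by (subst Bochner_Integration.integral_sum) auto
  also have "\<dots> \<le> (\<Sum>y\<in>Y. 1/3)" using rej by (intro sum_mono)
  also have "\<dots> = real (card Y) / 3" by simp
  finally show False by simp
qed

text \<open>Each algorithm is chosen against the inputs that all earlier ones reject, so the
  surviving set shrinks by a factor of three every time.\<close>

lemma greedy_picks:
  fixes R :: "'a pmf" and rej :: "'a \<Rightarrow> 'b \<Rightarrow> bool"
  assumes Y: "finite Y" and rej: "\<And>y. y \<in> Y \<Longrightarrow> measure_pmf.prob R {A. rej A y} \<le> 1/3"
  shows "\<exists>As. length As = m \<and> set As \<subseteq> set_pmf R \<and> 3 ^ m * card {y\<in>Y. \<forall>A\<in>set As. rej A y} \<le> card Y"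
proof (induction m)
  case 0
  then show ?case by simp
next
  case (Suc m)
  then obtain As where As: "length As = m" "set As \<subseteq> set_pmf R"
      "3 ^ m * card {y\<in>Y. \<forall>A\<in>set As. rej A y} \<le> card Y" by blast
  let ?Y = "{y\<in>Y. \<forall>A\<in>set As. rej A y}"
  obtain A where A: "A \<in> set_pmf R" "3 * card {y\<in>?Y. rej A y} \<le> card ?Y"
    using greedy_pick[of ?Y R rej] Y rej by auto
  have "{y\<in>Y. \<forall>A\<in>set (A # As). rej A y} = {y\<in>?Y. rej A y}" by auto
  then have "3 ^ Suc m * card {y\<in>Y. \<forall>A\<in>set (A # As). rej A y} = 3 ^ m * (3 * card {y\<in>?Y. rej A y})" by simp
  also have "\<dots> \<le> 3 ^ m * card ?Y" using A(2) by (intro mult_left_mono) auto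
  also have "\<dots> \<le> card Y" by (rule As(3))
  finally show ?case using As(1,2) A(1) by (intro exI[of _ "A # As"]) (simp del: power_Suc)
qed

text \<open>Every pair of vertices is owned by a player, so that the stream of \<open>G X\<close> can be split into one part per player.\<close>

locale reduction =
  fixes n k t :: nat and H :: "nat set set" and C :: "'c set"
    and G :: "(nat \<Rightarrow> 'c set) \<Rightarrow> nat set set" and own :: "nat set \<Rightarrow> nat"
  assumes t: "t \<ge> 1" and C: "finite C"
    and own: "own e < t"
    and G_pairs: "G X \<subseteq> all_pairs n"
    and G_own: "X (own e) = X' (own e) \<Longrightarrow> e \<in> G X \<longleftrightarrow> e \<in> G X'"
    and disj: "\<lbrakk>\<And>q. X q \<subseteq> C; \<And>q q'. q \<noteq> q' \<Longrightarrow> X q \<inter> X q' = {}\<rbrakk>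
        \<Longrightarrow> \<not> (\<exists>U. U \<subseteq> {..<n} \<and> induced_copy k H (G X) U)"
    and meet: "\<lbrakk>\<And>q. X q \<subseteq> C; c \<in> C; \<And>q. q < t \<Longrightarrow> c \<in> X q\<rbrakk>
        \<Longrightarrow> \<exists>U. U \<subseteq> {..<n} \<and> induced_copy k H (G X) U"
begin

lemma finite_G: "finite (G X)"
  using G_pairs finite_all_pairs by (rule finite_subset)

text \<open>The player evaluates \<open>G\<close> at the constant assignment of its own input. On
  the edges it owns this is correct by \<open>G_own\<close>, so its part of the stream depends on
  nothing else.\<close>

definition part :: "nat \<Rightarrow> 'c set \<Rightarrow> nat set list" where
  "part q x = listing {e\<in>G (\<lambda>_. x). own e = q}"

lemma own_edge: "own e = q \<Longrightarrow> e \<in> G (\<lambda>_. X q) \<longleftrightarrow> e \<in> G X"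
  by (rule G_own) simp

lemma part: "distinct (part q (X q))" "set (part q (X q)) = {e\<in>G X. own e = q}"
proof -
  have "{e\<in>G (\<lambda>_. X q). own e = q} = {e\<in>G X. own e = q}" using own_edge[of _ q X] by blast
  then show "distinct (part q (X q))" "set (part q (X q)) = {e\<in>G X. own e = q}"
    using listing[of "{e\<in>G X. own e = q}"] finite_G[of X] by (simp_all add: part_def)
qed

definition stream :: "(nat \<Rightarrow> 'c set) \<Rightarrow> nat set list" where
  "stream X = concat (map (\<lambda>q. part q (X q)) [0..<t])"

lemma is_stream: "is_stream (G X) (stream X)"
proof -
  have "distinct (concat (map (\<lambda>q. part q (X q)) [0..<j])) \<and>
        set (concat (map (\<lambda>q. part q (X q)) [0..<j])) = {e\<in>G X. own e < j}" for j
    by (induction j) (auto simp: part)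
  then show ?thesis using own by (simp add: is_stream_def stream_def)
qed

text \<open>The last player of a round also performs the end-of-pass computation, so that
  \<open>t\<close> turns make one pass.\<close>

definition turn :: "salg \<Rightarrow> nat \<Rightarrow> 'c set \<Rightarrow> nat \<Rightarrow> nat" where
  "turn A q x s = (let s' = fold (\<lambda>e t. step A t e) (part q x) s in if Suc q = t then end_pass A s' else s')"

primrec trace :: "salg \<Rightarrow> (nat \<Rightarrow> 'c set) \<Rightarrow> nat \<Rightarrow> nat" where
  "trace A X 0 = init A"
| "trace A X (Suc i) = turn A (i mod t) (X (i mod t)) (trace A X i)"

lemma trace_run: "trace A X (p * t) = (one_pass A (stream X) ^^ p) (init A)"
proof (induction p)
  case 0
  then show ?case by simp
next
  case (Suc p)
  have within: "trace A X (p * t + j) = fold (\<lambda>e t. step A t e) (concat (map (\<lambda>q. part q (X q)) [0..<j])) (trace A X (p * t))"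
    if "j < t" for j
    using that by (induction j) (auto simp: turn_def Let_def)
  obtain j where j: "Suc j = t" using t by (cases t) auto
  have "Suc p * t = Suc (p * t + j)" unfolding mult_Suc using j by linarith
  moreover have "(p * t + j) mod t = j"
    unfolding mod_mult_self3 using j by (intro mod_less) linarith
  ultimately have "trace A X (Suc p * t) = turn A j (X j) (trace A X (p * t + j))"
    by (simp only: trace.simps)
  also have "\<dots> = end_pass A (fold (\<lambda>e t. step A t e) (concat (map (\<lambda>q. part q (X q)) [0..<Suc j])) (trace A X (p * t)))"
    unfolding upt_Suc_append[OF le0] using j within[of j] by (simp add: turn_def Let_def)
  also have "\<dots> = one_pass A (stream X) (trace A X (p * t))"
    unfolding one_pass_def stream_def j ..
  finally show ?case using Suc by simp
qed

lemma trace_bounded: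
  assumes "space_bounded S A"
  shows "trace A X i < 2 ^ S"
proof (induction i)
  case (Suc i)
  have "fold (\<lambda>e t. step A t e) es s < 2 ^ S" if "s < 2 ^ S" for es s
    using that assms by (induction es arbitrary: s) (auto simp: space_bounded_def)
  then show ?case using Suc assms by (auto simp: turn_def Let_def space_bounded_def)
qed (use assms in \<open>auto simp: space_bounded_def\<close>)

definition accepts :: "salg \<Rightarrow> nat \<Rightarrow> (nat \<Rightarrow> 'c set) \<Rightarrow> bool" where
  "accepts A p X \<longleftrightarrow> (\<exists>U. run A p (stream X) = Some U \<and> U \<subseteq> {..<n} \<and> induced_copy k H (G X) U)"

text \<open>The label records the memory states at all turns and the edges inside the reported vertex set,
  so that it determines whether the report is correct.\<close>

lemma boxed_rejects:
  assumes A: "space_bounded S A"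
  shows "boxed t ((2 ^ S) ^ Suc (p * t) * 2 ^ 2 ^ k) (\<lambda>X. \<not> accepts A p X)"
proof -
  \<comment> \<open>Reports of the wrong size count as empty: they are never copies, and |V| \<le>
    \<open>k\<close> bounds the possible edge sets inside \<open>V\<close> by 2^2^k.\<close>
  define V where "V \<tau> = (case out A (\<tau> (p * t)) of None \<Rightarrow> {} | Some U \<Rightarrow> if U \<subseteq> {..<n} \<and> card U = k then U else {})" for \<tau> :: "nat \<Rightarrow> nat"
  define \<Lambda> where "\<Lambda> = (SIGMA \<tau>:{..p * t} \<rightarrow>\<^sub>E {..<2 ^ S}. Pow (Pow (V \<tau>)))"
  define \<tau> where "\<tau> X = restrict (trace A X) {..p * t}" for X
  define lab where "lab X = (\<tau> X, {e\<in>G X. e \<subseteq> V (\<tau> X)})" for X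
  have V: "finite (V \<tau>)" "card (V \<tau>) \<le> k" for \<tau>
  proof -
    have "V \<tau> = {} \<or> V \<tau> \<subseteq> {..<n} \<and> card (V \<tau>) = k" by (auto simp: V_def split: option.splits)
    then show "finite (V \<tau>)" "card (V \<tau>) \<le> k" by (auto intro: finite_subset[of _ "{..<n}"])
  qed
  have fin: "finite \<Lambda>" unfolding \<Lambda>_def using V(1) by (intro finite_SigmaI) (auto intro: finite_PiE)
  have "card \<Lambda> = (\<Sum>\<tau>\<in>{..p * t} \<rightarrow>\<^sub>E {..<2 ^ S}. card (Pow (Pow (V \<tau>))))"
    unfolding \<Lambda>_def using V(1) by (subst card_SigmaI) (auto intro: finite_PiE)
  also have "\<dots> \<le> (\<Sum>\<tau>\<in>{..p * t} \<rightarrow>\<^sub>E {..<(2::nat) ^ S}. 2 ^ 2 ^ k)"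
    using V by (intro sum_mono) (simp add: card_Pow)
  also have "\<dots> = (2 ^ S) ^ Suc (p * t) * 2 ^ 2 ^ k" by (simp add: card_PiE)
  finally have card: "card \<Lambda> \<le> (2 ^ S) ^ Suc (p * t) * 2 ^ 2 ^ k" .
  have box: "\<exists>P. \<forall>X. lab X = l \<longleftrightarrow> (\<forall>q<t. P q (X q))" if l: "l \<in> \<Lambda>" for l
  proof -
    obtain \<sigma> W where lW: "l = (\<sigma>, W)" by fastforce
    have \<sigma>: "\<sigma> \<in> {..p * t} \<rightarrow>\<^sub>E {..<2 ^ S}" and W: "W \<subseteq> Pow (V \<sigma>)" using l by (auto simp: lW \<Lambda>_def)
    \<comment> \<open>Player \<open>q\<close> checks only its own transitions and its own edges
      inside \<open>V\<close>. The state sequence, and with it \<open>V\<close>, is part of the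
      label and thus known to all.\<close>
    define P where "P q x \<longleftrightarrow> \<sigma> 0 = init A \<and> (\<forall>i<p * t. i mod t = q \<longrightarrow> \<sigma> (Suc i) = turn A q x (\<sigma> i))
       \<and> {e\<in>G (\<lambda>_. x). own e = q \<and> e \<subseteq> V \<sigma>} = {e\<in>W. own e = q}" for q x
    have "lab X = l \<longleftrightarrow> (\<forall>q<t. P q (X q))" for X
    proof
      assume "lab X = l"
      then have 1: "\<sigma> = \<tau> X" "W = {e\<in>G X. e \<subseteq> V \<sigma>}" by (auto simp: lab_def lW)
      show "\<forall>q<t. P q (X q)"
      proof (intro allI impI)
        fix q assume "q < t"
        have "{e\<in>G (\<lambda>_. X q). own e = q \<and> e \<subseteq> V \<sigma>} = {e\<in>W. own e = q}"
          unfolding 1(2) using own_edge[of _ q X] by blast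
        moreover have "\<sigma> 0 = init A" by (simp add: 1(1) \<tau>_def)
        moreover have "\<sigma> (Suc i) = turn A (i mod t) (X (i mod t)) (\<sigma> i)" if "i < p * t" for i
          using that by (simp add: 1(1) \<tau>_def)
        ultimately show "P q (X q)" unfolding P_def by blast
      qed
    next
      assume P: "\<forall>q<t. P q (X q)"
      have "\<sigma> i = trace A X i" if "i \<le> p * t" for i
        using that
      proof (induction i)
        case 0
        have "P 0 (X 0)" using P t by simp
        then show ?case by (simp add: P_def)
      next
        case (Suc i)
        then have i: "i < p * t" "\<sigma> i = trace A X i" by auto
        have "P (i mod t) (X (i mod t))" using P t by simp
        then have "\<sigma> (Suc i) = turn A (i mod t) (X (i mod t)) (\<sigma> i)" using i(1) unfolding P_def by blast
        then show ?case using i(2) by simp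
      qed
      then have s: "\<sigma> = \<tau> X"
        using \<sigma> unfolding \<tau>_def by (intro extensionalityI[of _ "{..p * t}"]) (auto simp: PiE_def)
      have "e \<in> W \<longleftrightarrow> e \<in> G X \<and> e \<subseteq> V \<sigma>" for e
      proof -
        have "{e'\<in>G (\<lambda>_. X (own e)). own e' = own e \<and> e' \<subseteq> V \<sigma>} = {e'\<in>W. own e' = own e}"
          using P[rule_format, OF own[of e]] unfolding P_def by (elim conjE)
        then have "e \<in> W \<longleftrightarrow> e \<in> G (\<lambda>_. X (own e)) \<and> e \<subseteq> V \<sigma>" by blast
        then show ?thesis using G_own[of "\<lambda>_. X (own e)" e X] by simp
      qed
      then show "lab X = l" using s by (auto simp: lab_def lW)
    qed
    then show ?thesis by blast
  qed
  have det: "(\<not> accepts A p X) = (\<not> accepts A p X')" if "lab X = lab X'" for X X'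
  proof -
    have eq: "\<tau> X = \<tau> X'" "{e\<in>G X. e \<subseteq> V (\<tau> X)} = {e\<in>G X'. e \<subseteq> V (\<tau> X)}"
      using that by (auto simp: lab_def)
    have run: "run A p (stream X) = out A (\<tau> X (p * t))" for X
      by (simp add: run_def \<tau>_def trace_run)
    have "induced_copy k H (G X) U \<longleftrightarrow> induced_copy k H (G X') U"
      if U: "out A (\<tau> X (p * t)) = Some U" "U \<subseteq> {..<n}" for U
    proof (cases "card U = k")
      case True
      then have "V (\<tau> X) = U" using U by (simp add: V_def)
      then show ?thesis using eq(2) by (intro induced_copy_cong) blast
    next
      case False
      then show ?thesis using induced_copy_card by blast
    qed
    then show ?thesis unfolding accepts_def run eq(1)[symmetric] by blast
  qed
  have range: "lab X \<in> \<Lambda>" for X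
    using trace_bounded[OF A] by (fastforce simp: lab_def \<Lambda>_def \<tau>_def)
  show ?thesis by (rule boxedI[OF t fin card range box det])
qed

lemma disj_input_rejects:
  assumes "(D, Z) \<in> disj_index t C"
  shows "\<not> accepts A p (disj_input D Z)"
proof -
  have "\<not> (\<exists>U. U \<subseteq> {..<n} \<and> induced_copy k H (G (disj_input D Z)) U)"
    using assms by (intro disj) (auto simp: disj_input_def disj_index_def)
  then show ?thesis by (auto simp: accepts_def)
qed

lemma meet_input_rejects:
  assumes R: "rand_solves n k H p S R" and y: "(c, D, Z) \<in> meet_index t C"
  shows "measure_pmf.prob R {A. \<not> accepts A p (meet_input c D Z)} \<le> 1/3"
proof -
  let ?X = "meet_input c D Z"
  have ex: "\<exists>U. U \<subseteq> {..<n} \<and> induced_copy k H (G ?X) U"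
    using y by (intro meet) (auto simp: meet_input_def meet_index_def)
  have "{A. \<not> accepts A p ?X} = - {A. indsub_correct n k H (G ?X) (run A p (stream ?X))}"
    using ex by (auto simp: accepts_def indsub_correct_def split: option.splits)
  moreover have "measure_pmf.prob R {A. indsub_correct n k H (G ?X) (run A p (stream ?X))} \<ge> 2/3"
    using R is_stream G_pairs by (auto simp: rand_solves_def simple_graph_def)
  ultimately show ?thesis
    by (simp add: measure_pmf.prob_compl[of _ R, simplified] Compl_eq_Diff_UNIV)
qed

lemma communication_bound:
  assumes R: "rand_solves n k H p S R" and \<epsilon>: "\<epsilon> \<ge> (0::real)"
  shows "3 ^ m * ((1/8)^t * ((1 / (8 * t) - 2 * \<epsilon>) * card C * (2 * t) ^ card C
            - 4 * ((2 ^ S) ^ Suc (p * t) * 2 ^ 2 ^ k) ^ m * card C * (2 * t * (9/10) powr \<epsilon>) ^ card C))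
         \<le> card C * (2 * t) ^ (card C - 1)"
proof -
  define rej where "rej A y = (case y of (c, D, Z) \<Rightarrow> \<not> accepts A p (meet_input c D Z))" for A y
  define M :: nat where "M = (2 ^ S) ^ Suc (p * t) * 2 ^ 2 ^ k"
  obtain As where As: "length As = m" "set As \<subseteq> set_pmf R"
     "3 ^ m * card {y\<in>meet_index t C. \<forall>A\<in>set As. rej A y} \<le> card (meet_index t C)"
    using greedy_picks[of "meet_index t C" R rej m] finite_meet_index[OF C] meet_input_rejects[OF R]
    by (auto simp: rej_def)
  have sp: "space_bounded S A" if "A \<in> set As" for A
    using that As(2) R by (auto simp: rand_solves_def)
  have "boxed t (M ^ length As) (\<lambda>X. \<forall>A\<in>set As. \<not> accepts A p X)" using sp
  proof (induction As)
    case Nil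
    then show ?case
      using t by (auto intro!: boxedI[where \<Lambda> = "{0::nat}" and lab = "\<lambda>_. 0"])
  next
    case (Cons A As)
    then have "boxed t M (\<lambda>X. \<not> accepts A p X)" "boxed t (M ^ length As) (\<lambda>X. \<forall>A\<in>set As. \<not> accepts A p X)"
      unfolding M_def using boxed_rejects by auto
    from boxed_conj[OF this] show ?case by simp
  qed
  from boxed_corruption[OF t C \<epsilon> this] disj_input_rejects
  have "(1/8)^t * ((1 / (8 * t) - 2 * \<epsilon>) * card C * (2 * t) ^ card C
            - 4 * M ^ m * card C * (2 * t * (9/10) powr \<epsilon>) ^ card C)
      \<le> card {(c, D, Z)\<in>meet_index t C. \<forall>A\<in>set As. \<not> accepts A p (meet_input c D Z)}" (is "?L \<le> _")
    unfolding As(1) by simp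
  also have "{(c, D, Z)\<in>meet_index t C. \<forall>A\<in>set As. \<not> accepts A p (meet_input c D Z)}
      = {y\<in>meet_index t C. \<forall>A\<in>set As. rej A y}" by (auto simp: rej_def)
  finally have "3 ^ m * ?L \<le> 3 ^ m * real (card {y\<in>meet_index t C. \<forall>A\<in>set As. rej A y})"
    by (rule mult_left_mono) simp
  also have "\<dots> \<le> card (meet_index t C)" 
    using of_nat_mono[OF As(3), where 'a = real] by simp
  finally show ?thesis by (simp only: card_meet_index[OF C] M_def)
qed

end

section \<open>Constants of the space bound\<close>

lemma reduction_bound:
  fixes t k :: nat
  assumes t: "t \<ge> 1"
  shows "\<exists>\<delta>>0. \<exists>N0. \<forall>n H (C :: 'c set) G own p S R. reduction n k t H C G own \<longrightarrow> N0 \<le> card C \<longrightarrow> p \<ge> 1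
    \<longrightarrow> rand_solves n k H p S R \<longrightarrow> \<delta> * real (card C) \<le> real S * real p"
proof -
  \<comment> \<open>Half of the gain survives the bias: 1/(8t) - 2\<epsilon> = 1/(16t).\<close>
  define \<epsilon> :: real where "\<epsilon> = 1 / (32 * t)"
  define \<rho> :: real where "\<rho> = (9/10) powr \<epsilon>"
  define \<gamma> where "\<gamma> = - log 2 \<rho>"
  have \<epsilon>: "\<epsilon> > 0" using t by (simp add: \<epsilon>_def)
  have \<rho>: "\<rho> > 0" by (simp add: \<rho>_def)
  have "\<rho> < 1" unfolding \<rho>_def using \<epsilon> powr_less_mono'[of "9/10" 0 \<epsilon>] by simp
  then have \<gamma>: "\<gamma> > 0" using \<rho> by (simp add: \<gamma>_def)
  \<comment> \<open>With 3^m 8^-t > 16 the error term 4 2^e \<rho>^N must exceed 1/(32t): otherwise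
    \<open>communication_bound\<close>, divided by N (2t)^N, would have a left-hand side above
    16/(32t) = 1/(2t), its right-hand side.\<close>
  obtain m where m: "16 * 8 ^ t < (3::real) ^ m" using real_arch_pow[of 3] by auto
  have m1: "m \<ge> 1" 
  proof (rule ccontr)
    assume "\<not> m \<ge> 1"
    then have "m = 0" by simp
    then have "16 * 8 ^ t < (1::real)" using m by simp
    moreover have "(8::real) ^ t \<ge> 1" by (rule one_le_power) simp
    ultimately show False by linarith
  qed
  \<comment> \<open>The part of the exponent that involves neither \<open>S\<close> nor
    \<open>p\<close>; once |C| \<ge> 2K/\<gamma> it is at most half of \<gamma> |C|.\<close>
  define K where "K = log 2 (128 * t) + m * 2 ^ k"
  obtain a :: nat where a: "2 * K / \<gamma> \<le> real a" using real_arch_simple by blast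
  define N0 where "N0 = Suc a"
  have N0: "N0 \<ge> 1" "real N0 \<ge> 2 * K / \<gamma>" using a by (auto simp: N0_def)
  have "\<gamma> / (4 * t * m) * real (card C) \<le> real S * real p"
    if r: "reduction n k t H C G own" and N: "N0 \<le> card C" and p: "p \<ge> 1" and R: "rand_solves n k H p S R"
    for n H and C :: "'c set" and G own p S R
  proof -
    interpret reduction n k t H C G own by (rule r)
    define N where "N = card C"
    have N1: "N \<ge> 1" using N N0 by (simp add: N_def)
    define e where "e = m * (S * Suc (p * t) + 2 ^ k)"
    have M: "((2 ^ S) ^ Suc (p * t) * 2 ^ 2 ^ k) ^ m = (2::real) ^ e"
      by (simp only: e_def power_mult[symmetric] power_add[symmetric] mult.commute[of m])
    have eps: "1 / (8 * t) - 2 * \<epsilon> = 1 / (16 * t)" using t by (simp add: \<epsilon>_def field_simps)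
    have "N * (2 * t) ^ N * (3 ^ m * (1/8)^t * (1 / (16 * t) - 4 * 2 ^ e * \<rho> ^ N))
       = 3 ^ m * ((1/8)^t * (1 / (16 * t) * N * (2 * t) ^ N - 4 * 2 ^ e * N * (2 * t * \<rho>) ^ N))"
      by (simp add: power_mult_distrib algebra_simps)
    also have "\<dots> \<le> N * (2 * t) ^ (N - 1)"
      using communication_bound[OF R, of \<epsilon> m] \<epsilon> unfolding \<rho>_def[symmetric] N_def eps
      by (simp only: M[symmetric] of_nat_mult of_nat_power of_nat_numeral less_imp_le)
    also have "real (N * (2 * t) ^ (N - 1)) = N * (2 * t) ^ N * (1 / (2 * t))"
      using N1 t power_minus_mult[of N "2 * real t"] by (simp add: field_simps)
    finally have "3 ^ m * (1/8)^t * (1 / (16 * t) - 4 * 2 ^ e * \<rho> ^ N) \<le> 1 / (2 * t)"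
      using N1 t by (subst (asm) mult_le_cancel_left_pos) auto
    moreover have "3 ^ m * (1/8)^t * (1 / (32 * t)) > 1 / (2 * t)"
    proof -
      have "3 ^ m * (1/8)^t > (16::real)" using m by (simp add: power_divide field_simps)
      then have "16 * (1 / real (32 * t)) < 3 ^ m * (1/8)^t * (1 / real (32 * t))"
        by (rule mult_strict_right_mono) (use t in simp)
      then show ?thesis by simp
    qed
    ultimately have "3 ^ m * (1/8)^t * (1 / (16 * t) - 4 * 2 ^ e * \<rho> ^ N) < 3 ^ m * (1/8)^t * (1 / (32 * t))"
      by linarith
    then have "1 / (16 * t) - 4 * 2 ^ e * \<rho> ^ N < 1 / (32 * real t)"
      by (subst (asm) mult_less_cancel_left_pos) auto
    then have "1 / (32 * real t) < 4 * 2 ^ e * \<rho> ^ N" by simp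
    then have "1 < 128 * t * 2 ^ e * \<rho> ^ N" using t by (simp add: field_simps)
    then have "log 2 1 < log 2 (128 * t * 2 ^ e * \<rho> ^ N)" using t \<rho> by (subst log_less_cancel_iff) auto
    also have "\<dots> = log 2 (128 * t) + e - N * \<gamma>"
      using t \<rho> by (simp add: log_mult log_nat_power \<gamma>_def)
    finally have "N * \<gamma> < log 2 (128 * t) + e" by simp
    also have "\<dots> = K + m * S * Suc (p * t)" by (simp add: K_def e_def algebra_simps)
    finally have 1: "N * \<gamma> < K + m * S * Suc (p * t)" by simp
    have "2 * K / \<gamma> \<le> N" using N0(2) N by (simp add: N_def)
    then have 2: "2 * K \<le> N * \<gamma>" using \<gamma> by (simp add: field_simps)
    have "p * t \<ge> 1" using p t by simp
    then have "m * S * Suc (p * t) \<le> m * S * (2 * (p * t))" by (intro mult_le_mono2) linarith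
    then have "real (m * S * Suc (p * t)) \<le> real (m * S * (2 * (p * t)))" by (rule of_nat_mono)
    with 1 2 have "N * \<gamma> \<le> 2 * real (m * S * (2 * (p * t)))" by linarith
    then have "N * \<gamma> \<le> (4 * t * m) * (S * p)" by (simp add: mult_ac)
    then show ?thesis using t m1 by (simp add: N_def field_simps)
  qed
  moreover have "\<gamma> / (4 * t * m) > 0" using \<gamma> t m1 by simp
  ultimately show ?thesis by blast
qed

section \<open>Implementing finite machines, and attained minima\<close>

lemma salg_of_machine:
  fixes X :: "'x set"
  assumes fin: "finite X" and card: "card X \<le> 2 ^ S" and i: "i \<in> X"
    and st: "\<And>x e. x \<in> X \<Longrightarrow> st x e \<in> X" and ed: "\<And>x. x \<in> X \<Longrightarrow> ed x \<in> X"
  shows "\<exists>A. space_bounded S A \<and> (\<forall>p es. run A p es = ot (((\<lambda>x. ed (fold (\<lambda>e y. st y e) es x)) ^^ p) i))"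
proof -
  obtain h where h: "bij_betw h X {0..<card X}" using ex_bij_betw_finite_nat[OF fin] by blast
  define g where "g = inv_into X h"
  have gh: "g (h x) = x" if "x \<in> X" for x using h that by (simp add: g_def bij_betw_def)
  have hX: "h x < 2 ^ S" if "x \<in> X" for x using bij_betwE[OF h] that card by fastforce
  have gX: "g s \<in> X" if "s < card X" for s
    using h that by (simp add: g_def bij_betw_def inv_into_into)
  \<comment> \<open>Numbers below 2^S that encode no state go to 0, as \<open>space_bounded\<close>
    constrains them too.\<close>
  define A where "A = \<lparr>init = h i, step = (\<lambda>s e. if s < card X then h (st (g s) e) else 0),
     end_pass = (\<lambda>s. if s < card X then h (ed (g s)) else 0), out = (\<lambda>s. ot (g s))\<rparr>"
  have hc: "h x < card X" if "x \<in> X" for x using bij_betwE[OF h] that by fastforce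
  have sp: "space_bounded S A"
    unfolding space_bounded_def A_def using hX gX i st ed by auto
  have fold: "fold (\<lambda>e t. step A t e) es (h x) = h (fold (\<lambda>e y. st y e) es x) \<and> fold (\<lambda>e y. st y e) es x \<in> X"
    if "x \<in> X" for es x
    using that by (induction es arbitrary: x) (auto simp: A_def hc gh st)
  have pass: "one_pass A es (h x) = h (ed (fold (\<lambda>e y. st y e) es x))" if "x \<in> X" for es x
    unfolding one_pass_def using fold[OF that, of es] by (simp add: A_def hc gh)
  have it: "(one_pass A es ^^ p) (h i) = h (((\<lambda>x. ed (fold (\<lambda>e y. st y e) es x)) ^^ p) i)
      \<and> ((\<lambda>x. ed (fold (\<lambda>e y. st y e) es x)) ^^ p) i \<in> X" for p es
    by (induction p) (auto simp: pass i fold ed)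
  have "run A p es = ot (((\<lambda>x. ed (fold (\<lambda>e y. st y e) es x)) ^^ p) i)" for p es
  proof -
    have "init A = h i" "out A s = ot (g s)" for s by (auto simp: A_def)
    then show ?thesis unfolding run_def using it[of p es] by (simp add: gh)
  qed
  with sp show ?thesis by blast
qed

lemma indsub_correct_exists: "\<exists>r. indsub_correct n k H G r"
proof (cases "\<exists>U. U \<subseteq> {..<n} \<and> induced_copy k H G U")
  case True
  then obtain U where "U \<subseteq> {..<n}" "induced_copy k H G U" by blast
  then show ?thesis by (intro exI[of _ "Some U"]) (simp add: indsub_correct_def)
qed (auto intro: exI[of _ None] simp: indsub_correct_def)

text \<open>Storing the whole graph always works. Hence the \<open>LEAST\<close> in
  \<open>Rspace\<close> is attained by an algorithm, to which the lower bound can be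
  applied.\<close>

lemma rand_solves_exists:
  assumes "p \<ge> 1"
  shows "\<exists>S R. rand_solves n k H p S R"
proof -
  define X where "X = Pow (all_pairs n)"
  define S where "S = card X"
  define st where "st x e = (if e \<in> all_pairs n then insert e x else x)" for x e
  define ot where "ot G = (SOME r. indsub_correct n k H G r)" for G
  have ot: "indsub_correct n k H G (ot G)" for G
    unfolding ot_def using indsub_correct_exists by (rule someI_ex)
  have "\<exists>A. space_bounded S A \<and> (\<forall>p es. run A p es = ot (((\<lambda>x. id (fold (\<lambda>e y. st y e) es x)) ^^ p) {}))"
    using finite_all_pairs[of n]
    by (intro salg_of_machine[of X]) (auto simp: X_def S_def st_def less_imp_le)
  then obtain A where A: "space_bounded S A"
     "\<And>p es. run A p es = ot (((\<lambda>x. fold (\<lambda>e y. st y e) es x) ^^ p) {})" by auto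
  have fold: "fold (\<lambda>e y. st y e) es x = x \<union> set es" if "set es \<subseteq> all_pairs n" for es x
    using that by (induction es arbitrary: x) (auto simp: st_def)
  have iter: "((\<lambda>x. fold (\<lambda>e y. st y e) es x) ^^ Suc p) {} = set es" if "set es \<subseteq> all_pairs n" for es p
    by (induction p) (auto simp: fold[OF that])
  have "indsub_correct n k H G (run A p es)" if "simple_graph n G" "is_stream G es" for G es
    using that ot[of G] iter[of es "p - 1"] assms by (auto simp: A(2) simple_graph_def is_stream_def)
  then have "rand_solves n k H p S (return_pmf A)"
    using A(1) by (auto simp: rand_solves_def indicator_def)
  then show ?thesis by blast
qed

text \<open>One player per pattern vertex keeps the number of players, and so the constants of
  \<open>reduction_bound\<close>, independent of \<open>n\<close>.\<close>

definition hard :: "nat \<Rightarrow> nat set set \<Rightarrow> bool" where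
  "hard k H \<longleftrightarrow> (\<exists>c>0. \<exists>n0. \<forall>n\<ge>n0. \<exists>(C :: (nat \<times> nat) set) G own.
      reduction n k k H C G own \<and> c * real n ^ 2 \<le> real (card C))"

lemma hard_Rspace:
  assumes k: "k \<ge> 1" and hard: "hard k H" and p: "\<And>n. p n \<ge> 1"
  shows "(\<lambda>n. real (Rspace k H n (p n))) \<in> \<Omega>(\<lambda>n. real n ^ 2 / real (p n))"
proof -
  obtain c n0 where c: "c > 0" and red: "\<And>n. n \<ge> n0 \<Longrightarrow> \<exists>(C :: (nat \<times> nat) set) G own.
      reduction n k k H C G own \<and> c * real n ^ 2 \<le> real (card C)"
    using hard unfolding hard_def by blast
  obtain \<delta> N0 where \<delta>: "\<delta> > 0" and bound: "\<And>n H (C :: (nat \<times> nat) set) G own p S R. reduction n k k H C G own \<Longrightarrow>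
      N0 \<le> card C \<Longrightarrow> p \<ge> 1 \<Longrightarrow> rand_solves n k H p S R \<Longrightarrow> \<delta> * real (card C) \<le> real S * real p"
    using reduction_bound[OF k, of k] by metis
  obtain n1 :: nat where n1: "real n1 \<ge> real N0 / c" using real_arch_simple by blast
  have "\<delta> * c * norm (real n ^ 2 / real (p n)) \<le> norm (real (Rspace k H n (p n)))"
    if n: "n \<ge> max (max n0 n1) 1" for n
  proof -
    obtain C :: "(nat \<times> nat) set" and G own where
      r: "reduction n k k H C G own" and C: "c * real n ^ 2 \<le> real (card C)" using red[of n] n by auto
    have "real N0 \<le> c * real n1" using n1 c by (simp add: field_simps)
    also have "\<dots> \<le> c * real n" using n c by simp
    also have "\<dots> \<le> c * real n ^ 2" using n c by (simp add: power2_eq_square)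
    finally have N0: "N0 \<le> card C" using C by linarith
    have "\<exists>R. rand_solves n k H (p n) (Rspace k H n (p n)) R"
      unfolding Rspace_def using rand_solves_exists[OF p] by (rule LeastI_ex)
    then obtain R where "rand_solves n k H (p n) (Rspace k H n (p n)) R" ..
    then have "\<delta> * real (card C) \<le> real (Rspace k H n (p n)) * real (p n)"
      using bound r N0 p by blast
    moreover have "\<delta> * (c * real n ^ 2) \<le> \<delta> * real (card C)" using C \<delta> by (intro mult_left_mono) auto
    ultimately have "\<delta> * (c * real n ^ 2) \<le> real (Rspace k H n (p n)) * real (p n)" by linarith
    then show ?thesis using p[of n] by (simp add: field_simps)
  qed
  then have "\<forall>\<^sub>F n in sequentially. \<delta> * c * norm (real n ^ 2 / real (p n)) \<le> norm (real (Rspace k H n (p n)))"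
    unfolding eventually_sequentially by blast
  then show ?thesis using \<delta> c by (intro landau_omega.bigI[of "\<delta> * c"]) auto
qed

section \<open>Gadgets\<close>

lemma induced_copy_compl:
  assumes "U \<subseteq> {..<n}"
  shows "induced_copy k H (all_pairs n - G) U \<longleftrightarrow> induced_copy k (graph_compl k H) G U"
proof -
  have "({i, j} \<in> H \<longleftrightarrow> {f i, f j} \<in> all_pairs n - G) \<longleftrightarrow> ({i, j} \<in> graph_compl k H \<longleftrightarrow> {f i, f j} \<in> G)"
    if f: "bij_betw f {..<k} U" and ij: "i < k" "j < k" "i \<noteq> j" for f i j
  proof -
    have "f i < n" "f j < n" using bij_betwE[OF f] ij assms by auto
    moreover have "f i \<noteq> f j" using f ij by (auto simp: bij_betw_def inj_on_def)
    ultimately have "{f i, f j} \<in> all_pairs n" by (auto simp: all_pairs_def)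
    moreover have "{i, j} \<in> all_pairs k" using ij by (auto simp: all_pairs_def)
    ultimately show ?thesis by (auto simp: graph_compl_def)
  qed
  then show ?thesis unfolding induced_copy_def by meson
qed

text \<open>Every pair has an owner whether or not it is an edge, so the owner can stream it exactly
  when it is missing from \<open>G X\<close>.\<close>

lemma reduction_compl:
  assumes "reduction n k t (graph_compl k H) C G own"
  shows "reduction n k t H C (\<lambda>X. all_pairs n - G X) own"
proof -
  interpret reduction n k t "graph_compl k H" C G own by (rule assms)
  have eq: "(\<exists>U. U \<subseteq> {..<n} \<and> induced_copy k H (all_pairs n - G X) U) \<longleftrightarrow>
      (\<exists>U. U \<subseteq> {..<n} \<and> induced_copy k (graph_compl k H) (G X) U)" for X
    using induced_copy_compl by blast
  show ?thesis
  proof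
    show "t \<ge> 1" "finite C" by (fact t C)+
    show "own e < t" for e by (rule own)
    show "all_pairs n - G X \<subseteq> all_pairs n" for X by blast
    show "e \<in> all_pairs n - G X \<longleftrightarrow> e \<in> all_pairs n - G X'" if "X (own e) = X' (own e)" for X X' e
      using G_own[of X e X', OF that] by blast
  qed (unfold eq, fact disj, fact meet)
qed

lemma hard_compl:
  assumes "hard k (graph_compl k H)"
  shows "hard k H"
proof -
  obtain c n0 where c: "c > 0" and red: "\<And>n. n \<ge> n0 \<Longrightarrow> \<exists>(C :: (nat \<times> nat) set) G own.
      reduction n k k (graph_compl k H) C G own \<and> c * real n ^ 2 \<le> real (card C)"
    using assms unfolding hard_def by blast
  have "\<exists>(C :: (nat \<times> nat) set) G own. reduction n k k H C G own \<and> c * real n ^ 2 \<le> real (card C)"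
    if n: "n \<ge> n0" for n
  proof -
    obtain C :: "(nat \<times> nat) set" and G own where
      "reduction n k k (graph_compl k H) C G own" and card: "c * real n ^ 2 \<le> real (card C)"
      using red[OF n] by blast
    from reduction_compl[OF this(1)] card show ?thesis by blast
  qed
  with c show ?thesis unfolding hard_def by blast
qed

definition embeds :: "nat \<Rightarrow> nat set set \<Rightarrow> 'v set \<Rightarrow> ('v \<Rightarrow> 'v \<Rightarrow> bool) \<Rightarrow> (nat \<Rightarrow> 'v) \<Rightarrow> bool" where
  "embeds k H V adj \<phi> \<longleftrightarrow> inj_on \<phi> {..<k} \<and> \<phi> ` {..<k} \<subseteq> V \<and>
     (\<forall>i<k. \<forall>j<k. i \<noteq> j \<longrightarrow> ({i, j} \<in> H \<longleftrightarrow> adj (\<phi> i) (\<phi> j)))"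

text \<open>Gadgets are described on structured vertices; numbering these vertices turns them into
  graphs on \<open>{..<n}\<close>.\<close>

lemma reduction_of_adj:
  fixes adj :: "(nat \<Rightarrow> 'c set) \<Rightarrow> 'v \<Rightarrow> 'v \<Rightarrow> bool" and ow :: "'v \<Rightarrow> 'v \<Rightarrow> nat"
  assumes t: "t \<ge> 1" and C: "finite C" and V: "finite V" "card V = n"
    and sym: "\<And>X u v. adj X u v \<Longrightarrow> adj X v u"
    and ow_sym: "\<And>u v. ow u v = ow v u"
    and ow: "\<And>u v. u \<in> V \<Longrightarrow> v \<in> V \<Longrightarrow> ow u v < t"
    and local: "\<And>X X' u v. X (ow u v) = X' (ow u v) \<Longrightarrow> adj X u v \<Longrightarrow> adj X' u v"
    and disj: "\<And>X \<phi>. (\<And>q. X q \<subseteq> C) \<Longrightarrow> (\<And>q q'. q \<noteq> q' \<Longrightarrow> X q \<inter> X q' = {}) \<Longrightarrow> \<not> embeds k H V (adj X) \<phi>"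
    and meet: "\<And>X c. (\<And>q. X q \<subseteq> C) \<Longrightarrow> c \<in> C \<Longrightarrow> (\<And>q. q < t \<Longrightarrow> c \<in> X q) \<Longrightarrow> \<exists>\<phi>. embeds k H V (adj X) \<phi>"
  shows "\<exists>G own. reduction n k t H C G own"
proof -
  obtain h where h: "bij_betw h V {..<n}"
    using V ex_bij_betw_finite_nat[of V] by (auto simp: atLeast0LessThan)
  define g where "g = inv_into V h"
  have g: "bij_betw g {..<n} V" unfolding g_def using h by (rule bij_betw_inv_into)
  have hg: "h (g x) = x" if "x < n" for x
    using h that by (simp add: g_def bij_betw_def f_inv_into_f)
  have gV: "g x \<in> V" if "x < n" for x using bij_betwE[OF g] that by auto
  define G where "G X = {e. \<exists>x<n. \<exists>y<n. x \<noteq> y \<and> e = {x, y} \<and> adj X (g x) (g y)}" for X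
  \<comment> \<open>The locale asks for an owner of every set, so 0 is the default for sets that are
    not pairs of vertices.\<close>
  define own where "own e = (let q = ow (g (Min e)) (g (Max e)) in if q < t then q else 0)" for e
  have own_pair: "own {x, y} = ow (g x) (g y)" if "x < n" "y < n" for x y
    using ow[OF gV gV, OF that] ow[OF gV gV, OF that(2,1)] ow_sym[of "g x" "g y"]
    by (cases "x \<le> y") (auto simp: own_def Let_def min_def max_def)
  have G_pair: "{x, y} \<in> G X \<longleftrightarrow> adj X (g x) (g y)" if "x < n" "y < n" "x \<noteq> y" for x y X
    unfolding G_def using that sym by (auto simp: doubleton_eq_iff)
  have eq: "(\<exists>U. U \<subseteq> {..<n} \<and> induced_copy k H (G X) U) \<longleftrightarrow> (\<exists>\<phi>. embeds k H V (adj X) \<phi>)" for X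
  proof
    assume "\<exists>U. U \<subseteq> {..<n} \<and> induced_copy k H (G X) U"
    then obtain U f where U: "U \<subseteq> {..<n}" and f: "bij_betw f {..<k} U"
      and fe: "\<And>i j. i < k \<Longrightarrow> j < k \<Longrightarrow> i \<noteq> j \<Longrightarrow> {i, j} \<in> H \<longleftrightarrow> {f i, f j} \<in> G X"
      unfolding induced_copy_def by blast
    have fn: "f i < n" if "i < k" for i using bij_betwE[OF f] U that by auto
    have fi: "f i \<noteq> f j" if "i < k" "j < k" "i \<noteq> j" for i j
      using f that by (auto simp: bij_betw_def inj_on_def)
    have "embeds k H V (adj X) (g \<circ> f)"
      unfolding embeds_def
    proof (intro conjI)
      show "inj_on (g \<circ> f) {..<k}"
        using f g U by (intro comp_inj_on) (auto simp: bij_betw_def intro: inj_on_subset)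
      show "(g \<circ> f) ` {..<k} \<subseteq> V" using fn gV by auto
      show "\<forall>i<k. \<forall>j<k. i \<noteq> j \<longrightarrow> ({i, j} \<in> H \<longleftrightarrow> adj X ((g \<circ> f) i) ((g \<circ> f) j))"
        using fe G_pair fn fi by simp
    qed
    then show "\<exists>\<phi>. embeds k H V (adj X) \<phi>" by blast
  next
    assume "\<exists>\<phi>. embeds k H V (adj X) \<phi>"
    then obtain \<phi> where \<phi>: "inj_on \<phi> {..<k}" "\<phi> ` {..<k} \<subseteq> V"
      "\<And>i j. i < k \<Longrightarrow> j < k \<Longrightarrow> i \<noteq> j \<Longrightarrow> {i, j} \<in> H \<longleftrightarrow> adj X (\<phi> i) (\<phi> j)"
      unfolding embeds_def by blast
    have inj: "inj_on (h \<circ> \<phi>) {..<k}"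
      using \<phi> h by (intro comp_inj_on) (auto simp: bij_betw_def intro: inj_on_subset)
    have n: "h (\<phi> i) < n" if "i < k" for i using bij_betwE[OF h] \<phi>(2) that by auto
    have gh: "g (h (\<phi> i)) = \<phi> i" if "i < k" for i
      using h \<phi>(2) that by (auto simp: g_def bij_betw_def)
    have "induced_copy k H (G X) ((h \<circ> \<phi>) ` {..<k})"
      unfolding induced_copy_def
    proof (intro exI conjI allI impI)
      show "bij_betw (h \<circ> \<phi>) {..<k} ((h \<circ> \<phi>) ` {..<k})" using inj by (rule inj_on_imp_bij_betw)
      fix i j assume ij: "i < k" "j < k" "i \<noteq> j"
      then have "(h \<circ> \<phi>) i \<noteq> (h \<circ> \<phi>) j" using inj_onD[OF inj, of i j] by auto
      then show "{i, j} \<in> H \<longleftrightarrow> {(h \<circ> \<phi>) i, (h \<circ> \<phi>) j} \<in> G X"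
        using \<phi>(3)[OF ij] G_pair n gh ij by simp
    qed
    moreover have "(h \<circ> \<phi>) ` {..<k} \<subseteq> {..<n}" using n by auto
    ultimately show "\<exists>U. U \<subseteq> {..<n} \<and> induced_copy k H (G X) U" by blast
  qed
  have "reduction n k t H C G own"
  proof
    show "t \<ge> 1" "finite C" by (fact t C)+
    show "own e < t" for e using t by (auto simp: own_def Let_def)
    show "G X \<subseteq> all_pairs n" for X by (auto simp: G_def all_pairs_def)
    have "e \<in> G X'" if X: "X (own e) = X' (own e)" and e: "e \<in> G X" for X X' e
    proof -
      obtain x y where xy: "x < n" "y < n" "x \<noteq> y" "e = {x, y}" "adj X (g x) (g y)"
        using e unfolding G_def by blast
      then have "adj X' (g x) (g y)" using local X own_pair by metis
      then show ?thesis using xy G_pair by blast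
    qed
    then show "e \<in> G X \<longleftrightarrow> e \<in> G X'" if "X (own e) = X' (own e)" for X X' e
      using that by metis
  qed (unfold eq, use disj in blast, use meet in blast)
  then show ?thesis by blast
qed

subsection \<open>Non-bipartite patterns\<close>

definition two_colourable :: "('v \<Rightarrow> 'v \<Rightarrow> bool) \<Rightarrow> 'v set \<Rightarrow> bool" where
  "two_colourable adj S \<longleftrightarrow> (\<exists>col :: 'v \<Rightarrow> bool. \<forall>u\<in>S. \<forall>v\<in>S. adj u v \<longrightarrow> col u \<noteq> col v)"

definition edge :: "nat set set \<Rightarrow> nat \<Rightarrow> nat \<Rightarrow> bool" where
  "edge H u v \<longleftrightarrow> {u, v} \<in> H"

text \<open>The vertices of \<open>T\<close> are kept, \<open>r\<close> is replaced by copies \<open>(r, i)\<close>, and the rest of the pattern by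
  copies with second coordinate \<open>j\<close>; player \<open>h\<close> decides which pairs \<open>(r, i)\<close>, \<open>(h, j)\<close> are joined.\<close>

fun blowup :: "nat set set \<Rightarrow> nat set \<Rightarrow> nat \<Rightarrow> (nat \<Rightarrow> (nat \<times> nat) set) \<Rightarrow> nat \<times> nat \<Rightarrow> nat \<times> nat \<Rightarrow> bool" where
  "blowup H T r X (h, i) (h', i') \<longleftrightarrow> edge H h h' \<and>
     (h \<in> T \<or> h' \<in> T \<or> (h \<noteq> r \<and> h' \<noteq> r \<and> i = i') \<or>
      (h = r \<and> h' \<noteq> r \<and> (i, i') \<in> X h') \<or> (h' = r \<and> h \<noteq> r \<and> (i', i) \<in> X h))"

text \<open>The default 0 concerns pairs without a copy of \<open>r\<close>, whose adjacency is
  fixed.\<close>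

fun blowup_owner :: "nat \<Rightarrow> nat \<times> nat \<Rightarrow> nat \<times> nat \<Rightarrow> nat" where
  "blowup_owner r (h, i) (h', i') = (if h = r then h' else if h' = r then h else 0)"

definition blowup_vertices :: "nat \<Rightarrow> nat set \<Rightarrow> nat \<Rightarrow> nat \<Rightarrow> nat \<Rightarrow> (nat \<times> nat) set" where
  "blowup_vertices k T r m1 m2 = T \<times> {0} \<union> {r} \<times> {..<m1} \<union> ({..<k} - insert r T) \<times> {..<m2}"

text \<open>A set without a 2-colouring projects injectively to a least one of \<open>H\<close>, so it contains a single copy of \<open>r\<close>.
  As the inputs are disjoint, that copy has at most one neighbour in every copy of the rest, and flipping the
  colours in some of these copies gives a 2-colouring.\<close>

lemma blowup_two_colourable:
  assumes g: "\<And>S. S \<subseteq> {..<k} \<Longrightarrow> card S < g \<Longrightarrow> two_colourable (edge H) S"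
    and R: "\<And>S. S \<subseteq> {..<k} - insert r T \<Longrightarrow> card S \<le> g \<Longrightarrow> two_colourable (edge H) S"
    and X: "\<And>q q'. q \<noteq> q' \<Longrightarrow> X q \<inter> X q' = {}"
    and simple: "\<And>v. \<not> edge H v v"
    and W: "finite W" "card W \<le> g" "fst ` W \<subseteq> {..<k} - T"
  shows "two_colourable (blowup H T r X) W"
proof (rule ccontr)
  assume non: "\<not> two_colourable (blowup H T r X) W"
  have adj_edge: "edge H (fst u) (fst v)" if "blowup H T r X u v" for u v
    using that by (cases u; cases v) auto
  have "\<not> two_colourable (edge H) (fst ` W)"
  proof
    assume "two_colourable (edge H) (fst ` W)"
    then obtain col :: "nat \<Rightarrow> bool" where "\<forall>u\<in>fst ` W. \<forall>v\<in>fst ` W. edge H u v \<longrightarrow> col u \<noteq> col v"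
      unfolding two_colourable_def by blast
    then have "two_colourable (blowup H T r X) W"
      unfolding two_colourable_def using adj_edge by (intro exI[of _ "\<lambda>u. col (fst u)"]) auto
    with non show False by contradiction
  qed
  then have nonF: "\<And>S. S = fst ` W \<Longrightarrow> \<not> two_colourable (edge H) S" by blast
  have "card (fst ` W) \<ge> g" using g[of "fst ` W"] nonF W(3) by force
  moreover have "card (fst ` W) \<le> card W" using W(1) by (rule card_image_le)
  ultimately have cW: "card (fst ` W) = card W" "card (fst ` W) = g" using W(2) by auto
  then have inj: "inj_on fst W" using W(1) by (simp add: eq_card_imp_inj_on)
  \<comment> \<open>A projection without \<open>r\<close> would avoid \<open>insert r T\<close> and
    have size \<open>g\<close>, hence be 2-colourable by \<open>R\<close>.\<close>
  have "r \<in> fst ` W" using R[of "fst ` W"] nonF W(3) cW(2) by blast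
  then obtain i0 where i0: "(r, i0) \<in> W" by auto
  have uniq: "i = i0" if "(r, i) \<in> W" for i using inj_onD[OF inj _ that i0] by simp
  have fin: "finite (fst ` W)" using W(1) by simp
  have "card (fst ` W - {r}) < g" using cW(2) \<open>r \<in> fst ` W\<close> fin by (metis card_Diff1_less)
  then have "two_colourable (edge H) (fst ` W - {r})" using g W(3) by blast
  then obtain c0 :: "nat \<Rightarrow> bool" where "\<forall>u\<in>fst ` W - {r}. \<forall>v\<in>fst ` W - {r}. edge H u v \<longrightarrow> c0 u \<noteq> c0 v"
    unfolding two_colourable_def by blast
  then have c0: "c0 u \<noteq> c0 v" if "u \<in> fst ` W - {r}" "v \<in> fst ` W - {r}" "edge H u v" for u v
    using that by blast
  \<comment> \<open>The copy of \<open>r\<close> gets colour True. Copy \<open>i\<close> of the rest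
    is flipped if the only vertex there that can be joined to \<open>(r, i0)\<close> has colour
    True, so that this vertex ends up False.\<close>
  define flip where "flip i \<longleftrightarrow> (\<exists>h. (i0, i) \<in> X h \<and> c0 h)" for i
  define col where "col u = (if fst u = r then True else c0 (fst u) \<noteq> flip (snd u))" for u
  have rcol: "col (r, i)" for i by (simp add: col_def)
  have nb: "\<not> col (h, i)" if "(i0, i) \<in> X h" "h \<noteq> r" for h i
  proof -
    have "h' = h" if "(i0, i) \<in> X h'" for h'
      using X[of h h'] that \<open>(i0, i) \<in> X h\<close> by blast
    then have "flip i \<longleftrightarrow> c0 h" unfolding flip_def using \<open>(i0, i) \<in> X h\<close> by blast
    then show ?thesis using \<open>h \<noteq> r\<close> by (simp add: col_def)
  qed
  have "col u \<noteq> col v" if u: "u \<in> W" and v: "v \<in> W" and adj: "blowup H T r X u v" for u v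
  proof -
    obtain h i h' i' where uv: "u = (h, i)" "v = (h', i')" by (cases u, cases v)
    have hT: "h \<notin> T" "h' \<notin> T" using u v W(3) uv by force+
    have e: "edge H h h'" using adj uv by simp
    consider "h \<noteq> r" "h' \<noteq> r" "i = i'" | "h = r" "h' \<noteq> r" "(i, i') \<in> X h'" | "h' = r" "h \<noteq> r" "(i', i) \<in> X h"
      using adj hT by (auto simp: uv)
    then show ?thesis
    proof cases
      case 1
      have "c0 h \<noteq> c0 h'" using c0[of h h'] 1 e u v uv by force
      then show ?thesis using 1 by (auto simp: col_def uv)
    next
      case 2
      then have "i = i0" using uniq u uv by blast
      then show ?thesis using nb[of i' h'] 2 by (simp add: uv rcol)
    next
      case 3
      then have "i' = i0" using uniq v uv by blast
      then show ?thesis using nb[of i h] 3 by (simp add: uv rcol)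
    qed
  qed
  then have "two_colourable (blowup H T r X) W" unfolding two_colourable_def by blast
  with non show False by contradiction
qed

text \<open>Let \<open>g\<close> be the least size of a vertex set that is not 2-colourable, and let \<open>insert r T\<close> be a smallest set that
  meets all such sets of size \<open>g\<close>. An embedding of \<open>H\<close> into the blow-up meets \<open>T\<close> in at most \<open>card T\<close> vertices,
  hence it has such a set outside \<open>T\<close>.\<close>

lemma hard_non_bipartite:
  assumes H: "simple_graph k H" and non: "\<not> two_colourable (edge H) {..<k}"
  shows "hard k H"
proof -
  have simple: "\<not> edge H v v" for v
  proof
    assume "edge H v v"
    then have "{v, v} \<in> all_pairs k" using H by (auto simp: edge_def simple_graph_def)
    then show False by (auto simp: all_pairs_def doubleton_eq_iff)
  qed
  have sym: "edge H u v \<longleftrightarrow> edge H v u" for u v by (simp add: edge_def insert_commute)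
  have k: "k \<ge> 1" using non by (cases k) (auto simp: two_colourable_def)
  define Q where "Q m \<longleftrightarrow> (\<exists>S\<subseteq>{..<k}. card S = m \<and> \<not> two_colourable (edge H) S)" for m
  define g where "g = (LEAST m. Q m)"
  have "Q (card {..<k})" using non unfolding Q_def by blast
  then have Qg: "Q g" unfolding g_def by (rule LeastI)
  have g: "two_colourable (edge H) S" if "S \<subseteq> {..<k}" "card S < g" for S
    using not_less_Least[of "card S" Q] that unfolding g_def Q_def by blast
  define good where "good R \<longleftrightarrow> (\<forall>S\<subseteq>{..<k} - R. card S \<le> g \<longrightarrow> two_colourable (edge H) S)" for R
  define c where "c = (LEAST m. \<exists>R\<subseteq>{..<k}. card R = m \<and> good R)"
  have "good {..<k}" by (auto simp: good_def two_colourable_def)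
  then have "\<exists>R\<subseteq>{..<k}. card R = card {..<k} \<and> good R" by blast
  then have "\<exists>R\<subseteq>{..<k}. card R = c \<and> good R" unfolding c_def by (rule LeastI)
  then obtain R where R: "R \<subseteq> {..<k}" "card R = c" "good R" by blast
  have minR: "\<not> good R'" if "R' \<subseteq> {..<k}" "card R' < c" for R'
    using not_less_Least[of "card R'" "\<lambda>m. \<exists>R\<subseteq>{..<k}. card R = m \<and> good R"] that unfolding c_def by blast
  have "R \<noteq> {}" using Qg R(3) unfolding Q_def good_def by fastforce
  then obtain r where r: "r \<in> R" by blast
  define T where "T = R - {r}"
  have RT: "R = insert r T" "r \<notin> T" using r by (auto simp: T_def)
  have fR: "finite R" using R(1) finite_subset by blast
  have fT: "finite T" by (simp add: T_def fR)
  have cT: "card T < c" using card_Diff1_less[OF fR r] R(2) by (simp add: T_def)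
  have rk: "r < k" and Tk: "T \<subseteq> {..<k}" using R(1) RT by auto
  define d where "d = card ({..<k} - insert r T)"
  have cVk: "k = Suc (card T + d)"
  proof -
    have "card {..<k} = card (insert r T) + card ({..<k} - insert r T)"
      using card_Diff_subset[of "insert r T" "{..<k}"] card_mono[of "{..<k}" "insert r T"] fT rk Tk by auto
    then show ?thesis using RT(2) fT by (simp add: d_def)
  qed
  have red: "\<exists>G own. reduction n k k H ({..<m1} \<times> {..<m2}) G own"
    if n: "n = card T + m1 + d * m2" for n m1 m2
  proof (rule reduction_of_adj[where V = "blowup_vertices k T r m1 m2" and adj = "blowup H T r" and ow = "blowup_owner r"])
    let ?V = "blowup_vertices k T r m1 m2"
    show "k \<ge> 1" by (rule k)
    show "finite ({..<m1} \<times> {..<m2})" by simp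
    show "finite ?V" using fT by (simp add: blowup_vertices_def)
    have "card ?V = card (T \<times> {0::nat} \<union> {r} \<times> {..<m1}) + card (({..<k} - insert r T) \<times> {..<m2})"
      unfolding blowup_vertices_def using fT by (intro card_Un_disjoint) auto
    also have "card (T \<times> {0::nat} \<union> {r} \<times> {..<m1}) = card (T \<times> {0::nat}) + card ({r} \<times> {..<m1})"
      using fT RT(2) by (intro card_Un_disjoint) auto
    finally show "card ?V = n" by (simp add: card_cartesian_product n d_def)
    show "blowup H T r X v u" if "blowup H T r X u v" for X u v
      using that sym by (cases u; cases v) auto
    show "blowup_owner r u v = blowup_owner r v u" for u v
      by (cases u; cases v) auto
    show "blowup_owner r u v < k" if "u \<in> ?V" "v \<in> ?V" for u v
      using that rk Tk by (cases u; cases v) (auto simp: blowup_vertices_def)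
    show "blowup H T r X' u v" if "X (blowup_owner r u v) = X' (blowup_owner r u v)" "blowup H T r X u v" for X X' u v
      using that by (cases u; cases v) (auto split: if_splits)
    show "\<exists>\<phi>. embeds k H ?V (blowup H T r X) \<phi>"
      if c: "c \<in> {..<m1} \<times> {..<m2}" and full: "\<And>q. q < k \<Longrightarrow> c \<in> X q" for X c
    proof -
      obtain i0 j0 where c: "c = (i0, j0)" "i0 < m1" "j0 < m2" using c by auto
      define \<phi> where "\<phi> h = (h, if h \<in> T then 0 else if h = r then i0 else j0)" for h
      have "embeds k H ?V (blowup H T r X) \<phi>"
        unfolding embeds_def
      proof (intro conjI allI impI)
        show "inj_on \<phi> {..<k}" by (auto simp: \<phi>_def inj_on_def)
        show "\<phi> ` {..<k} \<subseteq> ?V" 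
          using c RT(2) by (auto simp: \<phi>_def blowup_vertices_def split: if_splits)
        show "{i, j} \<in> H \<longleftrightarrow> blowup H T r X (\<phi> i) (\<phi> j)" if "i < k" "j < k" "i \<noteq> j" for i j
          using that full[of i] full[of j] c(1)
          by (auto simp: \<phi>_def edge_def)
      qed
      then show ?thesis by blast
    qed
    show "\<not> embeds k H ?V (blowup H T r X) \<phi>"
      if X: "\<And>q q'. q \<noteq> q' \<Longrightarrow> X q \<inter> X q' = {}" for X \<phi>
    proof
      assume "embeds k H ?V (blowup H T r X) \<phi>"
      then have \<phi>: "inj_on \<phi> {..<k}" "\<phi> ` {..<k} \<subseteq> ?V"
        "\<And>i j. i < k \<Longrightarrow> j < k \<Longrightarrow> i \<noteq> j \<Longrightarrow> edge H i j \<longleftrightarrow> blowup H T r X (\<phi> i) (\<phi> j)"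
        unfolding embeds_def edge_def by auto
      define T' where "T' = {h. h < k \<and> fst (\<phi> h) \<in> T}"
      have "\<phi> ` T' \<subseteq> T \<times> {0}" using \<phi>(2) RT(2) by (fastforce simp: T'_def blowup_vertices_def)
      then have "card (\<phi> ` T') \<le> card (T \<times> {0::nat})" using fT by (intro card_mono) auto
      moreover have "inj_on \<phi> T'" using \<phi>(1) by (rule inj_on_subset) (auto simp: T'_def)
      ultimately have "card T' < c" using cT by (simp add: card_image card_cartesian_product)
      then have "\<not> good T'" using minR[of T'] by (auto simp: T'_def)
      then obtain S where S: "S \<subseteq> {..<k} - T'" "card S \<le> g" "\<not> two_colourable (edge H) S"
        unfolding good_def by blast
      have fS: "finite S" using S(1) finite_subset by blast
      have "two_colourable (blowup H T r X) (\<phi> ` S)"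
      proof (rule blowup_two_colourable[of k g H r T X])
        show "two_colourable (edge H) S" if "S \<subseteq> {..<k} - insert r T" "card S \<le> g" for S
          using R(3) that unfolding good_def RT(1) by blast
        show "card (\<phi> ` S) \<le> g" using card_image_le[OF fS, of \<phi>] S(2) by simp
        have "fst (\<phi> s) < k" if "s \<in> S" for s
        proof -
          have "\<phi> s \<in> ?V" using \<phi>(2) S(1) that by auto
          then show ?thesis using rk Tk by (auto simp: blowup_vertices_def)
        qed
        then show "fst ` \<phi> ` S \<subseteq> {..<k} - T" using S(1) by (auto simp: T'_def)
      qed (use g X simple fS in auto)
      then obtain col :: "nat \<times> nat \<Rightarrow> bool" where col: "\<forall>u\<in>\<phi> ` S. \<forall>v\<in>\<phi> ` S. blowup H T r X u v \<longrightarrow> col u \<noteq> col v"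
            unfolding two_colourable_def by blast
      have "col (\<phi> u) \<noteq> col (\<phi> v)" if "u \<in> S" "v \<in> S" "edge H u v" for u v
      proof -
        have "u \<noteq> v" "u < k" "v < k" using that S(1) simple by auto
        then show ?thesis using col that \<phi>(3) by blast
      qed
      then have "two_colourable (edge H) S"
        unfolding two_colourable_def by (intro exI[of _ "col \<circ> \<phi>"]) simp
      with S(3) show False by contradiction
    qed
  qed
  have main: "\<exists>(C :: (nat \<times> nat) set) G own. reduction n k k H C G own \<and> 1 / (16 * real k) * real n ^ 2 \<le> real (card C)"
    if n: "n \<ge> 4 * k" for n :: nat
  proof -
    \<comment> \<open>The copies of the rest use at most half of the vertices and \<open>T\<close>
      at most a quarter; \<open>m1\<close> absorbs the remainder, so that exactly \<open>n\<close>
      vertices are used.\<close>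
    define m2 where "m2 = n div (2 * k)"
    define m1 where "m1 = n - card T - d * m2"
    have "m2 * (2 * k) \<le> n" unfolding m2_def by (rule div_times_less_eq_dividend)
    then have "2 * (k * m2) \<le> n" by (simp add: mult_ac)
    moreover have "d * m2 \<le> k * m2" using cVk by (intro mult_le_mono1) linarith
    ultimately have dm: "2 * (d * m2) \<le> n" by linarith
    have cTk: "card T \<le> k" using cVk by linarith
    have "n = card T + m1 + d * m2" using dm cTk n unfolding m1_def by linarith
    from red[OF this] obtain G own where G: "reduction n k k H ({..<m1} \<times> {..<m2}) G own" by blast
    have "4 * m1 \<ge> n" using dm cTk n unfolding m1_def by linarith
    then have 1: "real n / 4 \<le> m1" by linarith
    have "n = m2 * (2 * k) + n mod (2 * k)" unfolding m2_def by (rule div_mult_mod_eq[symmetric])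
    moreover have "n mod (2 * k) < 2 * k" using k by simp
    ultimately have "n < m2 * (2 * k) + 2 * k" by linarith
    then have "real n < real (m2 * (2 * k) + 2 * k)" by (rule of_nat_less_iff[THEN iffD2])
    moreover have "real (4 * k) \<le> real n" using n by (rule of_nat_mono)
    ultimately have "real n \<le> 4 * real k * real m2" by (simp add: algebra_simps)
    then have 2: "real n / (4 * k) \<le> m2" using k by (simp add: field_simps)
    have "1 / (16 * real k) * real n ^ 2 = (real n / 4) * (real n / (4 * k))" by (simp add: power2_eq_square)
    also have "\<dots> \<le> real m1 * real m2" using 1 2 by (intro mult_mono) auto
    finally have "1 / (16 * real k) * real n ^ 2 \<le> real (card ({..<m1} \<times> {..<m2}))"
      by (simp add: card_cartesian_product)
    with G show ?thesis by blast
  qed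
  have pos: "1 / (16 * real k) > (0::real)" using k by simp
  show ?thesis unfolding hard_def
    by (rule exI[of _ "1 / (16 * real k)"], rule conjI[OF pos], rule exI[of _ "4 * k"], intro allI impI, rule main)
qed

subsection \<open>The four-cycle\<close>

text \<open>If the inputs are disjoint, then every neighbour of \<open>(2, j)\<close> with label 3 is also a neighbour of \<open>(1, j)\<close>,
  so that the edge between \<open>(1, j)\<close> and \<open>(2, j)\<close> lies on no induced four-cycle.\<close>

fun square_arc :: "(nat \<Rightarrow> (nat \<times> nat) set) \<Rightarrow> nat \<times> nat \<Rightarrow> nat \<times> nat \<Rightarrow> bool" where
  "square_arc X (l, i) (l', i') \<longleftrightarrow>
      l = 0 \<and> (l' = 1 \<or> l' = 3) \<or> l = 3 \<and> l' = 3 \<or> l = 1 \<and> l' = 2 \<and> i = i' \<or>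
      l = 1 \<and> l' = 3 \<and> (i', i) \<notin> X 0 \<or> l = 2 \<and> l' = 3 \<and> (i', i) \<in> X 1"

definition square_adj :: "(nat \<Rightarrow> (nat \<times> nat) set) \<Rightarrow> nat \<times> nat \<Rightarrow> nat \<times> nat \<Rightarrow> bool" where
  "square_adj X u v \<longleftrightarrow> square_arc X u v \<or> square_arc X v u"

definition square_owner :: "nat \<times> nat \<Rightarrow> nat \<times> nat \<Rightarrow> nat" where
  "square_owner u v = (if fst u = 2 \<or> fst v = 2 then 1 else 0)"

definition square_vertices :: "nat \<Rightarrow> nat \<Rightarrow> (nat \<times> nat) set" where
  "square_vertices m1 m2 = {(0, 0)} \<union> {1, 2} \<times> {..<m2} \<union> {3} \<times> {..<m1}"

lemma square_adj_sym: "square_adj X u v \<longleftrightarrow> square_adj X v u"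
  unfolding square_adj_def by (rule disj_commute)

lemma square_arc_own:
  assumes "X (square_owner u v) = X' (square_owner u v)" "square_arc X u v"
  shows "square_arc X' u v"
proof -
  obtain l i l' i' where uv: "u = (l, i)" "v = (l', i')" by (cases u, cases v)
  show ?thesis
    using assms unfolding uv square_arc.simps by (elim disjE conjE) (simp_all add: square_owner_def)
qed

lemma square_induced_cycle_half:
  assumes X: "X 0 \<inter> X 1 = {}"
    and V: "x \<in> square_vertices m1 m2" "y \<in> square_vertices m1 m2" "z \<in> square_vertices m1 m2" "w \<in> square_vertices m1 m2"
    and S: "fst x \<in> {1, 2}" "fst y \<in> {1, 2}" and K: "fst z \<in> {0, 3}" "fst w \<in> {0, 3}"
    and adj: "square_adj X x y" "square_adj X y z" "square_adj X w x"
      "\<not> square_adj X x z" "\<not> square_adj X y w"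
  shows False
proof -
  have no: False
    if "c \<in> square_vertices m1 m2" "fst c \<in> {0, 3}" "square_adj X (2, j) c" "\<not> square_adj X (1, j) c" for j c
    using that X by (cases c) (auto simp: square_adj_def square_vertices_def)
  obtain j where "x = (1, j) \<and> y = (2, j) \<or> x = (2, j) \<and> y = (1, j)"
    using S adj(1) by (cases x, cases y) (auto simp: square_adj_def)
  then show False
  proof
    assume "x = (1, j) \<and> y = (2, j)"
    then show False using no[OF V(3) K(1), of j] adj by simp
  next
    assume "x = (2, j) \<and> y = (1, j)"
    then show False using no[OF V(4) K(2), of j] adj square_adj_sym[of X w x] by simp
  qed
qed

lemma square_matching:
  assumes "fst x \<in> {1, 2}" "fst y \<in> {1, 2}" "square_adj X x y"
  shows "snd x = snd y \<and> fst x \<noteq> fst y"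
proof -
  obtain l i l' i' where xy: "x = (l, i)" "y = (l', i')" by (cases x, cases y)
  show ?thesis
    using assms unfolding xy square_adj_def square_arc.simps by (elim disjE conjE) simp_all
qed

lemma square_no_path:
  assumes "fst x \<in> {1, 2}" "fst y \<in> {1, 2}" "fst z \<in> {1, 2}" "square_adj X x y" "square_adj X y z"
  shows "x = z"
  using square_matching[OF assms(1,2,4)] square_matching[OF assms(2,3,5)] assms(1-3)
  by (intro prod_eqI) auto

text \<open>Labels 0 and 3 form a clique, labels 1 and 2 a matching. No diagonal of the cycle lies
  in the clique, as diagonals are non-edges. Thus each diagonal has an end in the matching; if one
  had both, they would form a path with two edges there. So the matching contains exactly two
  vertices of the cycle, consecutive ones, and the four rotations are covered by
  \<open>square_induced_cycle_half\<close>.\<close>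

lemma square_no_induced_cycle:
  assumes X: "X 0 \<inter> X 1 = {}"
    and V: "u0 \<in> square_vertices m1 m2" "u1 \<in> square_vertices m1 m2" "u2 \<in> square_vertices m1 m2" "u3 \<in> square_vertices m1 m2"
    and ne: "u0 \<noteq> u2" "u1 \<noteq> u3"
    and adj: "square_adj X u0 u1" "square_adj X u1 u2" "square_adj X u2 u3" "square_adj X u3 u0"
    and non: "\<not> square_adj X u0 u2" "\<not> square_adj X u1 u3"
  shows False
proof -
  have cl: "square_adj X u v" if "u \<in> square_vertices m1 m2" "v \<in> square_vertices m1 m2" "u \<noteq> v" "fst u \<in> {0, 3}" "fst v \<in> {0, 3}" for u v
  proof -
    obtain l i l' i' where uv: "u = (l, i)" "v = (l', i')" by (cases u, cases v)
    have l: "l = 0 \<and> i = 0 \<or> l = 3" "l' = 0 \<and> i' = 0 \<or> l' = 3"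
      using that by (auto simp: square_vertices_def uv)
    then show ?thesis
      using that(3) unfolding uv square_adj_def square_arc.simps by (elim disjE) simp_all
  qed
  have lab: "fst u \<in> {1, 2} \<longleftrightarrow> fst u \<notin> {0, 3}" if "u \<in> square_vertices m1 m2" for u
    using that by (auto simp: square_vertices_def)
  note L = lab[OF V(1)] lab[OF V(2)] lab[OF V(3)] lab[OF V(4)]
  have 02: "fst u0 \<in> {1, 2} \<or> fst u2 \<in> {1, 2}"
    using cl[OF V(1,3) ne(1)] non(1) L(1,3) by argo
  have 13: "fst u1 \<in> {1, 2} \<or> fst u3 \<in> {1, 2}"
    using cl[OF V(2,4) ne(2)] non(2) L(2,4) by argo
  have adj': "square_adj X u1 u0" "square_adj X u2 u1" "square_adj X u3 u2" "square_adj X u0 u3"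
    using adj by (simp_all add: square_adj_sym)
  have n02: "\<not> (fst u0 \<in> {1, 2} \<and> fst u2 \<in> {1, 2})"
    using square_no_path[OF _ _ _ adj(1,2)] square_no_path[OF _ _ _ adj'(4,3)] ne 13 by argo
  have n13: "\<not> (fst u1 \<in> {1, 2} \<and> fst u3 \<in> {1, 2})"
    using square_no_path[OF _ _ _ adj(2,3)] square_no_path[OF _ _ _ adj'(1,4)] ne 02 by argo
  have non': "\<not> square_adj X u2 u0" "\<not> square_adj X u3 u1" using non square_adj_sym by blast+
  note half = square_induced_cycle_half[OF X]
  show False
    using half[OF V _ _ _ _ adj(1,2) adj(4) non] half[OF V(2,3,4,1) _ _ _ _ adj(2,3) adj(1) non(2) non'(1)]
      half[OF V(3,4,1,2) _ _ _ _ adj(3,4) adj(2) non'] half[OF V(4,1,2,3) _ _ _ _ adj(4,1) adj(3) non'(2) non(1)]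
      02 13 n02 n13 L by argo
qed

lemma hard_square:
  assumes H: "simple_graph 4 H"
    and abcd: "a < 4" "b < 4" "c < 4" "d < (4::nat)" "distinct [a, b, c, d]"
    and edges: "{a, b} \<in> H" "{b, c} \<in> H" "{c, d} \<in> H" "{d, a} \<in> H"
    and non_edges: "{a, c} \<notin> H" "{b, d} \<notin> H"
  shows "hard 4 H"
proof -
  have four: "{..<4} = {a, b, c, d}"
  proof -
    have "card {a, b, c, d} = card {..<4::nat}" using abcd(5) by simp
    then show ?thesis using abcd by (intro card_subset_eq[symmetric]) auto
  qed
  have red: "\<exists>G own. reduction n 4 4 H ({..<m1} \<times> {..<m2}) G own"
    if n: "n = 1 + 2 * m2 + m1" for n m1 m2
  proof (rule reduction_of_adj[where V = "square_vertices m1 m2" and adj = square_adj and ow = square_owner])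
    let ?V = "square_vertices m1 m2"
    show "(4::nat) \<ge> 1" "finite ({..<m1} \<times> {..<m2})" "finite ?V" by (simp_all add: square_vertices_def)
    have "card ?V = card ({(0::nat, 0::nat)} \<union> {1, 2} \<times> {..<m2}) + card ({3::nat} \<times> {..<m1})"
      unfolding square_vertices_def by (intro card_Un_disjoint) auto
    also have "card ({(0::nat, 0::nat)} \<union> {1, 2} \<times> {..<m2}) = card {(0::nat, 0::nat)} + card ({1::nat, 2} \<times> {..<m2})"
      by (intro card_Un_disjoint) auto
    finally show "card ?V = n" by (simp add: card_cartesian_product n)
    show "square_adj X v u" if "square_adj X u v" for X u v using that square_adj_sym by blast
    show "square_owner u v = square_owner v u" for u v by (auto simp: square_owner_def)
    show "square_owner u v < 4" for u v by (auto simp: square_owner_def)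
    show "square_adj X' u v" if "X (square_owner u v) = X' (square_owner u v)" "square_adj X u v" for X X' u v
    proof -
      have "square_owner u v = square_owner v u" by (auto simp: square_owner_def)
      then show ?thesis using that square_arc_own[of X u v X'] square_arc_own[of X v u X']
        unfolding square_adj_def by argo
    qed
    show "\<exists>\<phi>. embeds 4 H ?V (square_adj X) \<phi>"
      if p: "p \<in> {..<m1} \<times> {..<m2}" and full: "\<And>q. q < 4 \<Longrightarrow> p \<in> X q" for X p
    proof -
      obtain i j where ij: "p = (i, j)" "i < m1" "j < m2" using p by auto
      have X: "(i, j) \<in> X 0" "(i, j) \<in> X 1" using full[of 0] full[of 1] ij by auto
      \<comment> \<open>The edges a b, b c, d a and the non-edge a c are fixed in the gadget. Player
        1 supplies the edge c d, and player 0 removes b d.\<close>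
      define \<phi> :: "nat \<Rightarrow> nat \<times> nat" where "\<phi> = (\<lambda>_. (3, i))(a := (0, 0), b := (1, j), c := (2, j))"
      have \<phi>: "\<phi> a = (0, 0)" "\<phi> b = (1, j)" "\<phi> c = (2, j)" "\<phi> d = (3, i)"
        using abcd(5) by (auto simp: \<phi>_def)
      have A: "square_adj X (0, 0) (1, j)" "square_adj X (1, j) (2, j)" "square_adj X (2, j) (3, i)" "square_adj X (3, i) (0, 0)"
        "\<not> square_adj X (0, 0) (2, j)" "\<not> square_adj X (1, j) (3, i)"
        using X by (auto simp: square_adj_def)
      have "embeds 4 H ?V (square_adj X) \<phi>"
        unfolding embeds_def
      proof (intro conjI)
        show "inj_on \<phi> {..<4}" unfolding four using \<phi> by (auto simp: inj_on_def)
        show "\<phi> ` {..<4} \<subseteq> ?V" unfolding four using \<phi> ij by (auto simp: square_vertices_def)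
        have "\<forall>x\<in>{a, b, c, d}. \<forall>y\<in>{a, b, c, d}. x \<noteq> y \<longrightarrow> ({x, y} \<in> H \<longleftrightarrow> square_adj X (\<phi> x) (\<phi> y))"
          using \<phi> A A[unfolded square_adj_sym[of X "(0, 0)"]] edges non_edges square_adj_sym[of X] by (simp add: insert_commute)
        then show "\<forall>x<4. \<forall>y<4. x \<noteq> y \<longrightarrow> ({x, y} \<in> H \<longleftrightarrow> square_adj X (\<phi> x) (\<phi> y))"
          unfolding four[symmetric] by simp
      qed
      then show ?thesis by blast
    qed
    show "\<not> embeds 4 H ?V (square_adj X) \<phi>" if X: "\<And>q q'. q \<noteq> q' \<Longrightarrow> X q \<inter> X q' = {}" for X \<phi>
    proof
      assume "embeds 4 H ?V (square_adj X) \<phi>"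
      then have \<phi>: "inj_on \<phi> {..<4}" "\<phi> ` {..<4} \<subseteq> ?V"
        "\<And>i j. i < 4 \<Longrightarrow> j < 4 \<Longrightarrow> i \<noteq> j \<Longrightarrow> {i, j} \<in> H \<longleftrightarrow> square_adj X (\<phi> i) (\<phi> j)"
        unfolding embeds_def by auto
      have ne: "a \<noteq> b" "b \<noteq> c" "c \<noteq> d" "d \<noteq> a" "a \<noteq> c" "b \<noteq> d" using abcd(5) by auto
      show False
      proof (rule square_no_induced_cycle[of X "\<phi> a" m1 m2 "\<phi> b" "\<phi> c" "\<phi> d"])
        show "X 0 \<inter> X 1 = {}" by (rule X) simp
        show "\<phi> a \<in> ?V" "\<phi> b \<in> ?V" "\<phi> c \<in> ?V" "\<phi> d \<in> ?V" using \<phi>(2) abcd by auto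
        show "\<phi> a \<noteq> \<phi> c" "\<phi> b \<noteq> \<phi> d" using \<phi>(1) abcd ne by (auto simp: inj_on_def)
      qed (use \<phi>(3) abcd ne edges non_edges in blast)+
    qed
  qed
  have main: "\<exists>(C :: (nat \<times> nat) set) G own. reduction n 4 4 H C G own \<and> 1 / 64 * real n ^ 2 \<le> real (card C)"
    if n: "n \<ge> 8" for n :: nat
  proof -
    define m2 where "m2 = n div 4"
    define m1 where "m1 = n - 1 - 2 * m2"
    have "n = 1 + 2 * m2 + m1" using n unfolding m1_def m2_def by linarith
    from red[OF this] obtain G own where G: "reduction n 4 4 H ({..<m1} \<times> {..<m2}) G own" by blast
    have "8 * m1 \<ge> n" "8 * m2 \<ge> n" using n unfolding m1_def m2_def by linarith+
    then have "real n / 8 \<le> m1" "real n / 8 \<le> m2" by linarith+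
    then have "(real n / 8) * (real n / 8) \<le> real m1 * real m2" by (intro mult_mono) auto
    then have "1 / 64 * real n ^ 2 \<le> real (card ({..<m1} \<times> {..<m2}))"
      by (simp add: card_cartesian_product power2_eq_square)
    with G show ?thesis by blast
  qed
  have pos: "1 / 64 > (0::real)" by simp
  show ?thesis unfolding hard_def
    by (rule exI[of _ "1 / 64"], rule conjI[OF pos], rule exI[of _ "8"], intro allI impI, rule main)
qed

section \<open>Counting cographs\<close>

definition p4free :: "('v \<Rightarrow> 'v \<Rightarrow> bool) \<Rightarrow> 'v set \<Rightarrow> bool" where
  "p4free e W \<longleftrightarrow> \<not> (\<exists>a\<in>W. \<exists>b\<in>W. \<exists>c\<in>W. \<exists>d\<in>W. distinct [a, b, c, d] \<and>
     e a b \<and> e b c \<and> e c d \<and> \<not> e a c \<and> \<not> e b d \<and> \<not> e a d)"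

lemma p4freeD:
  "p4free e W \<Longrightarrow> a \<in> W \<Longrightarrow> b \<in> W \<Longrightarrow> c \<in> W \<Longrightarrow> d \<in> W \<Longrightarrow> distinct [a, b, c, d] \<Longrightarrow>
   e a b \<Longrightarrow> e b c \<Longrightarrow> e c d \<Longrightarrow> \<not> e a c \<Longrightarrow> \<not> e b d \<Longrightarrow> \<not> e a d \<Longrightarrow> False"
  unfolding p4free_def by blast

lemma p4freeI:
  assumes "\<And>a b c d. a \<in> W \<Longrightarrow> b \<in> W \<Longrightarrow> c \<in> W \<Longrightarrow> d \<in> W \<Longrightarrow> distinct [a, b, c, d] \<Longrightarrow>
   e a b \<Longrightarrow> e b c \<Longrightarrow> e c d \<Longrightarrow> \<not> e a c \<Longrightarrow> \<not> e b d \<Longrightarrow> \<not> e a d \<Longrightarrow> False"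
  shows "p4free e W"
  unfolding p4free_def using assms by blast

lemma p4free_subset: "p4free e W \<Longrightarrow> W' \<subseteq> W \<Longrightarrow> p4free e W'"
  unfolding p4free_def by blast

lemma p4free_compl:
  assumes sym: "\<And>x y. e x y = e y x" and e: "p4free e W"
  shows "p4free (\<lambda>x y. \<not> e x y) W"
proof (rule p4freeI)
  fix a b c d
  assume "a \<in> W" "b \<in> W" "c \<in> W" "d \<in> W" "distinct [a, b, c, d]"
    "\<not> e a b" "\<not> e b c" "\<not> e c d" "\<not> \<not> e a c" "\<not> \<not> e b d" "\<not> \<not> e a d"
  then show False using p4freeD[OF e, of b d a c] sym by auto
qed

text \<open>A disjoint union if \<open>s\<close> is False and a join if it is True. That every
  \<open>p4free\<close> graph on at least two vertices arises in this way is the classical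
  decomposition of cographs.\<close>

definition splits :: "('v \<Rightarrow> 'v \<Rightarrow> bool) \<Rightarrow> 'v set \<Rightarrow> bool \<Rightarrow> 'v set \<Rightarrow> 'v set \<Rightarrow> bool" where
  "splits e W s A B \<longleftrightarrow> A \<union> B = W \<and> A \<inter> B = {} \<and> A \<noteq> {} \<and> B \<noteq> {} \<and> (\<forall>x\<in>A. \<forall>y\<in>B. e x y = s)"

text \<open>The non-neighbours of \<open>v\<close> in \<open>A\<close> split off: if one of them,
  x2, were adjacent to a neighbour x1 of \<open>v\<close> in \<open>A\<close>, then x2, x1, v, c
  would be an induced path.\<close>

lemma splits_insert_aux:
  assumes sym: "\<And>x y. e x y = e y x" and e: "p4free e (insert v W)" and v: "v \<notin> W"
    and AB: "splits e W False A B"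
    and y: "y \<in> A" "\<not> e v y" and c: "c \<in> B" "e v c"
  shows "\<exists>s A B. splits e (insert v W) s A B"
proof -
  have W: "A \<union> B = W" "A \<inter> B = {}" and non: "\<And>x y. x \<in> A \<Longrightarrow> y \<in> B \<Longrightarrow> \<not> e x y"
    using AB by (auto simp: splits_def)
  define A2 where "A2 = {x\<in>A. \<not> e v x}"
  have "\<not> e x1 x2" if x: "x1 \<in> A" "e v x1" "x2 \<in> A2" for x1 x2
  proof
    assume "e x1 x2"
    have x2: "x2 \<in> A" "\<not> e v x2" using x by (auto simp: A2_def)
    show False
    proof (rule p4freeD[OF e])
      show "distinct [x2, x1, v, c]" using x x2 c v W by auto
      show "\<not> e x1 c" "\<not> e x2 c" using non x x2 c by auto
    qed (use \<open>e x1 x2\<close> sym x x2 c W in auto)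
  qed
  then have "\<not> e x z" if "x \<in> A2" "z \<in> insert v W - A2" for x z
    using that non sym W(1) unfolding A2_def by blast
  moreover have "y \<in> A2" "A2 \<subseteq> W" using y W(1) by (auto simp: A2_def)
  ultimately have "splits e (insert v W) False A2 (insert v W - A2)"
    unfolding splits_def using v by blast
  then show ?thesis by blast
qed

lemma splits_swap: "(\<And>x y. e x y = e y x) \<Longrightarrow> splits e W s A B \<Longrightarrow> splits e W s B A"
  unfolding splits_def by blast

lemma splits_insert:
  assumes sym: "\<And>x y. e x y = e y x" and e: "p4free e (insert v W)" and v: "v \<notin> W"
    and AB: "splits e W False A B"
  shows "\<exists>s A B. splits e (insert v W) s A B"
proof -
  have W: "A \<union> B = W" "A \<inter> B = {}" "A \<noteq> {}" "B \<noteq> {}" and non: "\<And>x y. x \<in> A \<Longrightarrow> y \<in> B \<Longrightarrow> \<not> e x y"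
    using AB by (auto simp: splits_def)
  consider "\<forall>x\<in>A. \<not> e v x" | "\<forall>x\<in>B. \<not> e v x" | "\<forall>x\<in>W. e v x"
    | y c where "y \<in> A" "\<not> e v y" "c \<in> B" "e v c"
    | y c where "y \<in> B" "\<not> e v y" "c \<in> A" "e v c" using W(1) by blast
  then show ?thesis
  proof cases
    case 1
    then have "splits e (insert v W) False A (insert v B)"
      unfolding splits_def using W v non sym by blast
    then show ?thesis by blast
  next
    case 2
    then have "splits e (insert v W) False (insert v A) B"
      unfolding splits_def using W v non sym by blast
    then show ?thesis by blast
  next
    case 3
    then have "splits e (insert v W) True {v} W"
      unfolding splits_def using W v by blast
    then show ?thesis by blast
  next
    case 4
    then show ?thesis using splits_insert_aux[OF sym e v AB] by blast
  next
    case 5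
    then show ?thesis using splits_insert_aux[OF sym e v splits_swap[OF sym AB]] by blast
  qed
qed

text \<open>Vertices are added one at a time. A join is handled as a union in the complement, which
  is \<open>p4free\<close> as well because the four-vertex path is self-complementary.\<close>

lemma p4free_splits:
  assumes "finite W" "card W \<ge> 2" and sym: "\<And>x y. e x y = e y x" and "p4free e W"
  shows "\<exists>s A B. splits e W s A B"
  using assms(1,2,4)
proof (induction W)
  case empty
  then show ?case by simp
next
  case (insert v W)
  show ?case
  proof (cases "card W \<ge> 2")
    case True
    then obtain s A B where AB: "splits e W s A B"
      using insert.IH p4free_subset[OF insert.prems(2)] by blast
    show ?thesis
    proof (cases s)
      case True
      have "splits (\<lambda>x y. \<not> e x y) W False A B" using AB True by (auto simp: splits_def)
      from splits_insert[OF _ p4free_compl[OF sym insert.prems(2)] insert.hyps(2) this]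
      obtain s' A' B' where "splits (\<lambda>x y. \<not> e x y) (insert v W) s' A' B'" using sym by blast
      then have "splits e (insert v W) (\<not> s') A' B'" unfolding splits_def by blast
      then show ?thesis by blast
    next
      case False
      then show ?thesis using splits_insert[OF sym insert.prems(2) insert.hyps(2)] AB by simp
    qed
  next
    case False
    then have "card W = 1" using insert.prems(1) insert.hyps by simp
    then obtain w where "W = {w}" by (auto simp: card_1_singleton_iff)
    then have "splits e (insert v W) (e v w) {v} {w}" using insert.hyps by (auto simp: splits_def)
    then show ?thesis by blast
  qed
qed

text \<open>Twins within one side of a split stay twins, since the other side sees that side
  uniformly; so one descends into a side with at least two vertices. If both sides are singletons,
  their two vertices are twins.\<close>

lemma p4free_twins:
  assumes "finite W" "card W \<ge> 2" and sym: "\<And>x y. e x y = e y x" and "p4free e W"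
  shows "\<exists>u\<in>W. \<exists>v\<in>W. u \<noteq> v \<and> (\<forall>x\<in>W - {u, v}. e x u = e x v)"
  using assms(1,2,4)
proof (induction "card W" arbitrary: W rule: less_induct)
  case less
  obtain s A B where AB: "splits e W s A B" using p4free_splits[OF less.prems(1,2) sym less.prems(3)] by blast
  have inherit: ?case if AB: "splits e W s A B" and A2: "card A \<ge> 2" for A B
  proof -
    have W: "A \<union> B = W" "A \<inter> B = {}" "B \<noteq> {}" and c: "\<And>x y. x \<in> A \<Longrightarrow> y \<in> B \<Longrightarrow> e x y = s"
      using AB by (auto simp: splits_def)
    have "A \<subset> W" using W by blast
    then have A: "card A < card W" "finite A" using less.prems(1) by (auto intro: psubset_card_mono finite_subset)
    have "p4free e A" using p4free_subset[OF less.prems(3)] W(1) by blast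
    from less.hyps[OF A A2 this]
    obtain u v where uv: "u \<in> A" "v \<in> A" "u \<noteq> v" "\<forall>x\<in>A - {u, v}. e x u = e x v"
      by blast
    have "e x u = e x v" if "x \<in> W - {u, v}" for x
    proof (cases "x \<in> A")
      case True
      then show ?thesis using uv that by blast
    next
      case False
      then have "x \<in> B" using that W(1) by blast
      then show ?thesis using c[OF uv(1)] c[OF uv(2)] sym by blast
    qed
    then show ?thesis using uv W(1) by blast
  qed
  show ?case
  proof (cases "card A \<ge> 2 \<or> card B \<ge> 2")
    case True
    then show ?thesis
    proof
      assume "card A \<ge> 2"
      then show ?thesis by (rule inherit[OF AB])
    next
      assume "card B \<ge> 2"
      then show ?thesis by (rule inherit[OF splits_swap[OF sym AB]])
    qed
  next
    case False
    have W: "A \<union> B = W" "A \<noteq> {}" "B \<noteq> {}" "A \<inter> B = {}" using AB by (auto simp: splits_def)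
    then have "finite A" "finite B" using less.prems(1) by auto
    then have "card A = 1" "card B = 1" using False W(2,3) card_gt_0_iff[of A] card_gt_0_iff[of B] by simp_all
    then obtain a b where "A = {a}" "B = {b}" by (auto simp: card_1_singleton_iff)
    then show ?thesis using W by (intro bexI[of _ a] bexI[of _ b]) auto
  qed
qed

definition pairs :: "nat set \<Rightarrow> nat set set" where
  "pairs W = {e. \<exists>u v. u \<in> W \<and> v \<in> W \<and> u \<noteq> v \<and> e = {u, v}}"

definition cographs :: "nat set \<Rightarrow> nat set set set" where
  "cographs W = {C. C \<subseteq> pairs W \<and> p4free (\<lambda>x y. {x, y} \<in> C) W}"

lemma finite_pairs: "finite W \<Longrightarrow> finite (pairs W)"
  by (rule finite_subset[of _ "Pow W"]) (auto simp: pairs_def)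

lemma pairs_lessThan: "pairs {..<n} = all_pairs n"
  by (auto simp: pairs_def all_pairs_def)

lemma finite_cographs: "finite W \<Longrightarrow> finite (cographs W)"
  by (rule finite_subset[of _ "Pow (pairs W)"]) (auto simp: cographs_def finite_pairs)

definition add_twin :: "nat \<Rightarrow> nat \<Rightarrow> bool \<Rightarrow> nat set set \<Rightarrow> nat set set" where
  "add_twin u v s C = C \<union> {{v, x} | x. {u, x} \<in> C} \<union> (if s then {{u, v}} else {})"

lemma cograph_is_twin_extension:
  assumes W: "finite W" "card W \<ge> 2" and C: "C \<in> cographs W"
  shows "\<exists>u\<in>W. \<exists>v\<in>W. \<exists>s. \<exists>C'\<in>cographs (W - {v}). C = add_twin u v s C'"
proof -
  have CW: "C \<subseteq> pairs W" and free: "p4free (\<lambda>x y. {x, y} \<in> C) W" using C by (auto simp: cographs_def)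
  obtain u v where uv: "u \<in> W" "v \<in> W" "u \<noteq> v" and tw: "\<And>x. x \<in> W - {u, v} \<Longrightarrow> {x, u} \<in> C \<longleftrightarrow> {x, v} \<in> C"
    using p4free_twins[OF W _ free] by (auto simp: insert_commute)
  define C' where "C' = C \<inter> pairs (W - {v})"
  have "p4free (\<lambda>x y. {x, y} \<in> C') (W - {v})"
  proof (rule p4freeI)
    fix a b c d assume V: "a \<in> W - {v}" "b \<in> W - {v}" "c \<in> W - {v}" "d \<in> W - {v}" "distinct [a, b, c, d]"
      and e: "{a, b} \<in> C'" "{b, c} \<in> C'" "{c, d} \<in> C'" "{a, c} \<notin> C'" "{b, d} \<notin> C'" "{a, d} \<notin> C'"
    have "{x, y} \<in> C' \<longleftrightarrow> {x, y} \<in> C" if "x \<in> W - {v}" "y \<in> W - {v}" "x \<noteq> y" for x y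
      using that by (auto simp: C'_def pairs_def)
    then have "{a, b} \<in> C" "{b, c} \<in> C" "{c, d} \<in> C" "{a, c} \<notin> C" "{b, d} \<notin> C" "{a, d} \<notin> C"
      using V e by auto
    then show False using p4freeD[OF free, of a b c d] V by auto
  qed
  then have C': "C' \<in> cographs (W - {v})" by (auto simp: cographs_def C'_def)
  have "e \<in> C \<longleftrightarrow> e \<in> add_twin u v ({u, v} \<in> C) C'" for e
  proof (cases "e \<in> pairs W \<and> v \<in> e")
    case True
    then obtain x where x: "e = {x, v}" "x \<in> W" "x \<noteq> v" by (auto simp: pairs_def insert_commute)
    have "e \<notin> C'" using x by (auto simp: C'_def pairs_def doubleton_eq_iff)
    show ?thesis
    proof (cases "x = u")
      case True
      have "{u, v} \<noteq> {v, y}" if "{u, y} \<in> C'" for y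
        using that uv by (auto simp: C'_def pairs_def doubleton_eq_iff)
      then show ?thesis using True x \<open>e \<notin> C'\<close> by (auto simp: add_twin_def)
    next
      case False
      have "{x, u} \<in> C \<longleftrightarrow> {u, x} \<in> C'" using False x uv by (auto simp: C'_def pairs_def insert_commute)
      then have "e \<in> C \<longleftrightarrow> {u, x} \<in> C'" using tw[of x] False x by simp
      then show ?thesis using False x uv \<open>e \<notin> C'\<close> by (auto simp: add_twin_def doubleton_eq_iff)
    qed
  next
    case False
    show ?thesis
    proof
      assume e: "e \<in> C"
      then have "e \<in> pairs W" "v \<notin> e" using CW False by auto
      then have "e \<in> C'" using e by (auto simp: C'_def pairs_def)
      then show "e \<in> add_twin u v ({u, v} \<in> C) C'" by (simp add: add_twin_def)
    next
      assume "e \<in> add_twin u v ({u, v} \<in> C) C'"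
      then consider "e \<in> C'" | x where "{u, x} \<in> C'" "e = {v, x}" | "e = {u, v}" "{u, v} \<in> C"
        by (auto simp: add_twin_def split: if_splits)
      then show "e \<in> C"
      proof cases
        case 2
        then have "x \<in> W" "x \<noteq> v" by (auto simp: C'_def pairs_def doubleton_eq_iff)
        then have "e \<in> pairs W \<and> v \<in> e" using 2 uv by (auto simp: pairs_def)
        then show ?thesis using False by contradiction
      qed (auto simp: C'_def)
    qed
  qed
  then have "C = add_twin u v ({u, v} \<in> C) C'" by blast
  then show ?thesis using uv C' by blast
qed

text \<open>After one twin is deleted, the graph is recovered by naming both twins and whether they
  are adjacent: at most 2 |W|^2 choices per vertex.\<close>

lemma card_cographs:
  assumes "finite W"
  shows "card (cographs W) \<le> (2 * card W ^ 2) ^ card W"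
  using assms
proof (induction "card W" arbitrary: W)
  case 0
  then have "cographs W \<subseteq> {{}}" by (auto simp: cographs_def pairs_def)
  then have "card (cographs W) \<le> card {{} :: nat set set}" by (intro card_mono) auto
  then show ?case using 0 by simp
next
  case (Suc m)
  show ?case
  proof (cases "m = 0")
    case True
    then obtain w where "W = {w}" using Suc(2) by (metis One_nat_def card_1_singletonE)
    then have "cographs W \<subseteq> {{}}" by (auto simp: cographs_def pairs_def)
    then have "card (cographs W) \<le> card {{} :: nat set set}" by (intro card_mono) auto
    then show ?thesis using \<open>W = {w}\<close> by simp
  next
    case False
    let ?E = "\<lambda>(u, v, s). add_twin u v s ` cographs (W - {v})"
    have "cographs W \<subseteq> (\<Union>x\<in>W \<times> W \<times> UNIV. ?E x)"
    proof
      fix C assume "C \<in> cographs W"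
      from cograph_is_twin_extension[OF Suc.prems _ this] False Suc(2)
      show "C \<in> (\<Union>x\<in>W \<times> W \<times> UNIV. ?E x)" by auto
    qed
    moreover have "finite (\<Union>x\<in>W \<times> W \<times> UNIV. ?E x)"
      using Suc.prems finite_cographs by (intro finite_UN_I) auto
    ultimately have "card (cographs W) \<le> card (\<Union>x\<in>W \<times> W \<times> UNIV. ?E x)"
      by (intro card_mono) auto
    also have "\<dots> \<le> (\<Sum>x\<in>W \<times> W \<times> UNIV. card (?E x))"
      using Suc.prems by (intro card_UN_le) auto
    also have "\<dots> \<le> (\<Sum>x\<in>W \<times> W \<times> (UNIV :: bool set). (2 * m ^ 2) ^ m)"
    proof (rule sum_mono)
      fix x assume "x \<in> W \<times> W \<times> (UNIV :: bool set)"
      then obtain u v s where x: "x = (u, v, s)" "v \<in> W" by auto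
      have m: "m = card (W - {v})" using Suc x by simp
      have "card (?E x) \<le> card (cographs (W - {v}))"
        using x Suc.prems by (auto intro: card_image_le finite_cographs)
      also have "\<dots> \<le> (2 * m ^ 2) ^ m" using Suc(1)[OF m] Suc.prems m by simp
      finally show "card (?E x) \<le> (2 * m ^ 2) ^ m" .
    qed
    also have "\<dots> = (2 * Suc m ^ 2) * (2 * m ^ 2) ^ m"
      using Suc(2) by (simp add: card_cartesian_product power2_eq_square card_UNIV_bool)
    also have "\<dots> \<le> (2 * Suc m ^ 2) * (2 * Suc m ^ 2) ^ m"
      by (intro mult_le_mono2 power_mono) auto
    finally show ?thesis by (simp only: Suc(2)[symmetric] power_Suc)
  qed
qed

text \<open>By induction the weights separate the traces of the family off \<open>x\<close>. The
  weight of \<open>x\<close> must only avoid the differences between trace weights, at most |F|^2 of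
  them, and there are |F|^2 + 1 values to choose from.\<close>

lemma separating_weights:
  fixes F :: "'a set set"
  assumes "finite E" "finite F" "F \<subseteq> Pow E"
  shows "\<exists>w :: 'a \<Rightarrow> nat. (\<forall>e. w e \<le> card F ^ 2) \<and> inj_on (\<lambda>A. \<Sum>e\<in>A. w e) F"
  using assms
proof (induction E arbitrary: F)
  case empty
  then have "F \<subseteq> {{}}" by simp
  then have "inj_on (\<lambda>A. \<Sum>e\<in>A. 0) F" by (auto simp: inj_on_def)
  then show ?case by (intro exI[of _ "\<lambda>_. 0"]) auto
next
  case (insert x E)
  let ?F = "(\<lambda>A. A - {x}) ` F"
  have cF: "card ?F \<le> card F" using insert.prems(1) by (rule card_image_le)
  have "?F \<subseteq> Pow E" using insert.prems(2) by auto
  then obtain w where w: "\<forall>e. w e \<le> card ?F ^ 2" "inj_on (\<lambda>A. \<Sum>e\<in>A. w e) ?F"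
    using insert.IH[of ?F] insert.prems(1) by auto
  \<comment> \<open>Subtraction truncates, but \<open>bad\<close> ranges over ordered pairs and so
    contains the true difference in one of the two orders.\<close>
  define bad where "bad = (\<lambda>(A, B). (\<Sum>e\<in>A - {x}. w e) - (\<Sum>e\<in>B - {x}. w e)) ` (F \<times> F)"
  have "card bad \<le> card (F \<times> F)" unfolding bad_def using insert.prems(1) by (intro card_image_le) auto
  then have "card bad < card {..card F ^ 2}" by (simp add: card_cartesian_product power2_eq_square)
  moreover have "finite bad" unfolding bad_def using insert.prems(1) by auto
  ultimately have "\<not> {..card F ^ 2} \<subseteq> bad" using card_mono[of bad "{..card F ^ 2}"] by auto
  then obtain c where c: "c \<le> card F ^ 2" "c \<notin> bad" by auto
  have fin: "finite A" if "A \<in> F" for A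
    using that insert.prems(2) insert.hyps(1) by (meson PowD finite_insert finite_subset subsetD)
  have s: "(\<Sum>e\<in>A. (w(x := c)) e) = (\<Sum>e\<in>A - {x}. w e) + (if x \<in> A then c else 0)" if "A \<in> F" for A
  proof -
    have "(\<Sum>e\<in>A - {x}. (w(x := c)) e) = (\<Sum>e\<in>A - {x}. w e)" by (intro sum.cong) auto
    then show ?thesis
    proof (cases "x \<in> A")
      case True
      then show ?thesis using \<open>(\<Sum>e\<in>A - {x}. (w(x := c)) e) = (\<Sum>e\<in>A - {x}. w e)\<close>
          fin[OF that] sum.remove[of A x "w(x := c)"] by simp
    next
      case False
      then have "A - {x} = A" by blast
      then show ?thesis using \<open>(\<Sum>e\<in>A - {x}. (w(x := c)) e) = (\<Sum>e\<in>A - {x}. w e)\<close> False by simp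
    qed
  qed
  have "inj_on (\<lambda>A. \<Sum>e\<in>A. (w(x := c)) e) F"
  proof (rule inj_onI)
    fix A B assume A: "A \<in> F" and B: "B \<in> F" and eq: "(\<Sum>e\<in>A. (w(x := c)) e) = (\<Sum>e\<in>B. (w(x := c)) e)"
    have nb: "c \<noteq> (\<Sum>e\<in>A - {x}. w e) - (\<Sum>e\<in>B - {x}. w e)" "c \<noteq> (\<Sum>e\<in>B - {x}. w e) - (\<Sum>e\<in>A - {x}. w e)"
      using c(2) A B by (auto simp: bad_def)
    have x: "x \<in> A \<longleftrightarrow> x \<in> B"
      using eq nb unfolding s[OF A] s[OF B] by (cases "x \<in> A"; cases "x \<in> B") auto
    then have "(\<Sum>e\<in>A - {x}. w e) = (\<Sum>e\<in>B - {x}. w e)" using eq unfolding s[OF A] s[OF B] by auto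
    from inj_onD[OF w(2) this imageI[OF A] imageI[OF B]] have "A - {x} = B - {x}" .
    with x show "A = B" by blast
  qed
  moreover have "(w(x := c)) e \<le> card F ^ 2" for e
  proof -
    have "w e \<le> card ?F ^ 2" using w(1) by blast
    also have "\<dots> \<le> card F ^ 2" using cF by (rule power_mono) simp
    finally show ?thesis using c(1) by simp
  qed
  ultimately show ?case by blast
qed

section \<open>The deterministic algorithm\<close>

text \<open>A sum over the edges is independent of the order of the stream, so a state frozen during
  the pass and one counter suffice.\<close>

lemma salg_of_sums:
  fixes X :: "'x set" and wt :: "'x \<Rightarrow> nat set \<Rightarrow> nat"
  assumes fin: "finite X" and card: "card X * Suc K \<le> 2 ^ S" and x0: "x0 \<in> X"
    and upd: "\<And>x a. x \<in> X \<Longrightarrow> a \<le> K \<Longrightarrow> upd x a \<in> X"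
    and K: "\<And>x G. x \<in> X \<Longrightarrow> simple_graph n G \<Longrightarrow> (\<Sum>e\<in>G. wt x e) \<le> K"
  shows "\<exists>A. space_bounded S A \<and> (\<forall>p G es. simple_graph n G \<longrightarrow> is_stream G es \<longrightarrow>
           run A p es = ot (((\<lambda>x. upd x (\<Sum>e\<in>G. wt x e)) ^^ p) x0))"
proof -
  \<comment> \<open>The cap keeps the counter in range on arbitrary input; totals over simple graphs
    never exceed it.\<close>
  define st where "st = (\<lambda>(x, c) e. (x, min K (c + wt x e)))"
  define ed where "ed = (\<lambda>(x, c :: nat). (upd x c, 0 :: nat))"
  have "\<exists>A. space_bounded S A \<and> (\<forall>p es. run A p es = (ot \<circ> fst) (((\<lambda>x. ed (fold (\<lambda>e y. st y e) es x)) ^^ p) (x0, 0)))"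
    using fin card x0 upd
    by (intro salg_of_machine[of "X \<times> {..K}"]) (auto simp: st_def ed_def card_cartesian_product)
  then obtain A where A: "space_bounded S A"
    "\<And>p es. run A p es = (ot \<circ> fst) (((\<lambda>x. ed (fold (\<lambda>e y. st y e) es x)) ^^ p) (x0, 0))" by blast
  have fold: "fold (\<lambda>e y. st y e) es (x, c) = (x, c + sum_list (map (wt x) es))"
    if "c + sum_list (map (wt x) es) \<le> K" for es x c
    using that
  proof (induction es arbitrary: c)
    case (Cons e es)
    then have "c + wt x e \<le> K" by simp
    then have "st (x, c) e = (x, c + wt x e)" by (simp add: st_def min_absorb2)
    then show ?case using Cons.IH[of "c + wt x e"] Cons.prems by (simp add: add.assoc)
  qed simp
  have "run A p es = ot (((\<lambda>x. upd x (\<Sum>e\<in>G. wt x e)) ^^ p) x0)" if G: "simple_graph n G" "is_stream G es" for p G es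
  proof -
    have pass: "ed (fold (\<lambda>e y. st y e) es (x, 0)) = (upd x (\<Sum>e\<in>G. wt x e), 0)" if "x \<in> X" for x
    proof -
      have "sum_list (map (wt x) es) = (\<Sum>e\<in>G. wt x e)"
        using G(2) by (auto simp: is_stream_def sum_list_distinct_conv_sum_set)
      then show ?thesis using fold[of 0 x es] K[OF that G(1)] by (simp add: ed_def)
    qed
    have "((\<lambda>x. ed (fold (\<lambda>e y. st y e) es x)) ^^ p) (x0, 0) = (((\<lambda>x. upd x (\<Sum>e\<in>G. wt x e)) ^^ p) x0, 0)
       \<and> ((\<lambda>x. upd x (\<Sum>e\<in>G. wt x e)) ^^ p) x0 \<in> X"
      by (induction p) (auto simp: x0 pass upd K G(1))
    then show ?thesis by (simp add: A(2))
  qed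
  with A(1) show ?thesis by blast
qed

subsection \<open>Decision trees\<close>

locale path_pattern =
  fixes n k :: nat and H :: "nat set set"
  assumes k: "k \<ge> 1"
    and path: "\<exists>g. inj_on g {..<k} \<and> g ` {..<k} \<subseteq> {..<4} \<and>
      (\<forall>i<k. \<forall>j<k. i \<noteq> j \<longrightarrow> ({i, j} \<in> H \<longleftrightarrow> g i + 1 = g j \<or> g j + 1 = (g i :: nat)))"
begin

definition free :: "nat set \<Rightarrow> nat set set \<Rightarrow> bool" where
  "free W G \<longleftrightarrow> \<not> (\<exists>U. U \<subseteq> {..<n} \<and> U \<subseteq> W \<and> induced_copy k H G U)"

lemma free_subset: "free W G \<Longrightarrow> W' \<subseteq> W \<Longrightarrow> free W' G"
  unfolding free_def by blast

lemma free_restrict: "free W {e\<in>G. e \<subseteq> W} \<longleftrightarrow> free W G"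
proof -
  have "induced_copy k H {e\<in>G. e \<subseteq> W} U \<longleftrightarrow> induced_copy k H G U" if "U \<subseteq> W" for U
    using that by (intro induced_copy_cong) auto
  then show ?thesis unfolding free_def by blast
qed

lemma not_free_if_not_cograph:
  assumes G: "simple_graph n G" and no: "{e\<in>G. e \<subseteq> W} \<notin> cographs {..<n}"
  shows "\<not> free W G"
proof -
  let ?G = "{e\<in>G. e \<subseteq> W}"
  have "?G \<subseteq> pairs {..<n}" using G by (auto simp: pairs_lessThan simple_graph_def)
  then have "\<not> p4free (\<lambda>x y. {x, y} \<in> ?G) {..<n}" using no by (auto simp: cographs_def)
  then obtain a b c d where v: "a < n" "b < n" "c < n" "d < n" "distinct [a, b, c, d]"
    and e: "{a, b} \<in> ?G" "{b, c} \<in> ?G" "{c, d} \<in> ?G" "{a, c} \<notin> ?G" "{b, d} \<notin> ?G" "{a, d} \<notin> ?G"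
    unfolding p4free_def by (metis (no_types, lifting) lessThan_iff)
  have vW: "a \<in> W" "b \<in> W" "c \<in> W" "d \<in> W" using e by auto
  have e': "{a, b} \<in> G" "{b, c} \<in> G" "{c, d} \<in> G" "{a, c} \<notin> G" "{b, d} \<notin> G" "{a, d} \<notin> G"
    using e vW by auto
  obtain g where g: "inj_on g {..<k}" "g ` {..<k} \<subseteq> {..<4}"
    "\<And>i j. i < k \<Longrightarrow> j < k \<Longrightarrow> i \<noteq> j \<Longrightarrow> {i, j} \<in> H \<longleftrightarrow> g i + 1 = g j \<or> g j + 1 = (g i :: nat)"
    using path by blast
  define p where "p x = [a, b, c, d] ! x" for x
  have four: "{..<4::nat} = {0, 1, 2, 3}" by auto
  have p_inj: "inj_on p {..<4}" using v(5) unfolding four by (auto simp: p_def inj_on_def)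
  have pW: "p ` {..<4} \<subseteq> W \<inter> {..<n}" unfolding four using v vW by (auto simp: p_def)
  have "\<forall>x\<in>{0, 1, 2, 3}. \<forall>y\<in>{0, 1, 2, 3}. x \<noteq> y \<longrightarrow> ({p x, p y} \<in> G \<longleftrightarrow> x + 1 = y \<or> y + 1 = x)"
    using e' by (simp add: p_def insert_commute numeral_2_eq_2 numeral_3_eq_3)
  then have pe: "{p x, p y} \<in> G \<longleftrightarrow> x + 1 = y \<or> y + 1 = x" if "x < 4" "y < 4" "x \<noteq> y" for x y
    using that unfolding four[symmetric] by simp
  have "induced_copy k H G ((p \<circ> g) ` {..<k})"
    unfolding induced_copy_def
  proof (intro exI conjI allI impI)
    show "bij_betw (p \<circ> g) {..<k} ((p \<circ> g) ` {..<k})"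
      using g p_inj by (intro inj_on_imp_bij_betw comp_inj_on) (auto intro: inj_on_subset)
    fix i j assume ij: "i < k" "j < k" "i \<noteq> j"
    then have "g i < 4" "g j < 4" "g i \<noteq> g j" using g(1,2) by (auto simp: inj_on_def)
    then show "{i, j} \<in> H \<longleftrightarrow> {(p \<circ> g) i, (p \<circ> g) j} \<in> G" using g(3)[OF ij] pe by simp
  qed
  moreover have "(p \<circ> g) ` {..<k} \<subseteq> W \<inter> {..<n}" using pW g(2) by fastforce
  ultimately show ?thesis unfolding free_def by blast
qed

text \<open>A decision tree of depth \<open>T\<close> that asks whether vertex sets are free,
  represented by the class of graphs reaching each node. Correctness at a leaf means that one answer
  serves the whole class.\<close>

primrec solvable :: "nat \<Rightarrow> nat set set set \<Rightarrow> bool" where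
  "solvable 0 \<G> \<longleftrightarrow> (\<exists>r. \<forall>G\<in>\<G>. indsub_correct n k H G r)"
| "solvable (Suc T) \<G> \<longleftrightarrow> (\<exists>W. solvable T {G\<in>\<G>. free W G} \<and> solvable T {G\<in>\<G>. \<not> free W G})"

primrec answers :: "(bool list \<Rightarrow> nat set) \<Rightarrow> nat set set \<Rightarrow> nat \<Rightarrow> bool list" where
  "answers qu G 0 = []"
| "answers qu G (Suc t) = answers qu G t @ [free (qu (answers qu G t)) G]"

lemma answers_Suc_front:
  "answers qu G (Suc t) = free (qu []) G # answers (\<lambda>bs. qu (free (qu []) G # bs)) G t"
  by (induction t) auto

lemma length_answers: "length (answers qu G t) = t"
  by (induction t) auto

text \<open>Turns the tree into functions of the list of earlier answers, which is all the algorithm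
  remembers between queries.\<close>

lemma solvable_strategy:
  "solvable T \<G> \<Longrightarrow> \<exists>qu ot. \<forall>G\<in>\<G>. indsub_correct n k H G (ot (answers qu G T))"
proof (induction T arbitrary: \<G>)
  case 0
  then obtain r where "\<forall>G\<in>\<G>. indsub_correct n k H G r" by auto
  then show ?case by (intro exI[of _ "\<lambda>_. {}"] exI[of _ "\<lambda>_. r"])
next
  case (Suc T)
  then obtain W where W: "solvable T {G\<in>\<G>. free W G}" "solvable T {G\<in>\<G>. \<not> free W G}" by auto
  obtain qu1 ot1 where 1: "\<forall>G\<in>{G\<in>\<G>. free W G}. indsub_correct n k H G (ot1 (answers qu1 G T))"
    using Suc.IH[OF W(1)] by blast
  obtain qu0 ot0 where 0: "\<forall>G\<in>{G\<in>\<G>. \<not> free W G}. indsub_correct n k H G (ot0 (answers qu0 G T))"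
    using Suc.IH[OF W(2)] by blast
  define qu where "qu bs = (case bs of [] \<Rightarrow> W | b # bs' \<Rightarrow> if b then qu1 bs' else qu0 bs')" for bs
  define ot where "ot bs = (case bs of [] \<Rightarrow> None | b # bs' \<Rightarrow> if b then ot1 bs' else ot0 bs')" for bs
  have "(\<lambda>bs. qu (True # bs)) = qu1" "(\<lambda>bs. qu (False # bs)) = qu0" "qu [] = W" by (auto simp: qu_def)
  then have "ot (answers qu G (Suc T)) = (if free W G then ot1 (answers qu1 G T) else ot0 (answers qu0 G T))" for G
    unfolding answers_Suc_front by (simp add: ot_def)
  then have "\<forall>G\<in>\<G>. indsub_correct n k H G (ot (answers qu G (Suc T)))" using 0 1 by simp
  then show ?case by blast
qed

lemma solvable_mono: "solvable T \<G> \<Longrightarrow> \<G>' \<subseteq> \<G> \<Longrightarrow> solvable T \<G>'"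
proof (induction T arbitrary: \<G> \<G>')
  case 0
  then show ?case by auto
next
  case (Suc T)
  from Suc.prems(1) obtain W where W: "solvable T {G\<in>\<G>. free W G}" "solvable T {G\<in>\<G>. \<not> free W G}" by auto
  have "solvable T {G\<in>\<G>'. free W G}" by (rule Suc.IH[OF W(1)]) (use Suc.prems(2) in blast)
  moreover have "solvable T {G\<in>\<G>'. \<not> free W G}" by (rule Suc.IH[OF W(2)]) (use Suc.prems(2) in blast)
  ultimately show ?case by auto
qed

text \<open>Freeness is lost at some prefix length between \<open>a\<close> and
  \<open>a + 2 ^ L\<close>. Halving finds it with \<open>L\<close> queries, and the tree for the
  other \<open>T\<close> queries may depend on the \<open>j\<close> found.\<close>

lemma solvable_binary_search:
  assumes "\<And>j. solvable T {G\<in>\<G>. free ({..<j} \<union> S) G \<and> \<not> free ({..<Suc j} \<union> S) G}"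
    and "\<And>G. G \<in> \<G> \<Longrightarrow> free ({..<a} \<union> S) G \<and> \<not> free ({..<a + 2 ^ L} \<union> S) G"
  shows "solvable (L + T) \<G>"
  using assms
proof (induction L arbitrary: a \<G>)
  case 0
  have "\<G> \<subseteq> {G\<in>\<G>. free ({..<a} \<union> S) G \<and> \<not> free ({..<Suc a} \<union> S) G}" using 0(2) by auto
  then show ?case using solvable_mono[OF 0(1)[of a]] by simp
next
  case (Suc L)
  let ?W = "{..<a + 2 ^ L} \<union> S"
  have "solvable (L + T) {G\<in>\<G>. free ?W G}"
  proof (rule Suc.IH)
    show "free ({..<a + 2 ^ L} \<union> S) G \<and> \<not> free ({..<a + 2 ^ L + 2 ^ L} \<union> S) G" if "G \<in> {G\<in>\<G>. free ?W G}" for G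
      using that Suc.prems(2)[of G] by (simp add: mult_2 add.assoc)
  qed (rule solvable_mono[OF Suc.prems(1)], blast)
  moreover have "solvable (L + T) {G\<in>\<G>. \<not> free ?W G}"
  proof (rule Suc.IH)
    show "free ({..<a} \<union> S) G \<and> \<not> free ({..<a + 2 ^ L} \<union> S) G" if "G \<in> {G\<in>\<G>. \<not> free ?W G}" for G
      using that Suc.prems(2)[of G] by simp
  qed (rule solvable_mono[OF Suc.prems(1)], blast)
  ultimately show ?case by auto
qed

text \<open>Every copy inside \<open>{..<m} \<union> S\<close> contains \<open>S\<close>. If \<open>j\<close> is least such that \<open>{..j} \<union> S\<close> contains a copy,
  then every copy in \<open>{..<j} \<union> insert j S\<close> contains \<open>insert j S\<close>.\<close>

lemma solvable_extend:
  assumes L: "n \<le> 2 ^ L" and i: "i \<le> k"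
    and S: "S \<subseteq> {..<n}" "card S = k - i" and m: "m \<le> n"
    and \<G>: "\<And>G. G \<in> \<G> \<Longrightarrow> \<not> free ({..<m} \<union> S) G"
      "\<And>G U. G \<in> \<G> \<Longrightarrow> U \<subseteq> {..<n} \<Longrightarrow> U \<subseteq> {..<m} \<union> S \<Longrightarrow> induced_copy k H G U \<Longrightarrow> S \<subseteq> U"
  shows "solvable (i * L) \<G>"
  using i S m \<G>
proof (induction i arbitrary: S m \<G>)
  case 0
  have "indsub_correct n k H G (Some S)" if G: "G \<in> \<G>" for G
  proof -
    obtain U where U: "U \<subseteq> {..<n}" "U \<subseteq> {..<m} \<union> S" "induced_copy k H G U"
      using 0(5)[OF G] unfolding free_def by blast
    have "S \<subseteq> U" using 0(6)[OF G U] .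
    moreover have "card S = card U" using induced_copy_card[OF U(3)] 0(3) by simp
    ultimately have "S = U" using U(1) by (intro card_subset_eq) (auto intro: finite_subset)
    then show ?thesis using U by (simp add: indsub_correct_def)
  qed
  then show ?case by auto
next
  case (Suc i)
  have fS: "finite S" using Suc.prems(2) finite_subset by blast
  have "solvable (i * L) {G\<in>\<G>. free ({..<j} \<union> S) G \<and> \<not> free ({..<Suc j} \<union> S) G}" for j
  proof (cases "j < m \<and> j \<notin> S")
    case False
    \<comment> \<open>The class is empty: adding a member of \<open>S\<close> changes nothing, and
      for \<open>j\<close> \<ge> \<open>m\<close> the shorter prefix already contains a
      copy.\<close>
    have "{G\<in>\<G>. free ({..<j} \<union> S) G \<and> \<not> free ({..<Suc j} \<union> S) G} = {}"
    proof (cases "j \<in> S")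
      case True
      then have "{..<Suc j} \<union> S = {..<j} \<union> S" by (auto simp: lessThan_Suc)
      then show ?thesis by simp
    next
      case False
      with \<open>\<not> (j < m \<and> j \<notin> S)\<close> have "{..<m} \<union> S \<subseteq> {..<j} \<union> S" by auto
      then have "\<not> free ({..<j} \<union> S) G" if "G \<in> \<G>" for G
        using Suc.prems(5)[OF that] free_subset by metis
      then show ?thesis by blast
    qed
    moreover have "solvable T {}" for T by (induction T) auto
    ultimately show ?thesis by (simp only:)
  next
    case True
    have eq: "{..<j} \<union> insert j S = {..<Suc j} \<union> S" by (auto simp: lessThan_Suc)
    show ?thesis
    proof (rule Suc.IH[of "insert j S" j])
      show "i \<le> k" "insert j S \<subseteq> {..<n}" "j \<le> n" using Suc.prems True by auto
      show "card (insert j S) = k - i" using Suc.prems(1,3) True fS by simp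
      show "\<not> free ({..<j} \<union> insert j S) G" if "G \<in> {G\<in>\<G>. free ({..<j} \<union> S) G \<and> \<not> free ({..<Suc j} \<union> S) G}" for G
        using that unfolding eq by simp
      show "insert j S \<subseteq> U" if G: "G \<in> {G\<in>\<G>. free ({..<j} \<union> S) G \<and> \<not> free ({..<Suc j} \<union> S) G}"
        and U: "U \<subseteq> {..<n}" "U \<subseteq> {..<j} \<union> insert j S" "induced_copy k H G U" for G U
      proof -
        have "U \<subseteq> {..<m} \<union> S" using U(2) True unfolding eq by auto
        then have "S \<subseteq> U" using Suc.prems(6)[of G U] G U(1,3) by simp
        moreover have "j \<in> U"
        proof (rule ccontr)
          assume "j \<notin> U"
          then have "U \<subseteq> {..<j} \<union> S" using U(2) by auto
          moreover have "free ({..<j} \<union> S) G" using G by simp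
          ultimately show False using U(1,3) unfolding free_def by simp
        qed
        ultimately show ?thesis by simp
      qed
    qed
  qed
  moreover have "free ({..<0} \<union> S) G \<and> \<not> free ({..<0 + 2 ^ L} \<union> S) G" if G: "G \<in> \<G>" for G
  proof
    have "\<not> induced_copy k H G U" if "U \<subseteq> {..<0} \<union> S" for U
      using card_mono[OF fS, of U] that Suc.prems(1,3) induced_copy_card[of k H G U] by auto
    then show "free ({..<0} \<union> S) G" unfolding free_def by blast
    have "{..<m} \<union> S \<subseteq> {..<0 + 2 ^ L} \<union> S" using L Suc.prems(4) by auto
    then show "\<not> free ({..<0 + 2 ^ L} \<union> S) G" using Suc.prems(5)[OF G] free_subset by metis
  qed
  ultimately have "solvable (L + i * L) \<G>" by (rule solvable_binary_search)
  then show ?case by simp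
qed

lemma solvable_all:
  assumes "n \<le> 2 ^ L"
  shows "solvable (Suc (k * L)) {G. simple_graph n G}"
proof -
  have "solvable (k * L) {G\<in>{G. simple_graph n G}. free {..<n} G}"
  proof -
    have "indsub_correct n k H G None" if "free {..<n} G" for G
      using that by (auto simp: indsub_correct_def free_def)
    then have base: "solvable 0 {G\<in>{G. simple_graph n G}. free {..<n} G}" by auto
    \<comment> \<open>Vacuous queries pad this branch to the depth of the other one.\<close>
    have step: "solvable (Suc T) \<G>" if "solvable T \<G>" for T \<G>
      unfolding solvable.simps(2)
      by (rule exI[of _ "{}"], rule conjI; rule solvable_mono[OF that], blast)
    have "solvable T {G\<in>{G. simple_graph n G}. free {..<n} G}" for T
      by (induction T) (rule base, rule step)
    then show ?thesis .
  qed
  moreover have "solvable (k * L) {G\<in>{G. simple_graph n G}. \<not> free {..<n} G}"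
    by (rule solvable_extend[OF assms, of k "{}" n]) auto
  ultimately show ?thesis by auto
qed

end

lemma card_all_pairs: "card (all_pairs n) \<le> n * n"
proof -
  have "all_pairs n \<subseteq> (\<lambda>(u, v). {u, v}) ` ({..<n} \<times> {..<n})" by (auto simp: all_pairs_def)
  then have "card (all_pairs n) \<le> card ((\<lambda>(u, v). {u, v}) ` ({..<n} \<times> {..<n}))" by (intro card_mono) auto
  also have "\<dots> \<le> card ({..<n} \<times> {..<n})" by (intro card_image_le) auto
  finally show ?thesis by (simp add: card_cartesian_product)
qed

lemma card_bool_lists: "card {bs :: bool list. length bs \<le> T} \<le> 2 ^ Suc T"
proof -
  have "card {bs :: bool list. length bs \<le> T} = (\<Sum>i\<le>T. 2 ^ i)"
    using card_lists_length_le[of "UNIV :: bool set" T] by (simp add: card_UNIV_bool)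
  also have "\<dots> \<le> 2 ^ Suc T" by (induction T) auto
  finally show ?thesis .
qed

text \<open>A single element outside \<open>C\<close> outweighs \<open>card C\<close>; without such
  elements the total counts \<open>A\<close>. So one sum verifies a candidate.\<close>

lemma equal_if_weight_eq_card:
  assumes "finite A" "finite C" "card C \<le> B" and eq: "(\<Sum>e\<in>A. if e \<in> C then 1 else Suc B) = card C"
  shows "A = C"
proof -
  have "A \<subseteq> C"
  proof (rule ccontr)
    assume "\<not> A \<subseteq> C"
    then obtain x where x: "x \<in> A" "x \<notin> C" by blast
    have "(if x \<in> C then 1 else Suc B) \<le> (\<Sum>e\<in>A. if e \<in> C then 1 else Suc B)"
      using assms(1) x(1) by (intro member_le_sum) auto
    then show False using x(2) eq assms(3) by simp
  qed
  then have "(\<Sum>e\<in>A. if e \<in> C then 1 else Suc B) = (\<Sum>e\<in>A. 1)" by (intro sum.cong) auto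
  then have "card A = card C" using eq by simp
  then show ?thesis using card_subset_eq[OF assms(2) \<open>A \<subseteq> C\<close>] by simp
qed

context path_pattern
begin

text \<open>A query costs two passes: the first computes the weight of the queried subgraph, which determines the only
  cograph that it can be, and the second checks whether it is that cograph.\<close>

lemma det_solves_exists:
  assumes L: "Suc n \<le> 2 ^ L"
  shows "\<exists>A. det_solves n k H (2 * Suc (k * L)) (Suc (Suc (k * L)) + 2 * ((4 * L + 2) * n + 4 * L + 3)) A"
proof -
  define T where "T = Suc (k * L)"
  \<comment> \<open>\<open>Suc T\<close> bits hold the answers so far. Of the two equal blocks, one
    holds the total of the first pass and the other the running counter.\<close>
  define S where "S = Suc T + 2 * ((4 * L + 2) * n + 4 * L + 3)"
  define F where "F = cographs {..<n}"
  have fF: "finite F" by (simp add: F_def finite_cographs)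
  have F_pairs: "C \<subseteq> all_pairs n" if "C \<in> F" for C using that by (auto simp: F_def cographs_def pairs_lessThan)
  obtain w :: "nat set \<Rightarrow> nat" where w: "\<And>e. w e \<le> card F ^ 2" "inj_on (\<lambda>A. \<Sum>e\<in>A. w e) F"
    using separating_weights[OF finite_all_pairs fF, of n] F_pairs by blast
  have "n \<le> 2 ^ L" using L by simp
  from solvable_strategy[OF solvable_all[OF this]]
  obtain qu ot where qu: "\<And>G. simple_graph n G \<Longrightarrow> indsub_correct n k H G (ot (answers qu G T))"
    unfolding T_def by blast
  \<comment> \<open>If no cograph has total \<open>s\<close>, this is an arbitrary set, and the test
    \<open>cand s \<in> F\<close> exposes it.\<close>
  define cand where "cand s = (SOME C. C \<in> F \<and> (\<Sum>e\<in>C. w e) = s)" for s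
  \<comment> \<open>\<open>None\<close> marks the first pass of a query, \<open>Some s\<close> the
    second, with \<open>s\<close> the total found by the first.\<close>
  define wt where "wt = (\<lambda>(bs, r) e. if e \<subseteq> qu bs then (case r of None \<Rightarrow> w e | Some s \<Rightarrow> if e \<in> cand s then 1 else Suc (n * n)) else 0)"
  have wt_simps: "wt (bs, None) e = (if e \<subseteq> qu bs then w e else 0)"
    "wt (bs, Some s) e = (if e \<subseteq> qu bs then if e \<in> cand s then 1 else Suc (n * n) else 0)" for bs s e
    by (simp_all add: wt_def)
  define upd where "upd = (\<lambda>(bs, r) (a :: nat). case r of None \<Rightarrow> (bs, Some a) | Some s \<Rightarrow>
     if length bs < T then (bs @ [cand s \<in> F \<and> a = card (cand s) \<and> free (qu bs) (cand s)], None) else (bs, None))"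
  define K where "K = n * n * (card F ^ 2 + Suc (n * n))"
  define X where "X = {bs :: bool list. length bs \<le> T} \<times> (insert None (Some ` {..K}))"
  have fin_lists: "finite {bs :: bool list. length bs \<le> T}"
    using finite_lists_length_le[of "UNIV :: bool set" T] by simp
  have "card X * Suc K \<le> 2 ^ S"
  proof -
    define E where "E = (4 * L + 2) * n"
    have n2: "n * n \<le> 2 ^ (2 * L)"
    proof -
      have "n * n \<le> 2 ^ L * 2 ^ L" using L by (intro mult_le_mono) auto
      then show ?thesis by (simp add: mult_2 power_add)
    qed
    have "card F \<le> (2 * n ^ 2) ^ n" unfolding F_def using card_cographs[of "{..<n}"] by simp
    also have "\<dots> \<le> (2 ^ (2 * L + 1)) ^ n"
      using n2 by (intro power_mono) (simp_all add: power2_eq_square)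
    finally have "card F ^ 2 \<le> ((2 ^ (2 * L + 1)) ^ n) ^ 2" by (rule power_mono) simp
    also have "\<dots> = 2 ^ ((2 * L + 1) * n * 2)" by (simp only: power_mult)
    also have "(2 * L + 1) * n * 2 = E" by (simp add: E_def algebra_simps)
    finally have "card F ^ 2 \<le> 2 ^ E" .
    moreover have "Suc (n * n) \<le> 2 ^ (2 * L)"
    proof -
      have "Suc (n * n) \<le> Suc n * Suc n" by simp
      also have "\<dots> \<le> 2 ^ L * 2 ^ L" using L by (intro mult_le_mono)
      finally show ?thesis by (simp add: power_add mult_2)
    qed
    moreover have "2 ^ E * 1 \<le> 2 ^ E * (2 :: nat) ^ (2 * L)" by (rule mult_le_mono2) simp
    moreover have "1 * 2 ^ (2 * L) \<le> 2 ^ E * (2 :: nat) ^ (2 * L)" by (rule mult_le_mono1) simp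
    ultimately have "card F ^ 2 + Suc (n * n) \<le> 2 * (2 ^ E * 2 ^ (2 * L))" by linarith
    then have "K \<le> 2 ^ (2 * L) * (2 * (2 ^ E * 2 ^ (2 * L)))" unfolding K_def by (rule mult_le_mono[OF n2])
    also have "\<dots> = 2 * 2 ^ (E + (2 * L + 2 * L))" by (simp only: power_add mult_ac)
    finally have K: "K \<le> 2 * 2 ^ (E + 4 * L)" by simp
    have one: "1 \<le> (2 :: nat) ^ (E + 4 * L)" by simp
    have K3: "2 ^ (E + 4 * L + 3) = 8 * (2 :: nat) ^ (E + 4 * L)" by (simp add: power_add)
    have "card X \<le> 2 ^ Suc T * Suc (Suc K)"
    proof -
      have "card (insert None (Some ` {..K})) \<le> Suc (card (Some ` {..K}))" by (rule card_insert_le_m1) auto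
      also have "\<dots> = Suc (Suc K)" by (simp add: card_image)
      finally show ?thesis unfolding X_def card_cartesian_product using card_bool_lists by (intro mult_le_mono)
    qed
    then have "card X * Suc K \<le> (2 ^ Suc T * Suc (Suc K)) * Suc K" by (rule mult_le_mono1)
    also have "\<dots> \<le> (2 ^ Suc T * 2 ^ (E + 4 * L + 3)) * 2 ^ (E + 4 * L + 3)"
      using K one K3 by (intro mult_le_mono) linarith+
    also have "\<dots> = 2 ^ S" by (simp only: S_def E_def[symmetric] power_add[symmetric] mult_2 add.assoc)
    finally show ?thesis .
  qed
  moreover have "finite X" using fin_lists by (simp add: X_def)
  moreover have "([], None) \<in> X" by (simp add: X_def)
  moreover have "upd x a \<in> X" if "x \<in> X" "a \<le> K" for x a
    using that by (auto simp: X_def upd_def split: option.splits)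
  moreover have "(\<Sum>e\<in>G. wt x e) \<le> K" if G: "simple_graph n G" for x G
  proof -
    have "w e \<le> card F ^ 2 + Suc (n * n)" for e using w(1)[of e] by simp
    then have "(\<Sum>e\<in>G. wt x e) \<le> (\<Sum>e\<in>G. card F ^ 2 + Suc (n * n))"
      by (intro sum_mono) (simp add: wt_def split: option.splits prod.splits)
    also have "\<dots> = card G * (card F ^ 2 + Suc (n * n))" by simp
    also have "\<dots> \<le> K"
    proof -
      have "card G \<le> n * n"
      using card_mono[OF finite_all_pairs, of G n] G card_all_pairs[of n] by (simp add: simple_graph_def)
      then show ?thesis unfolding K_def by (rule mult_le_mono1)
    qed
    finally show ?thesis .
  qed
  ultimately obtain A where A: "space_bounded S A" "\<And>p G es. simple_graph n G \<Longrightarrow> is_stream G es \<Longrightarrow>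
       run A p es = (\<lambda>x. ot (fst x)) (((\<lambda>x. upd x (\<Sum>e\<in>G. wt x e)) ^^ p) ([], None))"
    using salg_of_sums[of X K S "([], None)" upd n wt "\<lambda>x. ot (fst x)"] by blast
  have round: "upd (upd (bs, None) (\<Sum>e\<in>G. wt (bs, None) e)) (\<Sum>e\<in>G. wt (upd (bs, None) (\<Sum>e\<in>G. wt (bs, None) e)) e)
      = (bs @ [free (qu bs) G], None)" if G: "simple_graph n G" and bs: "length bs < T" for G bs
  proof -
    let ?A = "{e\<in>G. e \<subseteq> qu bs}"
    define s where "s = (\<Sum>e\<in>?A. w e)"
    have fG: "finite G" using G finite_all_pairs finite_subset by (auto simp: simple_graph_def)
    have s: "(\<Sum>e\<in>G. wt (bs, None) e) = s"
      unfolding s_def wt_simps sum.inter_filter[OF fG] ..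
    define a where "a = (\<Sum>e\<in>?A. if e \<in> cand s then 1 else Suc (n * n))"
    have a: "(\<Sum>e\<in>G. wt (bs, Some s) e) = a"
      unfolding a_def wt_simps sum.inter_filter[OF fG] ..
    have "(cand s \<in> F \<and> a = card (cand s) \<and> free (qu bs) (cand s)) \<longleftrightarrow> free (qu bs) G"
    proof (cases "?A \<in> F")
      case True
      then have "cand s \<in> F \<and> (\<Sum>e\<in>cand s. w e) = s"
        unfolding cand_def by (intro someI[of "\<lambda>C. C \<in> F \<and> (\<Sum>e\<in>C. w e) = s" ?A]) (simp add: s_def)
      then have c: "cand s = ?A" using inj_onD[OF w(2), of "cand s" ?A] True by (simp add: s_def)
      have "a = (\<Sum>e\<in>?A. 1)" unfolding a_def c by (intro sum.cong) auto
      then have "a = card ?A" by simp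
      then show ?thesis using True free_restrict unfolding c by simp
    next
      case False
      \<comment> \<open>A cograph of the same weight may exist although the queried subgraph is
        none; the second pass unmasks it.\<close>
      have "\<not> (cand s \<in> F \<and> a = card (cand s))"
      proof
        assume *: "cand s \<in> F \<and> a = card (cand s)"
        have "cand s \<subseteq> all_pairs n" using F_pairs * by blast
        then have "finite (cand s)" "card (cand s) \<le> n * n"
          using finite_all_pairs[of n] card_mono[of "all_pairs n" "cand s"] card_all_pairs[of n]
          by (auto intro: finite_subset)
        then have "?A = cand s" using * fG by (intro equal_if_weight_eq_card[of _ _ "n * n"]) (auto simp: a_def)
        with False * show False by simp
      qed
      moreover have "\<not> free (qu bs) G" using not_free_if_not_cograph[OF G] False by (simp add: F_def)
      ultimately show ?thesis by blast
    qed
    then show ?thesis unfolding s by (simp add: upd_def a bs)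
  qed
  have iter: "((\<lambda>x. upd x (\<Sum>e\<in>G. wt x e)) ^^ (2 * t)) ([], None) = (answers qu G t, None)"
    if G: "simple_graph n G" and "t \<le> T" for G t
    using that(2)
  proof (induction t)
    case (Suc t)
    have "length (answers qu G t) < T" using Suc.prems by (simp add: length_answers)
    from round[OF G this] Suc show ?case by simp
  qed simp
  have "indsub_correct n k H G (run A (2 * T) es)" if "simple_graph n G" "is_stream G es" for G es
    using that A(2) iter qu by simp
  then have "det_solves n k H (2 * T) S A" using A(1) by (auto simp: det_solves_def)
  then show ?thesis unfolding T_def S_def by blast
qed

end

section \<open>Asymptotics of the upper bound\<close>

lemma upper_bound:
  assumes pattern: "path_pattern k H"
  shows "\<exists>q :: nat \<Rightarrow> nat. \<exists>c :: real.
      (\<lambda>n. real (q n)) \<in> O(\<lambda>n. ln (real n) powr c) \<and>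
      (\<forall>n. \<exists>S A. det_solves n k H (q n) S A) \<and>
      (\<lambda>n. real (Dspace k H n (q n))) \<in> O(\<lambda>n. real n * ln (real n) powr c)"
proof -
  interpret path_pattern n k H for n by (rule pattern)
  define L where "L n = nat \<lceil>log 2 (real (Suc n))\<rceil>" for n
  have L: "Suc n \<le> 2 ^ L n" for n
  proof -
    have "log 2 (real (Suc n)) \<le> real (L n)" unfolding L_def by linarith
    then have "real (Suc n) \<le> 2 powr real (L n)" by (subst (asm) log_le_iff) auto
    then have "real (Suc n) \<le> real (2 ^ L n)" by (simp add: powr_realpow)
    then show ?thesis by (simp only: of_nat_le_iff)
  qed
  define q where "q n = 2 * Suc (k * L n)" for n
  define S where "S n = Suc (Suc (k * L n)) + 2 * ((4 * L n + 2) * n + 4 * L n + 3)" for n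
  have ex: "\<exists>A. det_solves n k H (q n) (S n) A" for n
    using det_solves_exists[OF L] unfolding q_def S_def .
  have D: "Dspace k H n (q n) \<le> S n" for n
    unfolding Dspace_def using ex by (rule Least_le)
  \<comment> \<open>For \<open>n\<close> \<ge> 2 both \<open>Suc n\<close> \<le> n^2 and the ceiling
    are cheap, giving \<open>L n\<close> \<le> 3 log 2 n; and 3 / ln 2 < 5.\<close>
  have Lln: "1 \<le> L n" "real (L n) \<le> 5 * ln (real n)" if "n \<ge> 2" for n
  proof -
    have "log 2 (real (Suc n)) \<ge> log 2 2" using that by (subst log_le_cancel_iff) auto
    then have "log 2 (real (Suc n)) \<ge> 1" by simp
    then show "1 \<le> L n" unfolding L_def by linarith
    have "Suc n \<le> n * n" using that by (cases n) (auto simp: algebra_simps)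
    then have "real (Suc n) \<le> real n * real n" by (metis of_nat_le_iff of_nat_mult)
    then have "log 2 (real (Suc n)) \<le> log 2 (real n * real n)" using that by (subst log_le_cancel_iff) auto
    also have "\<dots> = 2 * log 2 (real n)" using that by (simp add: log_mult)
    finally have 1: "log 2 (real (Suc n)) \<le> 2 * log 2 (real n)" .
    have "log 2 (real n) \<ge> log 2 2" using that by (subst log_le_cancel_iff) auto
    then have "log 2 (real n) \<ge> 1" by simp
    moreover have "real (L n) \<le> log 2 (real (Suc n)) + 1" using \<open>log 2 (real (Suc n)) \<ge> 1\<close> unfolding L_def by linarith
    ultimately have "real (L n) \<le> 3 * log 2 (real n)" using 1 by linarith
    also have "\<dots> \<le> 5 * ln (real n)"
    proof -
      have "3 / ln (2::real) \<le> 5" using ln2_ge_two_thirds by (simp add: field_simps)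
      then have "3 / ln 2 * ln (real n) \<le> 5 * ln (real n)" using that by (intro mult_right_mono) auto
      then show ?thesis by (simp add: log_def)
    qed
    finally show "real (L n) \<le> 5 * ln (real n)" .
  qed
  have q_le: "real (q n) \<le> (10 * real k + 10) * norm (ln (real n) powr 1)" if n: "n \<ge> 2" for n
  proof -
    have "q n \<le> 2 * (k + 1) * L n" using Lln(1)[OF n] by (simp add: q_def)
    then have "real (q n) \<le> 2 * (k + 1) * real (L n)" by (metis of_nat_le_iff of_nat_mult)
    also have "\<dots> \<le> 2 * (k + 1) * (5 * ln (real n))" using Lln(2)[OF n] by (intro mult_left_mono) auto
    finally show ?thesis using n by (simp add: algebra_simps)
  qed
  have S_le: "real (Dspace k H n (q n)) \<le> (5 * real k + 170) * norm (real n * ln (real n) powr 1)" if n: "n \<ge> 2" for n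
  proof -
    have l: "1 \<le> L n" by (rule Lln(1)[OF n])
    have "1 * 1 \<le> n * L n" "1 * L n \<le> n * L n" "n * 1 \<le> n * L n"
      using n l by (intro mult_le_mono; simp)+
    then have b: "1 \<le> n * L n" "L n \<le> n * L n" "n \<le> n * L n" by simp_all
    have "k * L n \<le> k * (n * L n)" using b(2) by (rule mult_le_mono2)
    moreover have "S n = 8 + k * L n + 8 * (n * L n) + 4 * n + 8 * L n" unfolding S_def by (simp add: algebra_simps)
    moreover have "(k + 34) * (n * L n) = k * (n * L n) + 34 * (n * L n)" by (simp add: algebra_simps)
    ultimately have "S n \<le> (k + 34) * (n * L n)" using b by linarith
    then have "real (Dspace k H n (q n)) \<le> real ((k + 34) * (n * L n))" using D[of n] by linarith
    also have "\<dots> = (k + 34) * (n * real (L n))" by simp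
    also have "\<dots> \<le> (k + 34) * (n * (5 * ln (real n)))" using Lln(2)[OF n] by (intro mult_left_mono) auto
    finally show ?thesis using n by (simp add: algebra_simps)
  qed
  have "(\<lambda>n. real (q n)) \<in> O(\<lambda>n. ln (real n) powr 1)"
  proof (rule landau_o.bigI)
    show "10 * real k + 10 > 0" by simp
    show "\<forall>\<^sub>F n in sequentially. norm (real (q n)) \<le> (10 * real k + 10) * norm (ln (real n) powr 1)"
      using q_le by (intro eventually_sequentiallyI[of 2]) simp
  qed
  moreover have "(\<lambda>n. real (Dspace k H n (q n))) \<in> O(\<lambda>n. real n * ln (real n) powr 1)"
  proof (rule landau_o.bigI)
    show "5 * real k + 170 > 0" by simp
    show "\<forall>\<^sub>F n in sequentially. norm (real (Dspace k H n (q n))) \<le> (5 * real k + 170) * norm (real n * ln (real n) powr 1)"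
      using S_le by (intro eventually_sequentiallyI[of 2]) simp
  qed
  ultimately show ?thesis using ex by blast
qed

section \<open>Classification of the patterns\<close>

lemma path_graph_iff:
  assumes "x < l" "y < l"
  shows "{x, y} \<in> path_graph l \<longleftrightarrow> x + 1 = y \<or> y + 1 = x"
  using assms by (auto simp: path_graph_def doubleton_eq_iff)

lemma graph_compl_iff:
  assumes "i < k" "j < k" "i \<noteq> j"
  shows "{i, j} \<in> graph_compl k H \<longleftrightarrow> {i, j} \<notin> H"
  using assms by (auto simp: graph_compl_def all_pairs_def)

lemma path_pattern_path:
  assumes "k \<ge> 1" "l \<le> 4" "graph_iso k H l (path_graph l)"
  shows "path_pattern k H"
proof
  show "k \<ge> 1" by fact
  from assms(3) obtain f where kl: "k = l" and f: "bij_betw f {..<k} {..<k}"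
    and fe: "\<And>i j. i < k \<Longrightarrow> j < k \<Longrightarrow> {i, j} \<in> H \<longleftrightarrow> {f i, f j} \<in> path_graph l"
    unfolding graph_iso_def by blast
  have fk: "f i < k" if "i < k" for i using bij_betwE[OF f] that by auto
  show "\<exists>g. inj_on g {..<k} \<and> g ` {..<k} \<subseteq> {..<4} \<and>
      (\<forall>i<k. \<forall>j<k. i \<noteq> j \<longrightarrow> ({i, j} \<in> H \<longleftrightarrow> g i + 1 = g j \<or> g j + 1 = (g i :: nat)))"
  proof (intro exI conjI allI impI)
    show "inj_on f {..<k}" using f by (simp add: bij_betw_def)
    show "f ` {..<k} \<subseteq> {..<4}" using fk kl assms(2) by fastforce
    show "{i, j} \<in> H \<longleftrightarrow> f i + 1 = f j \<or> f j + 1 = f i" if "i < k" "j < k" for i j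
      using fe[OF that] path_graph_iff[of "f i" l "f j"] fk that kl by simp
  qed
qed

lemma path_pattern_co_path:
  assumes "graph_iso k H 3 (graph_compl 3 (path_graph 3))"
  shows "path_pattern k H"
proof
  from assms obtain f where k3: "k = 3" and f: "bij_betw f {..<3} {..<3}"
    and fe: "\<And>i j. i < 3 \<Longrightarrow> j < 3 \<Longrightarrow> {i, j} \<in> H \<longleftrightarrow> {f i, f j} \<in> graph_compl 3 (path_graph 3)"
    unfolding graph_iso_def by blast
  have fk: "f i < 3" if "i < 3" for i using bij_betwE[OF f] that by auto
  have inj: "inj_on f {..<3}" using f by (simp add: bij_betw_def)
  show "k \<ge> 1" using k3 by simp
  \<comment> \<open>In the complement of the three-vertex path, 1 is isolated and 0, 2 are adjacent.
    They go to positions 3 and 0, 1 of the four-vertex path.\<close>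
  define h :: "nat \<Rightarrow> nat" where "h x = [0, 3, 1] ! x" for x
  have three: "{..<3::nat} = {0, 1, 2}" by auto
  have h_inj: "inj_on h {..<3}" unfolding three by (simp add: h_def inj_on_def)
  have "\<forall>x\<in>{0, 1, 2}. \<forall>y\<in>{0, 1, 2}. x \<noteq> y \<longrightarrow> (\<not> (x + 1 = y \<or> y + 1 = x) \<longleftrightarrow> h x + 1 = h y \<or> h y + 1 = h x)"
    by (simp add: h_def)
  then have he: "\<not> (x + 1 = y \<or> y + 1 = x) \<longleftrightarrow> h x + 1 = h y \<or> h y + 1 = h x" if "x < 3" "y < 3" "x \<noteq> y" for x y
    using that unfolding three[symmetric] by simp
  show "\<exists>g. inj_on g {..<k} \<and> g ` {..<k} \<subseteq> {..<4} \<and>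
      (\<forall>i<k. \<forall>j<k. i \<noteq> j \<longrightarrow> ({i, j} \<in> H \<longleftrightarrow> g i + 1 = g j \<or> g j + 1 = (g i :: nat)))"
    unfolding k3
  proof (intro exI conjI allI impI)
    show "inj_on (h \<circ> f) {..<3}"
      using inj h_inj fk by (intro comp_inj_on) (auto intro: inj_on_subset)
    have "h ` {..<3} \<subseteq> {..<4}" unfolding three by (simp add: h_def)
    then show "(h \<circ> f) ` {..<3} \<subseteq> {..<4}" using fk by fastforce
    fix i j :: nat assume ij: "i < 3" "j < 3" "i \<noteq> j"
    have ne: "f i \<noteq> f j" using inj_onD[OF inj, of i j] ij by auto
    have "{i, j} \<in> H \<longleftrightarrow> \<not> (f i + 1 = f j \<or> f j + 1 = f i)"
      using fe[OF ij(1,2)] graph_compl_iff[OF fk fk ne, of "path_graph 3"] path_graph_iff[OF fk fk] ij by simp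
    then show "{i, j} \<in> H \<longleftrightarrow> (h \<circ> f) i + 1 = (h \<circ> f) j \<or> (h \<circ> f) j + 1 = (h \<circ> f) i"
      using he[OF fk fk ne] ij by simp
  qed
qed

lemma lessThan_eq_distinct:
  assumes "distinct xs" "set xs \<subseteq> {..<k}" "length xs = (k :: nat)"
  shows "{..<k} = set xs"
proof -
  have "card (set xs) = card {..<k}" using assms distinct_card by force
  then show ?thesis using card_subset_eq[of "{..<k}" "set xs"] assms(2) by simp
qed

lemma simple_graph_no_loop: "simple_graph k H \<Longrightarrow> {v} \<notin> H"
  by (auto simp: simple_graph_def all_pairs_def doubleton_eq_iff dest: subsetD)

text \<open>The isomorphism sends the \<open>i\<close>-th vertex of the list to \<open>i\<close>.\<close>

lemma graph_iso_listI:
  assumes xs: "distinct xs" "set xs \<subseteq> {..<k}" "length xs = k"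
    and e: "\<And>i j. i < k \<Longrightarrow> j < k \<Longrightarrow> {xs ! i, xs ! j} \<in> H \<longleftrightarrow> {i, j} \<in> H'"
  shows "graph_iso k H k H'"
proof -
  have "bij_betw ((!) xs) {..<k} {..<k}"
    using bij_betw_nth[OF xs(1), of "{..<k}" "{..<k}"] lessThan_eq_distinct[OF xs] xs(3) by simp
  then obtain f where f: "bij_betw f {..<k} {..<k}" "\<And>x. x \<in> {..<k} \<Longrightarrow> xs ! f x = x"
    using bij_betw_inv_into[of "(!) xs"] by (metis bij_betw_inv_into_right)
  have "{i, j} \<in> H \<longleftrightarrow> {f i, f j} \<in> H'" if "i < k" "j < k" for i j
    using e[of "f i" "f j"] f(2)[of i] f(2)[of j] bij_betwE[OF f(1)] that by simp
  then show ?thesis using f(1) unfolding graph_iso_def by blast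
qed

lemma graph_iso_path_3:
  assumes "simple_graph 3 H" "distinct [u, v, w]" "{u, v, w} \<subseteq> {..<3}"
    and "{u, v} \<in> H" "{v, w} \<in> H" "{u, w} \<notin> H"
  shows "graph_iso 3 H 3 (path_graph 3)"
proof (rule graph_iso_listI)
  show "distinct [u, v, w]" "set [u, v, w] \<subseteq> {..<3}" "length [u, v, w] = 3" using assms by auto
  have three: "{..<3::nat} = {0, 1, 2}" by auto
  have "\<forall>i\<in>{0, 1, 2}. \<forall>j\<in>{0, 1, 2}. {[u, v, w] ! i, [u, v, w] ! j} \<in> H \<longleftrightarrow> i + 1 = j \<or> j + 1 = i"
    using assms simple_graph_no_loop[OF assms(1)] by (simp add: insert_commute)
  then show "{[u, v, w] ! i, [u, v, w] ! j} \<in> H \<longleftrightarrow> {i, j} \<in> path_graph 3" if "i < 3" "j < 3" for i j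
    using that path_graph_iff[OF that] unfolding three[symmetric] by simp
qed

lemma graph_iso_path_4:
  assumes "simple_graph 4 H" "distinct [u, v, w, x]" "{u, v, w, x} \<subseteq> {..<4}"
    and "{u, v} \<in> H" "{v, w} \<in> H" "{w, x} \<in> H" "{u, w} \<notin> H" "{v, x} \<notin> H" "{u, x} \<notin> H"
  shows "graph_iso 4 H 4 (path_graph 4)"
proof (rule graph_iso_listI)
  show "distinct [u, v, w, x]" "set [u, v, w, x] \<subseteq> {..<4}" "length [u, v, w, x] = 4" using assms by auto
  have four: "{..<4::nat} = {0, 1, 2, 3}" by auto
  have "\<forall>i\<in>{0, 1, 2, 3}. \<forall>j\<in>{0, 1, 2, 3}. {[u, v, w, x] ! i, [u, v, w, x] ! j} \<in> H \<longleftrightarrow> i + 1 = j \<or> j + 1 = i"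
    using assms simple_graph_no_loop[OF assms(1)] by (simp add: insert_commute numeral_2_eq_2 numeral_3_eq_3)
  then show "{[u, v, w, x] ! i, [u, v, w, x] ! j} \<in> H \<longleftrightarrow> {i, j} \<in> path_graph 4" if "i < 4" "j < 4" for i j
    using that path_graph_iff[OF that] unfolding four[symmetric] by simp
qed

lemma simple_graph_compl: "simple_graph k (graph_compl k H)"
  by (auto simp: simple_graph_def graph_compl_def)

lemma graph_iso_compl:
  assumes "simple_graph k H" and "graph_iso k (graph_compl k H) k H'"
  shows "graph_iso k H k (graph_compl k H')"
proof -
  obtain f where f: "bij_betw f {..<k} {..<k}"
    and fe: "\<And>i j. i < k \<Longrightarrow> j < k \<Longrightarrow> {i, j} \<in> graph_compl k H \<longleftrightarrow> {f i, f j} \<in> H'"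
    using assms(2) unfolding graph_iso_def by blast
  have "{i, j} \<in> H \<longleftrightarrow> {f i, f j} \<in> graph_compl k H'" if ij: "i < k" "j < k" for i j
  proof (cases "i = j")
    case True
    then show ?thesis
      using simple_graph_no_loop[OF assms(1)] simple_graph_no_loop[OF simple_graph_compl] by auto
  next
    case False
    have "f i < k" "f j < k" "f i \<noteq> f j"
      using bij_betwE[OF f] f ij False by (auto simp: bij_betw_def inj_on_def)
    then show ?thesis
      using fe[OF ij] graph_compl_iff[OF ij False, of H] graph_compl_iff[of "f i" k "f j" H'] by blast
  qed
  then show ?thesis using f unfolding graph_iso_def by blast
qed

text \<open>Suppose \<open>H\<close> and its complement are both 2-colourable. Two vertices that
  agree in both colours would be non-adjacent and adjacent at once, so colour pairs are distinct and
  \<open>k\<close> \<le> 4.\<close>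

lemma hard_pattern:
  assumes k: "k \<ge> 3" and H: "simple_graph k H"
    and not: "\<not> graph_iso k H 3 (path_graph 3)" "\<not> graph_iso k H 3 (graph_compl 3 (path_graph 3))"
      "\<not> graph_iso k H 4 (path_graph 4)"
  shows "hard k H"
proof (cases "two_colourable (edge H) {..<k} \<and> two_colourable (edge (graph_compl k H)) {..<k}")
  case False
  then show ?thesis
    using hard_non_bipartite[OF H] hard_non_bipartite[OF simple_graph_compl] hard_compl by blast
next
  case True
  then obtain col col' :: "nat \<Rightarrow> bool" where
    c: "\<forall>i\<in>{..<k}. \<forall>j\<in>{..<k}. edge H i j \<longrightarrow> col i \<noteq> col j" and
    c': "\<forall>i\<in>{..<k}. \<forall>j\<in>{..<k}. edge (graph_compl k H) i j \<longrightarrow> col' i \<noteq> col' j"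
    unfolding two_colourable_def by blast
  have col: "{i, j} \<notin> H" if "i < k" "j < k" "col i = col j" for i j
    using that c unfolding edge_def by blast
  have col': "{i, j} \<in> H" if "i < k" "j < k" "i \<noteq> j" "col' i = col' j" for i j
    using that c' graph_compl_iff[of i k j H] unfolding edge_def by blast
  have inj: "inj_on (\<lambda>i. (col i, col' i)) {..<k}"
  proof (rule inj_onI)
    fix i j assume "i \<in> {..<k}" "j \<in> {..<k}" "(col i, col' i) = (col j, col' j)"
    then show "i = j" using col[of i j] col'[of i j] by auto
  qed
  then have ck: "card ((\<lambda>i. (col i, col' i)) ` {..<k}) = k" by (simp add: card_image)
  have c4: "card (UNIV :: (bool \<times> bool) set) = 4" by (simp add: card_UNIV_bool card_cartesian_product flip: UNIV_Times_UNIV)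
  have "card ((\<lambda>i. (col i, col' i)) ` {..<k}) \<le> card (UNIV :: (bool \<times> bool) set)" by (rule card_mono) auto
  then consider "k = 3" | "k = 4" using k ck c4 by linarith
  then show ?thesis
  proof cases
    case 1
    \<comment> \<open>Among three vertices each colouring repeats a colour, so \<open>H\<close> is
      neither complete nor empty; what is left is a path or its complement.\<close>
    have non: "{0, 1} \<notin> H \<or> {0, 2} \<notin> H \<or> {1, 2} \<notin> H" using col[of 0 1] col[of 0 2] col[of 1 2] 1 by auto
    have edge: "{0, 1} \<in> H \<or> {0, 2} \<in> H \<or> {1, 2} \<in> H" using col'[of 0 1] col'[of 0 2] col'[of 1 2] 1 by auto
    have path: False if "distinct [u, v, w]" "{u, v, w} \<subseteq> {..<3}" "{u, v} \<in> H" "{v, w} \<in> H" "{u, w} \<notin> H" for u v w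
      using graph_iso_path_3[OF _ that] H not(1) 1 by simp
    have copath: False if "distinct [u, v, w]" "{u, v, w} \<subseteq> {..<3}" "{u, v} \<notin> H" "{v, w} \<notin> H" "{u, w} \<in> H" for u v w
    proof -
      have "{u, v} \<in> graph_compl 3 H" "{v, w} \<in> graph_compl 3 H" "{u, w} \<notin> graph_compl 3 H"
        using that graph_compl_iff[of _ 3] by auto
      then have "graph_iso 3 (graph_compl 3 H) 3 (path_graph 3)"
        using graph_iso_path_3[OF simple_graph_compl that(1,2)] by blast
      then show False using graph_iso_compl H not(2) 1 by blast
    qed
    show ?thesis
      using path[of 0 1 2] path[of 1 0 2] path[of 0 2 1] copath[of 0 1 2] copath[of 1 0 2] copath[of 0 2 1] non edge
      by (auto simp: insert_commute)
  next
    case 2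
    have "(\<lambda>i. (col i, col' i)) ` {..<k} = UNIV" using ck c4 2 by (intro card_subset_eq) auto
    then have ex: "\<exists>i<k. col i = s \<and> col' i = s'" for s s'
      by (metis (mono_tags, lifting) UNIV_I image_iff lessThan_iff prod.inject)
    obtain a b c d where v: "a < k" "b < k" "c < k" "d < k"
      and cols: "col a" "col' a" "col b" "\<not> col' b" "\<not> col c" "col' c" "\<not> col d" "\<not> col' d"
      using ex[of True True] ex[of True False] ex[of False True] ex[of False False] by auto
    have dist: "a \<noteq> b" "a \<noteq> c" "a \<noteq> d" "b \<noteq> c" "b \<noteq> d" "c \<noteq> d" using cols by auto
    have e: "{a, b} \<notin> H" "{c, d} \<notin> H" "{a, c} \<in> H" "{b, d} \<in> H"
      using col[of a b] col[of c d] col'[of a c] col'[of b d] v cols dist by auto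
    have H4: "simple_graph 4 H" and v4: "a < 4" "b < 4" "c < 4" "d < 4" using H v 2 by auto
    \<comment> \<open>Only a d and b c are undetermined: both present give the four-cycle a c b d,
      both absent its complement, exactly one a path.\<close>
    consider "{a, d} \<in> H" "{b, c} \<in> H" | "{a, d} \<notin> H" "{b, c} \<notin> H"
      | "{a, d} \<in> H" "{b, c} \<notin> H" | "{a, d} \<notin> H" "{b, c} \<in> H" by blast
    then show ?thesis
    proof cases
      case 1
      then have "hard 4 H"
        using hard_square[OF H4, of a c b d] v4 dist e by (auto simp: insert_commute)
      then show ?thesis using 2 by simp
    next
      case 2
      then have "hard 4 (graph_compl 4 H)"
        using hard_square[OF simple_graph_compl, of a b c d H] v4 dist e graph_compl_iff[of _ 4 _ H]
        by (auto simp: insert_commute)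
      then show ?thesis using hard_compl \<open>k = 4\<close> by blast
    next
      case 3
      then have "graph_iso 4 H 4 (path_graph 4)"
        using graph_iso_path_4[OF H4, of c a d b] v4 dist e by (auto simp: insert_commute)
      then show ?thesis using not(3) 2 by simp
    next
      case 4
      then have "graph_iso 4 H 4 (path_graph 4)"
        using graph_iso_path_4[OF H4, of a c b d] v4 dist e by (auto simp: insert_commute)
      then show ?thesis using not(3) 2 by simp
    qed
  qed
qed

theorem theorem5:
  fixes k :: nat and H :: "nat set set"
  assumes "k \<ge> 3" and "simple_graph k H"
  shows "((graph_iso k H 3 (path_graph 3) \<or> graph_iso k H 3 (graph_compl 3 (path_graph 3))
            \<or> graph_iso k H 4 (path_graph 4)) \<longrightarrow>
          (\<exists>q :: nat \<Rightarrow> nat. \<exists>c :: real.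
              (\<lambda>n. real (q n)) \<in> O(\<lambda>n. ln (real n) powr c) \<and>
              (\<forall>n. \<exists>S A. det_solves n k H (q n) S A) \<and>
              (\<lambda>n. real (Dspace k H n (q n))) \<in> O(\<lambda>n. real n * ln (real n) powr c)))
       \<and> ((\<not> graph_iso k H 3 (path_graph 3) \<and> \<not> graph_iso k H 3 (graph_compl 3 (path_graph 3))
            \<and> \<not> graph_iso k H 4 (path_graph 4)) \<longrightarrow>
          (\<forall>p :: nat \<Rightarrow> nat. (\<forall>n. p n \<ge> 1) \<longrightarrow>
              (\<lambda>n. real (Rspace k H n (p n))) \<in> \<Omega>(\<lambda>n. real n ^ 2 / real (p n))))"
proof (intro conjI impI allI)
  have k: "k \<ge> 1" using assms(1) by simp
  assume "graph_iso k H 3 (path_graph 3) \<or> graph_iso k H 3 (graph_compl 3 (path_graph 3)) \<or> graph_iso k H 4 (path_graph 4)"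
  then have "path_pattern k H"
    using path_pattern_path[OF k, of 3] path_pattern_path[OF k, of 4] path_pattern_co_path by auto
  then show "\<exists>q :: nat \<Rightarrow> nat. \<exists>c :: real.
              (\<lambda>n. real (q n)) \<in> O(\<lambda>n. ln (real n) powr c) \<and>
              (\<forall>n. \<exists>S A. det_solves n k H (q n) S A) \<and>
              (\<lambda>n. real (Dspace k H n (q n))) \<in> O(\<lambda>n. real n * ln (real n) powr c)"
    by (rule upper_bound)
next
  fix p :: "nat \<Rightarrow> nat"
  assume not: "\<not> graph_iso k H 3 (path_graph 3) \<and> \<not> graph_iso k H 3 (graph_compl 3 (path_graph 3)) \<and> \<not> graph_iso k H 4 (path_graph 4)"
    and p: "\<forall>n. p n \<ge> 1"
  have "hard k H" using hard_pattern[OF assms] not by blast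
  then show "(\<lambda>n. real (Rspace k H n (p n))) \<in> \<Omega>(\<lambda>n. real n ^ 2 / real (p n))"
    using assms(1) p by (intro hard_Rspace) auto
qed

end
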